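(* Let $M$ be a $C^r$ compact manifold, with $r\ge 1$, let $f\colon M\to M$ be a measurable function with measurable inverse, and let $\mu$ be a smooth volume form invariant under $f$. Suppose that for a $\mu$-integrable function $R\in L^\infty(M)$ satisfying $\int_M R\,d\mu=0$ and for $\phi\in C^r(M)$ the exponential decay of correlations $$\left|\int_M R(f^j(x))\,\phi(x)\,d\mu(x)\right|\le C_1 e^{-C_2|j|}\,|\phi|_{C^\gamma},\qquad j\in\mathbb{Z},$$ holds, where $C_1>0$ and $C_2>0$ are constants that depend neither on $j$ nor on $\phi$, and $|\phi|_{C^\gamma}$, with $\gamma>0$, is the usual Hölder norm of $\phi$. Then the Birkhoff sums $u_\alpha$ and $u_\omega$ given by $$u_\omega=\sum_{j=-\infty}^{-1}R\circ f^{j},\qquad u_\alpha=-\sum_{j=0}^{\infty}R\circ f^{j}$$ (as distributions) belong to the logarithmic Besov space $B^{0,-1}_{\infty,\infty}$. Moreover they are weak solutions of the cohomological equation $R=u\circ f-u$.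
   Context: Sums as distributions: $u_\omega(\phi)=\sum_{j=-\infty}^{-1}\int_M \phi\cdot R\circ f^j\,d\mu$ and $u_\alpha(\phi)=-\sum_{j=0}^\infty\int_M \phi\cdot R\circ f^j\,d\mu$ for test functions $\phi$. Weak solution: a distribution $u$ on $M$ is a weak solution of $R=u\circ f-u$ if for every test function $\phi\in C^\infty(M)$ one has $u(\phi\circ f^{-1})-u(\phi)=\int_M R\phi\,d\mu$ (this definition is formulated for $f$ a $C^\infty$ diffeomorphism). Logarithmic Besov space on $\mathbb{R}^n$: let $\psi_0\in C_c^\infty(\mathbb{R}^n)$ be radial, non-increasing along rays, $\psi_0(x)=1$ for $|x|<1$, $\psi_0(x)=0$ for $|x|>2$. Put $\psi(x)=\psi_0(x)-\psi_0(2x)$ and $\psi_\ell(x)=\psi(x/2^\ell)$ for $\ell\ge 1$. For a tempered distribution $u$ let $\psi_\ell(D)u=\mathcal{F}^{-1}(\psi_\ell\hat u)$, where $\hat u$ is the Fourier transform and $\mathcal F^{-1}$ its inverse. For $s,b\in\mathbb{R}$, $B^{s,b}_{\infty,\infty}$ is the set of tempered distributions $u$ with $\sup_{\ell\ge0}2^{\ell s}(1+\ell)^b\sup_x|\psi_\ell(D)u(x)|<\infty$. On the compact $n$-dimensional manifold $M$: cover $M$ by finitely many coordinate patches $U_i$ with coordinates in which $\mu=dx_1\wedge\dots\wedge dx_n$, and take a partition of unity $\chi_i$ with $\mathrm{supp}\,\chi_i\subset U_i$. A distribution $u$ on $M$ belongs to $B^{s,b}_{\infty,\infty}$ if each $\chi_i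 u$ (defined by $(\chi_iu)(\phi)=u(\chi_i\phi)$), viewed in coordinates as a compactly supported distribution on $\mathbb{R}^n$, belongs to $B^{s,b}_{\infty,\infty}$. *)

theory Defs
  imports "HOL-Analysis.Analysis"
begin

section \<open>Functions of class \<open>C\<^sup>k\<close> on open subsets of Euclidean space\<close>

text \<open>Both predicates are meant for open \<open>U\<close>; the order \<open>r\<close> ranges over \<open>0, 1, 2, \<dots>, \<infinity>\<close>.\<close>

primrec Ck_on :: "nat \<Rightarrow> 'a::real_normed_vector set \<Rightarrow> ('a \<Rightarrow> 'b::real_normed_vector) \<Rightarrow> bool" where
  "Ck_on 0 U g \<longleftrightarrow> continuous_on U g"
| "Ck_on (Suc k) U g \<longleftrightarrow>
     (\<forall>x\<in>U. g differentiable (at x)) \<and> (\<forall>v. Ck_on k U (\<lambda>x. frechet_derivative g (at x) v))"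

definition Cr_on :: "enat \<Rightarrow> 'a::real_normed_vector set \<Rightarrow> ('a \<Rightarrow> 'b::real_normed_vector) \<Rightarrow> bool" where
  "Cr_on r U g \<longleftrightarrow> (\<forall>k. enat k \<le> r \<longrightarrow> Ck_on k U g)"

text \<open>Iterated partial derivatives; a multi-index is given as a list of coordinate directions.\<close>

primrec partials :: "'n::finite list \<Rightarrow> (real^'n \<Rightarrow> 'b::real_normed_vector) \<Rightarrow> real^'n \<Rightarrow> 'b" where
  "partials [] g = g"
| "partials (i # is) g = (\<lambda>x. frechet_derivative (partials is g) (at x) (axis i 1))"

definition Ck_norm :: "nat \<Rightarrow> (real^'n::finite \<Rightarrow> 'b::real_normed_vector) \<Rightarrow> real" where
  "Ck_norm k g = (\<Sum>is\<in>{is :: 'n list. length is \<le> k}. SUP x. norm (partials is g x))"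

definition holder_seminorm :: "real \<Rightarrow> (real^'n::finite \<Rightarrow> 'b::real_normed_vector) \<Rightarrow> real" where
  "holder_seminorm \<delta> g =
     (SUP z\<in>{z :: (real^'n) \<times> (real^'n). fst z \<noteq> snd z}.
        norm (g (fst z) - g (snd z)) / norm (fst z - snd z) powr \<delta>)"

text \<open>The exponent is split as \<open>\<gamma> = k + \<delta>\<close> with \<open>0 < \<delta> \<le> 1\<close>.  Thus an integer \<open>\<gamma>\<close> gives the
  \<open>C\<^sup>k\<^sup>,\<^sup>1\<close> norm with \<open>k = \<gamma> - 1\<close>, which on functions of class \<open>C\<^sup>\<gamma>\<close> is equivalent to the
  \<open>C\<^sup>\<gamma>\<close> norm.\<close>

definition holder_norm :: "real \<Rightarrow> (real^'n::finite \<Rightarrow> 'b::real_normed_vector) \<Rightarrow> real" where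
  "holder_norm \<gamma> g =
     (let k = nat \<lceil>\<gamma>\<rceil> - 1; \<delta> = \<gamma> - real k in
        Ck_norm k g + (\<Sum>is\<in>{is :: 'n list. length is = k}. holder_seminorm \<delta> (partials is g)))"


section \<open>Tempered distributions and the logarithmic Besov spaces on \<open>\<real>\<^sup>n\<close>\<close>

definition schwartz :: "(real^'n::finite \<Rightarrow> complex) set" where
  "schwartz = {\<phi>. Cr_on \<infinity> UNIV \<phi> \<and>
     (\<forall>N is. bounded (range (\<lambda>x. (1 + norm x) ^ N *\<^sub>R partials is \<phi> x)))}"

definition schwartz_norm :: "nat \<Rightarrow> (real^'n::finite \<Rightarrow> complex) \<Rightarrow> real" where
  "schwartz_norm N \<phi> =
     (\<Sum>is\<in>{is :: 'n list. length is \<le> N}. SUP x. (1 + norm x) ^ N * norm (partials is \<phi> x))"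

definition tempered :: "((real^'n::finite \<Rightarrow> complex) \<Rightarrow> complex) \<Rightarrow> bool" where
  "tempered u \<longleftrightarrow>
     (\<forall>\<phi>\<in>schwartz. \<forall>\<theta>\<in>schwartz. \<forall>a b. u (\<lambda>x. a * \<phi> x + b * \<theta> x) = a * u \<phi> + b * u \<theta>) \<and>
     (\<exists>N C. \<forall>\<phi>\<in>schwartz. norm (u \<phi>) \<le> C * schwartz_norm N \<phi>)"

definition fourier :: "(real^'n::finite \<Rightarrow> complex) \<Rightarrow> real^'n \<Rightarrow> complex" where
  "fourier \<phi> \<xi> = (\<integral>x. cis (- (x \<bullet> \<xi>)) * \<phi> x \<partial>lborel)"

definition inv_fourier :: "(real^'n::finite \<Rightarrow> complex) \<Rightarrow> real^'n \<Rightarrow> complex" where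
  "inv_fourier \<phi> x = of_real (1 / (2 * pi) ^ CARD('n)) * (\<integral>\<xi>. cis (x \<bullet> \<xi>) * \<phi> \<xi> \<partial>lborel)"

definition dist_fourier ::
  "((real^'n::finite \<Rightarrow> complex) \<Rightarrow> complex) \<Rightarrow> (real^'n \<Rightarrow> complex) \<Rightarrow> complex" where
  "dist_fourier u \<phi> = u (fourier \<phi>)"

definition dist_inv_fourier ::
  "((real^'n::finite \<Rightarrow> complex) \<Rightarrow> complex) \<Rightarrow> (real^'n \<Rightarrow> complex) \<Rightarrow> complex" where
  "dist_inv_fourier u \<phi> = u (inv_fourier \<phi>)"

definition dist_times ::
  "(real^'n::finite \<Rightarrow> real) \<Rightarrow> ((real^'n \<Rightarrow> complex) \<Rightarrow> complex) \<Rightarrow> (real^'n \<Rightarrow> complex) \<Rightarrow> complex" where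
  "dist_times \<psi> u \<phi> = u (\<lambda>x. of_real (\<psi> x) * \<phi> x)"

text \<open>The Fourier multiplier \<open>\<psi>(D) u\<close>.\<close>

definition multiplier ::
  "(real^'n::finite \<Rightarrow> real) \<Rightarrow> ((real^'n \<Rightarrow> complex) \<Rightarrow> complex) \<Rightarrow> (real^'n \<Rightarrow> complex) \<Rightarrow> complex" where
  "multiplier \<psi> u = dist_inv_fourier (dist_times \<psi> (dist_fourier u))"

definition lp_cutoff :: "(real^'n::finite \<Rightarrow> real) \<Rightarrow> bool" where
  "lp_cutoff \<psi>0 \<longleftrightarrow> Cr_on \<infinity> UNIV \<psi>0 \<and>
     (\<forall>x y. norm x = norm y \<longrightarrow> \<psi>0 x = \<psi>0 y) \<and>
     (\<forall>x s t. 0 \<le> s \<and> s \<le> t \<longrightarrow> \<psi>0 (t *\<^sub>R x) \<le> \<psi>0 (s *\<^sub>R x)) \<and>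
     (\<forall>x. norm x < 1 \<longrightarrow> \<psi>0 x = 1) \<and> (\<forall>x. norm x > 2 \<longrightarrow> \<psi>0 x = 0)"

definition lp_piece :: "(real^'n::finite \<Rightarrow> real) \<Rightarrow> nat \<Rightarrow> real^'n \<Rightarrow> real" where
  "lp_piece \<psi>0 l x =
     (if l = 0 then \<psi>0 x else \<psi>0 ((1 / 2 ^ l) *\<^sub>R x) - \<psi>0 (2 *\<^sub>R ((1 / 2 ^ l) *\<^sub>R x)))"

text \<open>The distribution \<open>v\<close> is the continuous function \<open>g\<close>; such a \<open>g\<close> is unique.\<close>

definition represented_by ::
  "((real^'n::finite \<Rightarrow> complex) \<Rightarrow> complex) \<Rightarrow> (real^'n \<Rightarrow> complex) \<Rightarrow> bool" where
  "represented_by v g \<longleftrightarrow> continuous_on UNIV g \<and>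
     (\<forall>\<phi>\<in>schwartz. integrable lborel (\<lambda>x. g x * \<phi> x) \<and> v \<phi> = (\<integral>x. g x * \<phi> x \<partial>lborel))"

definition log_besov ::
  "(real^'n::finite \<Rightarrow> real) \<Rightarrow> real \<Rightarrow> real \<Rightarrow> ((real^'n \<Rightarrow> complex) \<Rightarrow> complex) set" where
  "log_besov \<psi>0 s b = {u. tempered u \<and>
     (\<exists>C. \<forall>l. \<exists>g. represented_by (multiplier (lp_piece \<psi>0 l) u) g \<and>
        (\<forall>x. 2 powr (real l * s) * (1 + real l) powr b * norm (g x) \<le> C))}"


section \<open>\<open>C\<^sup>r\<close> manifolds\<close>

text \<open>The underlying space of the manifold is a whole type \<open>'m\<close>.  A chart is a pair of its domain
  and its coordinate map; the values of the coordinate map off the domain are irrelevant.\<close>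

type_synonym ('m, 'n) chart = "'m set \<times> ('m \<Rightarrow> real^'n)"

abbreviation dom_of :: "('m, 'n) chart \<Rightarrow> 'm set" where "dom_of c \<equiv> fst c"
abbreviation coord :: "('m, 'n) chart \<Rightarrow> 'm \<Rightarrow> real^'n" where "coord c \<equiv> snd c"
abbreviation img_of :: "('m, 'n) chart \<Rightarrow> (real^'n) set" where "img_of c \<equiv> coord c ` dom_of c"
abbreviation point_of :: "('m, 'n) chart \<Rightarrow> real^'n \<Rightarrow> 'm" where
  "point_of c \<equiv> inv_into (dom_of c) (coord c)"

definition is_chart :: "('m::topological_space, 'n::finite) chart \<Rightarrow> bool" where
  "is_chart c \<longleftrightarrow> open (dom_of c) \<and> open (img_of c) \<and>
     (\<exists>g. homeomorphism (dom_of c) (img_of c) (coord c) g)"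

definition transition_Cr ::
  "enat \<Rightarrow> ('m, 'n::finite) chart \<Rightarrow> ('m, 'n) chart \<Rightarrow> bool" where
  "transition_Cr r c d \<longleftrightarrow>
     Cr_on r (coord c ` (dom_of c \<inter> dom_of d)) (\<lambda>x. coord d (point_of c x))"

definition Cr_atlas :: "enat \<Rightarrow> ('m::topological_space, 'n::finite) chart set \<Rightarrow> bool" where
  "Cr_atlas r A \<longleftrightarrow> (\<forall>c\<in>A. is_chart c) \<and> (\<forall>c\<in>A. \<forall>d\<in>A. transition_Cr r c d) \<and>
     (\<Union>c\<in>A. dom_of c) = UNIV"

text \<open>The maximal \<open>C\<^sup>r\<close> atlas determined by \<open>A\<close>.\<close>

definition charts :: "enat \<Rightarrow> ('m::topological_space, 'n::finite) chart set \<Rightarrow> ('m, 'n) chart set" where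
  "charts r A = {c. is_chart c \<and> (\<forall>d\<in>A. transition_Cr r c d \<and> transition_Cr r d c)}"

definition Cr_fun ::
  "enat \<Rightarrow> ('m::topological_space, 'n::finite) chart set \<Rightarrow> ('m \<Rightarrow> 'b::real_normed_vector) set" where
  "Cr_fun r A = {\<phi>. \<forall>c\<in>A. Cr_on r (img_of c) (\<lambda>x. \<phi> (point_of c x))}"

text \<open>A finite cover by coordinate patches together with a subordinate \<open>C\<^sup>r\<close> partition of unity.\<close>

definition chart_system ::
  "enat \<Rightarrow> ('m::topological_space, 'n::finite) chart set \<Rightarrow>
     (('m, 'n) chart \<times> ('m \<Rightarrow> real)) list \<Rightarrow> bool" where
  "chart_system r A S \<longleftrightarrow>
     (\<forall>(c, \<eta>)\<in>set S. c \<in> charts r A \<and> \<eta> \<in> Cr_fun r A \<and> (\<forall>p. 0 \<le> \<eta> p) \<and>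
        closure {p. \<eta> p \<noteq> 0} \<subseteq> dom_of c) \<and>
     (\<forall>p. (\<Sum>(c, \<eta>)\<leftarrow>S. \<eta> p) = 1)"

text \<open>The function \<open>\<eta> \<phi>\<close> in the coordinates \<open>c\<close>, extended by zero to the whole of \<open>\<real>\<^sup>n\<close>.\<close>

definition localize ::
  "('m, 'n::finite) chart \<Rightarrow> ('m \<Rightarrow> real) \<Rightarrow> ('m \<Rightarrow> 'b::real_normed_vector) \<Rightarrow> real^'n \<Rightarrow> 'b" where
  "localize c \<eta> \<phi> x =
     (if x \<in> img_of c then \<eta> (point_of c x) *\<^sub>R \<phi> (point_of c x) else 0)"

text \<open>Norms on the compact manifold; different chart systems give equivalent norms on
  \<open>C\<^sup>r\<close> functions as long as \<open>k \<le> r\<close> and \<open>\<gamma> \<le> r\<close>, respectively.\<close>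

definition Ck_norm_on ::
  "(('m, 'n::finite) chart \<times> ('m \<Rightarrow> real)) list \<Rightarrow> nat \<Rightarrow> ('m \<Rightarrow> 'b::real_normed_vector) \<Rightarrow> real" where
  "Ck_norm_on S k \<phi> = (\<Sum>(c, \<eta>)\<leftarrow>S. Ck_norm k (localize c \<eta> \<phi>))"

definition holder_norm_on ::
  "(('m, 'n::finite) chart \<times> ('m \<Rightarrow> real)) list \<Rightarrow> real \<Rightarrow> ('m \<Rightarrow> 'b::real_normed_vector) \<Rightarrow> real" where
  "holder_norm_on S \<gamma> \<phi> = (\<Sum>(c, \<eta>)\<leftarrow>S. holder_norm \<gamma> (localize c \<eta> \<phi>))"


section \<open>Volume forms\<close>

text \<open>A form of top degree is given by its coefficients: \<open>\<omega> c\<close> is the function with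
  \<open>\<omega> = \<omega> c dx\<^sub>1 \<and> \<dots> \<and> dx\<^sub>n\<close> in the coordinates \<open>c\<close>.

  On a \<open>C\<^sup>r\<close> manifold with finite \<open>r\<close> smoothness of the coefficient is not preserved by the
  transition maps, so a volume form is called smooth if near every point it has a smooth
  coefficient in some chart of the \<open>C\<^sup>r\<close> structure.  For \<open>r = \<infinity>\<close> the coefficients are then smooth
  in all charts.\<close>

definition smooth_volume_form ::
  "enat \<Rightarrow> ('m::topological_space, 'n::finite) chart set \<Rightarrow> (('m, 'n) chart \<Rightarrow> 'm \<Rightarrow> real) \<Rightarrow> bool" where
  "smooth_volume_form r A \<omega> \<longleftrightarrow>
     (\<forall>c\<in>charts r A. \<forall>d\<in>charts r A. \<forall>p\<in>dom_of c \<inter> dom_of d.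
        \<omega> c p =
          det (matrix (frechet_derivative (\<lambda>x. coord d (point_of c x)) (at (coord c p)))) * \<omega> d p) \<and>
     (\<forall>c\<in>charts r A. \<forall>p\<in>dom_of c. \<omega> c p \<noteq> 0) \<and>
     (\<forall>p. \<exists>c\<in>charts r A. p \<in> dom_of c \<and> Cr_on \<infinity> (img_of c) (\<lambda>x. \<omega> c (point_of c x)))"

text \<open>\<open>\<mu>\<close> is the Borel measure given by integration of the volume form.\<close>

definition volume_measure ::
  "enat \<Rightarrow> ('m::topological_space, 'n::finite) chart set \<Rightarrow> (('m, 'n) chart \<Rightarrow> 'm \<Rightarrow> real) \<Rightarrow>
     'm measure \<Rightarrow> bool" where
  "volume_measure r A \<omega> \<mu> \<longleftrightarrow> sets \<mu> = sets borel \<and>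
     (\<forall>c\<in>charts r A. \<forall>E\<in>sets borel. E \<subseteq> dom_of c \<longrightarrow>
        emeasure \<mu> E =
          (\<integral>\<^sup>+x. ennreal \<bar>\<omega> c (point_of c x)\<bar> * indicator (coord c ` E) x \<partial>lborel))"

text \<open>Chart systems all of whose charts satisfy \<open>\<omega> = dx\<^sub>1 \<and> \<dots> \<and> dx\<^sub>n\<close>.\<close>

definition volume_chart_system ::
  "enat \<Rightarrow> ('m::topological_space, 'n::finite) chart set \<Rightarrow> (('m, 'n) chart \<Rightarrow> 'm \<Rightarrow> real) \<Rightarrow>
     (('m, 'n) chart \<times> ('m \<Rightarrow> real)) list \<Rightarrow> bool" where
  "volume_chart_system r A \<omega> S \<longleftrightarrow>
     chart_system r A S \<and> (\<forall>(c, \<eta>)\<in>set S. \<forall>p\<in>dom_of c. \<omega> c p = 1)"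


section \<open>Distributions and logarithmic Besov spaces on the manifold\<close>

text \<open>Continuous linear functionals on the space of complex-valued \<open>C\<^sup>r\<close> functions.  They are
  represented by functionals on all functions, of which only the restriction to \<open>C\<^sup>r\<close> functions
  matters here.\<close>

definition distribution_on ::
  "enat \<Rightarrow> ('m::topological_space, 'n::finite) chart set \<Rightarrow> (('m \<Rightarrow> complex) \<Rightarrow> complex) \<Rightarrow> bool" where
  "distribution_on r A u \<longleftrightarrow>
     (\<forall>\<phi>\<in>Cr_fun r A. \<forall>\<theta>\<in>Cr_fun r A. \<forall>a b.
        u (\<lambda>p. a * \<phi> p + b * \<theta> p) = a * u \<phi> + b * u \<theta>) \<and>
     (\<exists>S k C. chart_system r A S \<and> enat k \<le> r \<and>
        (\<forall>\<phi>\<in>Cr_fun r A. norm (u \<phi>) \<le> C * Ck_norm_on S k \<phi>))"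

text \<open>The distribution \<open>\<eta> u\<close> in the coordinates \<open>c\<close>.  Here \<open>\<eta>\<close> vanishes off the domain of \<open>c\<close>,
  so the test function below is the zero extension of \<open>\<eta> (\<phi> \<circ> c)\<close>.\<close>

definition coord_dist ::
  "('m, 'n::finite) chart \<Rightarrow> ('m \<Rightarrow> real) \<Rightarrow> (('m \<Rightarrow> complex) \<Rightarrow> complex) \<Rightarrow>
     (real^'n \<Rightarrow> complex) \<Rightarrow> complex" where
  "coord_dist c \<eta> u \<phi> = u (\<lambda>p. of_real (\<eta> p) * \<phi> (coord c p))"

text \<open>The membership condition is required for every admissible choice of coordinates and
  partition of unity; the existence of such a choice is part of the definition.\<close>

definition log_besov_on ::
  "enat \<Rightarrow> ('m::topological_space, 'n::finite) chart set \<Rightarrow> (('m, 'n) chart \<Rightarrow> 'm \<Rightarrow> real) \<Rightarrow>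
     (real^'n \<Rightarrow> real) \<Rightarrow> real \<Rightarrow> real \<Rightarrow> (('m \<Rightarrow> complex) \<Rightarrow> complex) set" where
  "log_besov_on r A \<omega> \<psi>0 s b = {u. distribution_on r A u \<and>
     (\<exists>S. volume_chart_system r A \<omega> S) \<and>
     (\<forall>S. volume_chart_system r A \<omega> S \<longrightarrow>
        (\<forall>(c, \<eta>)\<in>set S. coord_dist c \<eta> u \<in> log_besov \<psi>0 s b))}"


section \<open>Birkhoff sums and the cohomological equation\<close>

definition int_iter :: "('m \<Rightarrow> 'm) \<Rightarrow> int \<Rightarrow> 'm \<Rightarrow> 'm" where
  "int_iter f j = (if 0 \<le> j then f ^^ nat j else inv f ^^ nat (- j))"

definition birkhoff_term ::
  "'m measure \<Rightarrow> ('m \<Rightarrow> 'm) \<Rightarrow> ('m \<Rightarrow> real) \<Rightarrow> ('m \<Rightarrow> complex) \<Rightarrow> int \<Rightarrow> complex" where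
  "birkhoff_term \<mu> f R \<phi> j = (\<integral>x. \<phi> x * of_real (R (int_iter f j x)) \<partial>\<mu>)"

definition u_omega ::
  "'m measure \<Rightarrow> ('m \<Rightarrow> 'm) \<Rightarrow> ('m \<Rightarrow> real) \<Rightarrow> ('m \<Rightarrow> complex) \<Rightarrow> complex" where
  "u_omega \<mu> f R \<phi> = (\<Sum>k. birkhoff_term \<mu> f R \<phi> (- 1 - int k))"

definition u_alpha ::
  "'m measure \<Rightarrow> ('m \<Rightarrow> 'm) \<Rightarrow> ('m \<Rightarrow> real) \<Rightarrow> ('m \<Rightarrow> complex) \<Rightarrow> complex" where
  "u_alpha \<mu> f R \<phi> = - (\<Sum>k. birkhoff_term \<mu> f R \<phi> (int k))"

text \<open>Both series converge at \<open>\<phi>\<close>.\<close>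

definition birkhoff_convergent ::
  "'m measure \<Rightarrow> ('m \<Rightarrow> 'm) \<Rightarrow> ('m \<Rightarrow> real) \<Rightarrow> ('m \<Rightarrow> complex) \<Rightarrow> bool" where
  "birkhoff_convergent \<mu> f R \<phi> \<longleftrightarrow>
     summable (\<lambda>k. birkhoff_term \<mu> f R \<phi> (- 1 - int k)) \<and>
     summable (\<lambda>k. birkhoff_term \<mu> f R \<phi> (int k))"

text \<open>For a merely measurable \<open>f\<close> the function \<open>\<phi> \<circ> f\<^sup>-\<^sup>1\<close> need not be of class \<open>C\<^sup>r\<close>, so \<open>u\<close> has
  to be defined on these functions as well; for the Birkhoff sums this is done by the same series.\<close>

definition weak_solution ::
  "enat \<Rightarrow> ('m::topological_space, 'n::finite) chart set \<Rightarrow> 'm measure \<Rightarrow> ('m \<Rightarrow> 'm) \<Rightarrow>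
     ('m \<Rightarrow> real) \<Rightarrow> (('m \<Rightarrow> complex) \<Rightarrow> complex) \<Rightarrow> bool" where
  "weak_solution r A \<mu> f R u \<longleftrightarrow>
     (\<forall>\<phi>\<in>Cr_fun r A. u (\<phi> \<circ> inv f) - u \<phi> = (\<integral>x. of_real (R x) * \<phi> x \<partial>\<mu>))"

end

theory Submission
  imports Defs
begin

text \<open>Decay of correlations makes the Birkhoff sums distributions.  A Littlewood-Paley piece of
  \<open>\<chi> u\<close> at \<open>y\<close> is \<open>u\<close> tested against \<open>\<chi> K\<^sub>l (\<cdot> - y)\<close>, where \<open>K\<^sub>l\<close> is a smooth kernel whose \<open>L\<^sup>1\<close> norm
  is bounded in \<open>l\<close> and whose \<open>C\<^sup>k\<close> norms grow at most like a power of \<open>2\<^sup>l\<close>.  In coordinates in which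
  \<open>\<mu>\<close> is Lebesgue measure, the term with \<open>R \<circ> f\<^sup>j\<close> is therefore bounded both by a constant and by
  \<open>C Q\<^sup>l q\<^bsup>\<bar>j\<bar>\<^esup>\<close> with \<open>q < 1\<close>.  The first bound is used for the \<open>O(l)\<close> indices with \<open>Q\<^sup>l q\<^bsup>\<bar>j\<bar>\<^esup> > 1\<close>
  and the second one for the rest, so the sum over \<open>j\<close> is \<open>O(1 + l)\<close>.  Since the definition of the
  Besov space on the manifold asks for volume preserving coordinates, one also has to construct them;
  they are obtained by integrating the density along one coordinate.\<close>

section \<open>Calculus of \<open>C\<^sup>k\<close> functions\<close>

text \<open>The constant bound rests on |R o f^j| \<le> B0 almost everywhere and on the fact that in
  volume preserving coordinates the \<mu>-integral of |\<chi> K_l(. - y)| is at most the Lebesgue L1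
  norm of K_l. That norm is bounded in l because for l \<ge> 1 all symbols are dilates of one test
  function, and dilating a symbol preserves the L1 norm of its Fourier transform. The base Q = 2^(K
  + n) comes from Fourier integrals over |\<xi>| \<le> 2 * 2^l: each of the K derivatives costs a
  factor 2^l and the volume of the ball costs 2^(l n). Here K is the ceiling of \<gamma>, the number
  of derivatives that dominates the Hoelder norm; since \<gamma> \<le> r, every C^r function has
  them. For finite r the density is smooth only in suitable charts near each point, so the
  straightening is done in such a chart, by a C^infinity map with C^infinity inverse; this keeps the
  new coordinates in the C^r structure.\<close>

lemma Ck_on_SucD:
  assumes "Ck_on (Suc k) U g" "x \<in> U"
  shows "(g has_derivative frechet_derivative g (at x)) (at x)"
proof -
  have "g differentiable (at x)" using assms by auto
  then show ?thesis by (simp only: frechet_derivative_works)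
qed

text \<open>Chart representatives are only known to agree on the image of a chart. On an open
  \<open>U\<close> the derivative at a point depends only on values in \<open>U\<close>, and
  agreement is inherited by the directional derivatives.\<close>

lemma Ck_on_cong_imp:
  assumes "open U" "\<And>x. x \<in> U \<Longrightarrow> f x = g x" "Ck_on k U f"
  shows "Ck_on k U g"
  using assms(2,3)
proof (induction k arbitrary: f g)
  case 0
  then show ?case by (metis Ck_on.simps(1) continuous_on_cong)
next
  case (Suc k)
  have d: "(g has_derivative frechet_derivative f (at x)) (at x)" if "x \<in> U" for x
  proof (rule has_derivative_transform_within_open[OF _ \<open>open U\<close> that])
    show "(f has_derivative frechet_derivative f (at x)) (at x)"
      by (rule Ck_on_SucD[OF Suc.prems(2) that])
  qed (use Suc.prems(1) in auto)
  have "frechet_derivative f (at x) v = frechet_derivative g (at x) v" if "x \<in> U" for x v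
    by (rule fun_cong[OF frechet_derivative_at[OF d[OF that]]])
  then have "Ck_on k U (\<lambda>x. frechet_derivative g (at x) v)" for v
    using Suc.prems by (blast intro: Suc.IH[of "\<lambda>x. frechet_derivative f (at x) v"] dest: Ck_on.simps(2)[THEN iffD1])
  with d show ?case by (auto simp: differentiable_def)
qed

text \<open>Since \<open>frechet_derivative\<close> is a choice operator, this rule lets inductions
  on the order work with an explicit derivative \<open>D\<close>, which is legitimate by uniqueness
  of derivatives.\<close>

lemma Ck_on_SucI:
  assumes "open U" "\<And>x. x \<in> U \<Longrightarrow> (g has_derivative D x) (at x)"
    and "\<And>v. Ck_on k U (\<lambda>x. D x v)"
  shows "Ck_on (Suc k) U g"
proof -
  have "frechet_derivative g (at x) = D x" if "x \<in> U" for x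
    by (rule frechet_derivative_at[OF assms(2)[OF that], symmetric])
  then have "Ck_on k U (\<lambda>x. frechet_derivative g (at x) v)" for v
    by (intro Ck_on_cong_imp[OF \<open>open U\<close> _ assms(3)[of v]]) simp
  then show ?thesis
    using assms by (auto simp: differentiable_def)
qed

lemma Ck_on_subset: "Ck_on k U g \<Longrightarrow> V \<subseteq> U \<Longrightarrow> Ck_on k V g"
  by (induction k arbitrary: g) (auto intro: continuous_on_subset)

lemma Ck_on_Union:
  assumes "\<And>V. V \<in> F \<Longrightarrow> open V \<and> Ck_on k V g"
  shows "Ck_on k (\<Union>F) g"
  using assms by (induction k arbitrary: g) (auto intro: continuous_on_open_Union)

lemma Ck_on_local:
  assumes "\<And>x. x \<in> U \<Longrightarrow> \<exists>V. open V \<and> x \<in> V \<and> Ck_on k V g"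
  shows "Ck_on k U g"
proof -
  have "Ck_on k (\<Union>{V. open V \<and> Ck_on k V g}) g" by (rule Ck_on_Union) auto
  then show ?thesis by (rule Ck_on_subset) (use assms in blast)
qed

lemma Ck_on_Suc_imp: "Ck_on (Suc k) U g \<Longrightarrow> Ck_on k U g"
proof (induction k arbitrary: g)
  case 0
  then show ?case
    by (auto intro!: differentiable_imp_continuous_on differentiable_at_imp_differentiable_on)
qed (auto)

lemma Ck_on_mono: "Ck_on k U g \<Longrightarrow> j \<le> k \<Longrightarrow> Ck_on j U g"
  by (induction k) (use Ck_on_Suc_imp le_Suc_eq in \<open>blast+\<close>)

lemma Ck_on_continuous: "Ck_on k U g \<Longrightarrow> continuous_on U g"
  using Ck_on_mono[of k U g 0] by simp

lemma Ck_on_const: "Ck_on k U (\<lambda>x. c)"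
  by (induction k arbitrary: c) auto

lemma Ck_on_bounded_linear:
  assumes "bounded_linear L"
  shows "Ck_on k U L"
proof (cases k)
  case 0
  then show ?thesis using assms by (simp add: linear_continuous_on)
next
  case (Suc j)
  have "frechet_derivative L (at x) = L" for x
    using assms by (metis bounded_linear_imp_has_derivative frechet_derivative_at)
  then show ?thesis
    using Suc assms by (auto simp: bounded_linear_imp_differentiable intro!: Ck_on_const)
qed

lemma Ck_on_linear_comp:
  assumes L: "bounded_linear L" and "open U" "Ck_on k U g"
  shows "Ck_on k U (\<lambda>x. L (g x))"
  using assms(3)
proof (induction k arbitrary: g)
  case 0
  then show ?case using bounded_linear.continuous_on[OF L] by auto
next
  case (Suc k)
  show ?case
  proof (rule Ck_on_SucI[OF \<open>open U\<close>])
    fix x assume "x \<in> U"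
    then show "((\<lambda>x. L (g x)) has_derivative (\<lambda>v. L (frechet_derivative g (at x) v))) (at x)"
      using bounded_linear.has_derivative[OF L Ck_on_SucD[OF Suc.prems]] by auto
  qed (use Suc assms in auto)
qed

lemma Ck_on_add:
  assumes "open U" "Ck_on k U f" "Ck_on k U g"
  shows "Ck_on k U (\<lambda>x. f x + g x)"
  using assms(2,3)
proof (induction k arbitrary: f g)
  case 0
  then show ?case by (auto intro: continuous_intros)
next
  case (Suc k)
  show ?case
    by (rule Ck_on_SucI[OF \<open>open U\<close> has_derivative_add[OF Ck_on_SucD Ck_on_SucD]])
      (use Suc assms in auto)
qed

lemma Ck_on_sum:
  assumes "open U" "\<And>i. i \<in> I \<Longrightarrow> Ck_on k U (f i)"
  shows "Ck_on k U (\<lambda>x. \<Sum>i\<in>I. f i x)"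
  using assms(2)
  by (induction I rule: infinite_finite_induct) (auto intro: Ck_on_const Ck_on_add[OF assms(1)])

lemma Ck_on_bilinear:
  assumes B: "bounded_bilinear B" and "open U" "Ck_on k U f" "Ck_on k U g"
  shows "Ck_on k U (\<lambda>x. B (f x) (g x))"
  using assms(3,4)
proof (induction k arbitrary: f g)
  case 0
  then show ?case using bounded_bilinear.continuous_on[OF B] by auto
next
  case (Suc k)
  have "Ck_on k U (\<lambda>x. B (f x) (frechet_derivative g (at x) v) + B (frechet_derivative f (at x) v) (g x))" for v
    using Suc.prems Suc.prems[THEN Ck_on_Suc_imp] by (intro Ck_on_add[OF \<open>open U\<close>] Suc.IH) auto
  from Ck_on_SucI[OF \<open>open U\<close> bounded_bilinear.FDERIV[OF B Ck_on_SucD[OF Suc.prems(1)] Ck_on_SucD[OF Suc.prems(2)]] this]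
  show ?case .
qed

lemmas Ck_on_scaleR = Ck_on_bilinear[OF bounded_bilinear_scaleR]
lemmas Ck_on_mult = Ck_on_bilinear[OF bounded_bilinear_mult]

lemma Ck_on_diff:
  assumes "open U" "Ck_on k U f" "Ck_on k U g"
  shows "Ck_on k U (\<lambda>x. f x - g x)"
  using Ck_on_add[OF assms(1,2) Ck_on_linear_comp[OF bounded_linear_minus[OF bounded_linear_ident] assms(1,3)]]
  by simp

lemma linear_Basis_sum:
  fixes L :: "'a::euclidean_space \<Rightarrow> 'b::real_vector"
  assumes "linear L"
  shows "L w = (\<Sum>b\<in>Basis. (w \<bullet> b) *\<^sub>R L b)"
proof -
  have "L w = L (\<Sum>b\<in>Basis. (w \<bullet> b) *\<^sub>R b)" by (simp add: euclidean_representation)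
  also have "\<dots> = (\<Sum>b\<in>Basis. (w \<bullet> b) *\<^sub>R L b)"
    using assms by (simp add: linear_sum linear_scale)
  finally show ?thesis .
qed

text \<open>\<open>Ck_on\<close> knows directional derivatives in a fixed direction, whereas the
  chain rule evaluates the derivative of \<open>g\<close> in the moving direction Df(x) v. Expanding
  that direction in the basis of the Euclidean space in between gives a sum of products, to which
  the induction hypothesis and the product rule apply.\<close>

lemma Ck_on_compose:
  fixes f :: "'a::real_normed_vector \<Rightarrow> 'b::euclidean_space"
  assumes "open U" "open V" "\<And>x. x \<in> U \<Longrightarrow> f x \<in> V" "Ck_on k U f" "Ck_on k V g"
  shows "Ck_on k U (\<lambda>x. g (f x))"
  using assms(4,5)
proof (induction k arbitrary: g)
  case 0
  then show ?case
    using assms(3) by (auto intro: continuous_on_compose2)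
next
  case (Suc k)
  show ?case
  proof (rule Ck_on_SucI[OF \<open>open U\<close>])
    fix x assume x: "x \<in> U"
    have lin: "linear (frechet_derivative g (at (f x)))"
      using Ck_on_SucD[OF Suc.prems(2) assms(3)[OF x]] has_derivative_linear by blast
    show "((\<lambda>x. g (f x)) has_derivative
       (\<lambda>v. \<Sum>b\<in>Basis. (frechet_derivative f (at x) v \<bullet> b) *\<^sub>R frechet_derivative g (at (f x)) b)) (at x)"
      using has_derivative_compose[OF Ck_on_SucD[OF Suc.prems(1) x] Ck_on_SucD[OF Suc.prems(2) assms(3)[OF x]]]
      by (subst (asm) linear_Basis_sum[OF lin]) 
  next
    fix v
    have "Ck_on k U (\<lambda>x. frechet_derivative f (at x) v \<bullet> b)" for b
      using Suc.prems(1) by (intro Ck_on_linear_comp[OF bounded_linear_inner_left \<open>open U\<close>]) auto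
    moreover have "Ck_on k U (\<lambda>x. frechet_derivative g (at (f x)) b)" for b
      using Suc.prems Ck_on_Suc_imp by (intro Suc.IH) auto
    ultimately show "Ck_on k U (\<lambda>x. \<Sum>b\<in>Basis. (frechet_derivative f (at x) v \<bullet> b) *\<^sub>R frechet_derivative g (at (f x)) b)"
      using \<open>open U\<close> by (intro Ck_on_sum Ck_on_scaleR)
  qed
qed

text \<open>The derivative of 1/f is -f' (1/f)^2, in which 1/f is needed only to one order less;
  this closes the induction.\<close>

lemma Ck_on_inverse:
  fixes f :: "'a::real_normed_vector \<Rightarrow> real"
  assumes "open U" "Ck_on k U f" "\<And>x. x \<in> U \<Longrightarrow> f x \<noteq> 0"
  shows "Ck_on k U (\<lambda>x. inverse (f x))"
  using assms(2)
proof (induction k)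
  case 0
  then show ?case using assms(3) by (auto intro: continuous_intros)
next
  case (Suc k)
  show ?case
  proof (rule Ck_on_SucI[OF \<open>open U\<close>])
    fix x assume x: "x \<in> U"
    show "((\<lambda>x. inverse (f x)) has_derivative
      (\<lambda>v. - (inverse (f x) * frechet_derivative f (at x) v * inverse (f x)))) (at x)"
      using assms(3)[OF x] Ck_on_SucD[OF Suc.prems x] by (auto intro!: derivative_eq_intros)
  next
    fix v
    have "Ck_on k U (\<lambda>x. inverse (f x))" using Suc Ck_on_Suc_imp by blast
    moreover have "Ck_on k U (\<lambda>x. frechet_derivative f (at x) v)" using Suc.prems by auto
    ultimately show "Ck_on k U (\<lambda>x. - (inverse (f x) * frechet_derivative f (at x) v * inverse (f x)))"
      using \<open>open U\<close> by (intro Ck_on_linear_comp[OF bounded_linear_minus[OF bounded_linear_ident]] Ck_on_mult)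
  qed
qed

lemma Ck_on_nth:
  fixes f :: "'a::real_normed_vector \<Rightarrow> real^'n"
  assumes "open U" "Ck_on k U f"
  shows "Ck_on k U (\<lambda>x. f x $ i)"
  using Ck_on_linear_comp[OF bounded_linear_vec_nth assms] .

text \<open>\<open>V\<close> and the complement of \<open>C\<close> form an open cover of the space,
  and on the complement \<open>h\<close> is constant.\<close>

lemma Ck_on_ext0:
  assumes "open V" "closed C" "C \<subseteq> V" "Ck_on k V h" "\<And>x. x \<notin> C \<Longrightarrow> h x = 0"
  shows "Ck_on k UNIV h"
proof (rule Ck_on_local)
  fix x
  have "Ck_on k (- C) h"
    using assms by (intro Ck_on_cong_imp[OF _ _ Ck_on_const[of k "- C" 0]]) auto
  then show "\<exists>W. open W \<and> x \<in> W \<and> Ck_on k W h"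
    using assms by (metis ComplI open_Compl subsetD)
qed

lemma linear_axis_sum:
  fixes L :: "real^'n \<Rightarrow> 'b::real_vector"
  assumes "linear L"
  shows "L w = (\<Sum>j\<in>UNIV. (w $ j) *\<^sub>R L (axis j 1))"
proof -
  have "L w = L (\<Sum>j\<in>UNIV. (w $ j) *\<^sub>R axis j 1)"
    using basis_expansion[of w] by (simp add: scalar_mult_eq_scaleR)
  also have "\<dots> = (\<Sum>j\<in>UNIV. (w $ j) *\<^sub>R L (axis j 1))"
    using assms by (simp add: linear_sum linear_scale)
  finally show ?thesis .
qed

section \<open>Iterated partial derivatives\<close>

text \<open>The head of the list is the outermost derivative. This form splits off the innermost one
  instead, which is what is needed when the first derivative has a closed formula, as for products
  and for Fourier integrals.\<close>

lemma partials_append: "partials (is @ js) g = partials is (partials js g)"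
  by (induction "is") auto

lemma partials_Cons_eq:
  assumes "(partials is g has_derivative D) (at x)"
  shows "partials (i # is) g x = D (axis i 1)"
  using frechet_derivative_at[OF assms] by simp

lemma Ck_on_partials:
  assumes "Ck_on k UNIV g" "length is \<le> k"
  shows "Ck_on (k - length is) UNIV (partials is g)"
  using assms(2)
proof (induction "is")
  case (Cons i "is")
  then obtain m where "k - length is = Suc m" "k - length (i # is) = m"
    by (metis Suc_diff_Suc Suc_le_lessD length_Cons)
  with Cons show ?case by auto
qed (use assms in auto)

lemma partials_has_derivative:
  assumes "Ck_on k UNIV g" "length is < k"
  shows "(partials is g has_derivative frechet_derivative (partials is g) (at x)) (at x)"
proof -
  have "Ck_on (Suc (k - length is - 1)) UNIV (partials is g)"
    using Ck_on_partials[OF assms(1), of "is"] assms(2) by (simp del: Ck_on.simps add: Suc_diff_Suc)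
  then show ?thesis by (rule Ck_on_SucD) auto
qed

lemma partials_continuous:
  assumes "Ck_on k UNIV g" "length is \<le> k"
  shows "continuous_on UNIV (partials is g)"
  using Ck_on_partials[OF assms] by (rule Ck_on_continuous)

lemma partials_linear_comp:
  assumes L: "bounded_linear L" and "Ck_on k UNIV g" "length is \<le> k"
  shows "partials is (\<lambda>x. L (g x)) = (\<lambda>x. L (partials is g x))"
  using assms(3)
proof (induction "is")
  case (Cons i "is")
  show ?case
  proof
    fix x
    have "(partials is (\<lambda>x. L (g x)) has_derivative (\<lambda>v. L (frechet_derivative (partials is g) (at x) v))) (at x)"
      using bounded_linear.has_derivative[OF L partials_has_derivative[OF assms(2), of "is" x]] Cons by simp
    from partials_Cons_eq[OF this] show "partials (i # is) (\<lambda>x. L (g x)) x = L (partials (i # is) g x)" by simp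
  qed
qed auto

lemma partials_add:
  assumes "Ck_on k UNIV f" "Ck_on k UNIV g" "length is \<le> k"
  shows "partials is (\<lambda>x. f x + g x) = (\<lambda>x. partials is f x + partials is g x)"
  using assms(3)
proof (induction "is")
  case (Cons i "is")
  show ?case
  proof
    fix x
    have "(partials is (\<lambda>x. f x + g x) has_derivative
        (\<lambda>v. frechet_derivative (partials is f) (at x) v + frechet_derivative (partials is g) (at x) v)) (at x)"
      using has_derivative_add[OF partials_has_derivative[OF assms(1), of "is" x]
        partials_has_derivative[OF assms(2), of "is" x]] Cons by simp
    from partials_Cons_eq[OF this]
    show "partials (i # is) (\<lambda>x. f x + g x) x = partials (i # is) f x + partials (i # is) g x" by simp
  qed
qed auto

lemma partials_const0: "partials is (\<lambda>x. 0) = (\<lambda>x. 0)"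
proof (induction "is")
  case (Cons i "is")
  then show ?case using frechet_derivative_const by auto
qed auto

lemma partials_sum:
  assumes "\<And>j. j \<in> J \<Longrightarrow> Ck_on k UNIV (f j)" "length is \<le> k"
  shows "partials is (\<lambda>x. \<Sum>j\<in>J. f j x) = (\<lambda>x. \<Sum>j\<in>J. partials is (f j) x)"
  using assms(1)
proof (induction J rule: infinite_finite_induct)
  case (insert j J)
  then show ?case
    using partials_add[of k "f j" "\<lambda>x. \<Sum>j\<in>J. f j x" "is"] assms(2) by (simp add: Ck_on_sum)
qed (simp_all add: partials_const0)

lemma partials_zero_outside:
  assumes "closed C" "\<And>x. x \<notin> C \<Longrightarrow> g x = 0"
  shows "x \<notin> C \<Longrightarrow> partials is g x = 0"
proof (induction "is" arbitrary: x)
  case (Cons i "is")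
  have "(partials is g has_derivative (\<lambda>v. 0)) (at x)"
    by (rule has_derivative_transform_within_open[OF has_derivative_const[of 0], of "- C"])
      (use Cons assms in auto)
  then show ?case by (simp only: partials_Cons_eq)
qed (use assms in auto)

lemma partials_bounded:
  fixes g :: "real^'n \<Rightarrow> 'b::real_normed_vector"
  assumes "Ck_on k UNIV g" "compact C" "\<And>x. x \<notin> C \<Longrightarrow> g x = 0"
  obtains B where "0 \<le> B" "\<And>is x. length is \<le> k \<Longrightarrow> norm (partials is g x) \<le> B"
proof -
  have "\<exists>b. \<forall>x. norm (partials is g x) \<le> b" if "length is \<le> k" for "is"
  proof -
    have "compact (partials is g ` C)"
      using partials_continuous[OF assms(1) that] assms(2)
      by (meson compact_continuous_image continuous_on_subset subset_UNIV)
    then obtain b where b: "\<And>x. x \<in> C \<Longrightarrow> norm (partials is g x) \<le> b"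
      using compact_imp_bounded bounded_iff by (metis imageI)
    \<comment> \<open>The maximum with 0 covers the points off \<open>C\<close>, also when
      \<open>C\<close> is empty and \<open>b\<close> happens to be negative.\<close>
    have "norm (partials is g x) \<le> max b 0" for x
      using b[of x] partials_zero_outside[of C g x "is"] assms(3) compact_imp_closed[OF assms(2)]
      by (cases "x \<in> C") auto
    then show ?thesis by blast
  qed
  then obtain b where b: "\<And>is x. length is \<le> k \<Longrightarrow> norm (partials is g x) \<le> b is" by metis
  have fin: "finite {is :: 'n list. length is \<le> k}"
    using finite_lists_length_le[of "UNIV :: 'n set" k] by simp
  have b0: "0 \<le> b is" if "length is \<le> k" for "is"
    using norm_ge_zero order_trans b[OF that] by blast
  show ?thesis
  proof
    show "0 \<le> (\<Sum>is\<in>{is :: 'n list. length is \<le> k}. b is)" by (intro sum_nonneg b0) auto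
    show "norm (partials is g x) \<le> (\<Sum>is\<in>{is :: 'n list. length is \<le> k}. b is)" if "length is \<le> k" for "is" x
      using b[OF that, of x] member_le_sum[of "is" "{is :: 'n list. length is \<le> k}" b] fin b0 that by force
  qed
qed

lemma Ck_norm_le:
  fixes g :: "real^'n \<Rightarrow> 'b::real_normed_vector"
  assumes "\<And>is x. length is \<le> k \<Longrightarrow> norm (partials is g x) \<le> M"
  shows "Ck_norm k g \<le> real (card {is :: 'n list. length is \<le> k}) * M"
  unfolding Ck_norm_def using assms by (intro sum_bounded_above cSUP_least) auto

text \<open>The bound \<open>B\<close> guarantees that the suprema in \<open>Ck_norm\<close> are
  taken over bounded sets; a real supremum of an unbounded set would say nothing about its members.
  Its size does not enter the conclusion.\<close>

lemma Ck_norm_ge: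
  fixes g :: "real^'n \<Rightarrow> 'b::real_normed_vector"
  assumes "\<And>is x. length is \<le> k \<Longrightarrow> norm (partials is g x) \<le> B" "length is \<le> k"
  shows "norm (partials is g x) \<le> Ck_norm k g"
proof -
  have bdd: "bdd_above (range (\<lambda>x. norm (partials is g x)))" if "length is \<le> k" for "is"
    using assms(1)[OF that] by (auto simp: bdd_above_def)
  have up: "norm (partials is g x) \<le> (SUP x. norm (partials is g x))" if "length is \<le> k" for "is" x
    by (rule cSUP_upper[OF UNIV_I bdd[OF that]])
  have "finite {is :: 'n list. length is \<le> k}"
    using finite_lists_length_le[of "UNIV :: 'n set" k] by simp
  then have "(SUP x. norm (partials is g x)) \<le> Ck_norm k g"
    unfolding Ck_norm_def using assms(2) order_trans[OF norm_ge_zero up]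
    by (intro member_le_sum[where f = "\<lambda>is. SUP x. norm (partials is g x)"]) auto
  with up[OF assms(2), of x] show ?thesis by linarith
qed

section \<open>Changes of coordinates as bounded operations on C^k functions\<close>

lemma Ck_on_pullback:
  fixes \<tau> :: "'a::real_normed_vector \<Rightarrow> 'c::euclidean_space" and a :: "'a \<Rightarrow> real"
  assumes "open V" "closed C" "C \<subseteq> V"
    and "Ck_on k V \<tau>" "Ck_on k UNIV a" "\<And>x. x \<notin> C \<Longrightarrow> a x = 0" "Ck_on k UNIV g"
  shows "Ck_on k UNIV (\<lambda>x. a x *\<^sub>R g (\<tau> x))"
proof (rule Ck_on_ext0[OF assms(1-3)])
  show "Ck_on k V (\<lambda>x. a x *\<^sub>R g (\<tau> x))"
    by (rule Ck_on_scaleR[OF assms(1) Ck_on_subset[OF assms(5)]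
        Ck_on_compose[OF assms(1) open_UNIV _ assms(4,7)]]) auto
qed (use assms(6) in auto)

abbreviation partials_le :: "nat \<Rightarrow> real \<Rightarrow> (real^'n \<Rightarrow> 'b::real_normed_vector) \<Rightarrow> bool" where
  "partials_le k M g \<equiv> \<forall>is x. length is \<le> k \<longrightarrow> norm (partials is g x) \<le> M"

text \<open>One derivative of a cut-off pullback is a sum of cut-off pullbacks of \<open>g\<close>
  and of its first partial derivatives, with new cut-off coefficients. The induction therefore runs
  over all coefficients \<open>a\<close>. That \<open>B\<close> is chosen before \<open>g\<close> is
  what later makes the estimates uniform over all kernels and their translates.\<close>

lemma pullback_bound:
  fixes \<tau> :: "real^'n \<Rightarrow> real^'m" and a :: "real^'n \<Rightarrow> real"
  assumes "open V" "compact C" "C \<subseteq> V"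
    and "Ck_on k V \<tau>" "Ck_on k UNIV a" "\<And>x. x \<notin> C \<Longrightarrow> a x = 0"
  shows "\<exists>B\<ge>0. \<forall>(g :: real^'m \<Rightarrow> 'b::real_normed_vector) M. Ck_on k UNIV g \<longrightarrow>
      partials_le k M g \<longrightarrow>
      partials_le k (B * M) (\<lambda>x. a x *\<^sub>R g (\<tau> x))"
  using assms(4-6)
proof (induction k arbitrary: a)
  case 0
  obtain B where B: "0 \<le> B" "\<And>x. norm (a x) \<le> B"
    using partials_bounded[OF 0(2) assms(2) 0(3)] by (metis le0 list.size(3) partials.simps(1))
  show ?case
  proof (intro exI[of _ B] conjI allI impI B(1))
    fix g :: "real^'m \<Rightarrow> 'b" and M and "is" :: "'n list" and x
    assume "partials_le 0 M g" "length is \<le> 0"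
    then have "is = []" "norm (partials [] g (\<tau> x)) \<le> M" by (simp, metis le_zero_eq list.size(3))
    then show "norm (partials is (\<lambda>x. a x *\<^sub>R g (\<tau> x)) x) \<le> B * M"
      using B(2)[of x] B(1) by (auto intro!: mult_mono)
  qed
next
  case (Suc k)
  have cl: "closed C" using assms(2) by (rule compact_imp_closed)
  \<comment> \<open>By the product and chain rules the i-th derivative is b_i g(\<tau>) + sum_j c_ij
    (partial_j g)(\<tau>). The coefficients again vanish off \<open>C\<close>, and \<open>c\<close>
    extends by zero although \<tau> is only controlled on \<open>V\<close>.\<close>
  define b where "b i = partials [i] a" for i
  define c where "c i j x = a x * frechet_derivative \<tau> (at x) (axis i 1) $ j" for i j x
  have Cb: "Ck_on k UNIV (b i)" for i
    using Suc.prems(2) by (auto simp: b_def)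
  have b0: "b i x = 0" if "x \<notin> C" for i x
    unfolding b_def using partials_zero_outside[OF cl Suc.prems(3) that] .
  have Cc: "Ck_on k UNIV (c i j)" for i j
  proof (rule Ck_on_ext0[OF assms(1) cl assms(3)])
    show "Ck_on k V (c i j)" unfolding c_def
      using Suc.prems(1,2)
      by (intro Ck_on_mult[OF assms(1)] Ck_on_nth[OF assms(1)]
            Ck_on_subset[OF Ck_on_Suc_imp[OF Suc.prems(2)]]) auto
  qed (use Suc.prems(3) in \<open>auto simp: c_def\<close>)
  have c0: "c i j x = 0" if "x \<notin> C" for i j x
    using that Suc.prems(3) by (auto simp: c_def)
  have \<tau>k: "Ck_on k V \<tau>" using Ck_on_Suc_imp Suc.prems(1) by blast
  note Cpull = Ck_on_pullback[OF assms(1) cl assms(3) \<tau>k]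
  have deriv: "partials [i] (\<lambda>x. a x *\<^sub>R g (\<tau> x)) =
      (\<lambda>x. b i x *\<^sub>R g (\<tau> x) + (\<Sum>j\<in>UNIV. c i j x *\<^sub>R partials [j] g (\<tau> x)))"
    if g: "Ck_on (Suc k) UNIV g" for g :: "real^'m \<Rightarrow> 'b" and i
  proof
    fix x
    show "partials [i] (\<lambda>x. a x *\<^sub>R g (\<tau> x)) x =
      b i x *\<^sub>R g (\<tau> x) + (\<Sum>j\<in>UNIV. c i j x *\<^sub>R partials [j] g (\<tau> x))"
    proof (cases "x \<in> C")
      case True
      then have x: "x \<in> V" using assms(3) by auto
      let ?Dg = "frechet_derivative g (at (\<tau> x))"
      have dg: "(g has_derivative ?Dg) (at (\<tau> x))" by (rule Ck_on_SucD[OF g]) auto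
      have "((\<lambda>x. a x *\<^sub>R g (\<tau> x)) has_derivative (\<lambda>v. a x *\<^sub>R ?Dg (frechet_derivative \<tau> (at x) v)
          + frechet_derivative a (at x) v *\<^sub>R g (\<tau> x))) (at x)"
        by (rule has_derivative_scaleR[OF Ck_on_SucD[OF Suc.prems(2)]
              has_derivative_compose[OF Ck_on_SucD[OF Suc.prems(1) x] dg]]) auto
      then have "partials [i] (\<lambda>x. a x *\<^sub>R g (\<tau> x)) x
          = a x *\<^sub>R ?Dg (frechet_derivative \<tau> (at x) (axis i 1)) + b i x *\<^sub>R g (\<tau> x)"
        using partials_Cons_eq[of "[]"] by (simp add: b_def)
      also have "?Dg (frechet_derivative \<tau> (at x) (axis i 1))
          = (\<Sum>j\<in>UNIV. (frechet_derivative \<tau> (at x) (axis i 1) $ j) *\<^sub>R ?Dg (axis j 1))"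
        by (rule linear_axis_sum[OF has_derivative_linear[OF dg]])
      finally show ?thesis by (simp add: c_def scaleR_sum_right)
    next
      case False
      then show ?thesis
        using partials_zero_outside[OF cl, of "\<lambda>x. a x *\<^sub>R g (\<tau> x)" x "[i]"] Suc.prems(3) b0 c0 by simp
    qed
  qed
  obtain B0 where B0: "0 \<le> B0" "\<And>x. norm (a x) \<le> B0"
    using partials_bounded[OF Suc.prems(2) assms(2) Suc.prems(3)] by (metis le0 list.size(3) partials.simps(1))
  have "\<forall>i. \<exists>B\<ge>0. \<forall>(g :: real^'m \<Rightarrow> 'b) M. Ck_on k UNIV g \<longrightarrow>
      partials_le k M g \<longrightarrow>
      partials_le k (B * M) (\<lambda>x. b i x *\<^sub>R g (\<tau> x))"
    using Suc.IH[OF \<tau>k Cb b0] by blast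
  then obtain B1 where B1: "\<And>i. 0 \<le> B1 i" "\<And>i (g :: real^'m \<Rightarrow> 'b) M is x. Ck_on k UNIV g \<Longrightarrow>
      (\<And>is y. length is \<le> k \<Longrightarrow> norm (partials is g y) \<le> M) \<Longrightarrow> length is \<le> k \<Longrightarrow>
      norm (partials is (\<lambda>x. b i x *\<^sub>R g (\<tau> x)) x) \<le> B1 i * M"
    by metis
  have "\<forall>i j. \<exists>B\<ge>0. \<forall>(g :: real^'m \<Rightarrow> 'b) M. Ck_on k UNIV g \<longrightarrow>
      partials_le k M g \<longrightarrow>
      partials_le k (B * M) (\<lambda>x. c i j x *\<^sub>R g (\<tau> x))"
    using Suc.IH[OF \<tau>k Cc c0] by blast
  then obtain B2 where B2: "\<And>i j. 0 \<le> B2 i j" "\<And>i j (g :: real^'m \<Rightarrow> 'b) M is x. Ck_on k UNIV g \<Longrightarrow>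
      (\<And>is y. length is \<le> k \<Longrightarrow> norm (partials is g y) \<le> M) \<Longrightarrow> length is \<le> k \<Longrightarrow>
      norm (partials is (\<lambda>x. c i j x *\<^sub>R g (\<tau> x)) x) \<le> B2 i j * M"
    by metis
  define E where "E i = B1 i + (\<Sum>j\<in>UNIV. B2 i j)" for i
  have E0: "0 \<le> E i" for i unfolding E_def by (intro add_nonneg_nonneg sum_nonneg B1 B2)
  have E1: "E i \<le> (\<Sum>i\<in>UNIV. E i)" for i using E0 by (intro member_le_sum) auto
  show ?case
  proof (intro exI[of _ "B0 + (\<Sum>i\<in>UNIV. E i)"] conjI allI impI)
    show "0 \<le> B0 + (\<Sum>i\<in>UNIV. E i)" by (intro add_nonneg_nonneg sum_nonneg B0 E0)
    fix g :: "real^'m \<Rightarrow> 'b" and M and "is" :: "'n list" and x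
    assume g: "Ck_on (Suc k) UNIV g" and M: "partials_le (Suc k) M g"
      and len: "length is \<le> Suc k"
    have gk: "Ck_on k UNIV g" using g Ck_on_Suc_imp by blast
    have M0: "norm (g y) \<le> M" for y using M[rule_format, of "[]" y] by simp
    then have M1: "0 \<le> M" using norm_ge_zero order_trans by blast
    show "norm (partials is (\<lambda>x. a x *\<^sub>R g (\<tau> x)) x) \<le> (B0 + (\<Sum>i\<in>UNIV. E i)) * M"
    \<comment> \<open>The innermost derivative is split off: \<open>deriv\<close> describes one
      derivative of the whole product, and the remaining \<open>js\<close> fall under the induction
      hypothesis.\<close>
    proof (cases "is" rule: rev_cases)
      case Nil
      have "norm (a x) * norm (g (\<tau> x)) \<le> B0 * M"
        using B0 M0 by (intro mult_mono) auto
      moreover have "0 \<le> (\<Sum>i\<in>UNIV. E i) * M" using E0 M1 by (intro mult_nonneg_nonneg sum_nonneg)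
      ultimately show ?thesis using Nil by (simp add: algebra_simps)
    next
      case (snoc js i)
      have lj: "length js \<le> k" using snoc len by simp
      have gj: "Ck_on k UNIV (partials [j] g)" for j using g by simp
      have Mj: "norm (partials is (partials [j] g) y) \<le> M" if "length is \<le> k" for j y "is"
        using M[rule_format, of "is @ [j]" y] that by (simp add: partials_append)
      have "partials is (\<lambda>x. a x *\<^sub>R g (\<tau> x)) = partials js
         (\<lambda>x. b i x *\<^sub>R g (\<tau> x) + (\<Sum>j\<in>UNIV. c i j x *\<^sub>R partials [j] g (\<tau> x)))"
        unfolding snoc partials_append deriv[OF g] ..
      also have "\<dots> = (\<lambda>x. partials js (\<lambda>x. b i x *\<^sub>R g (\<tau> x)) x +
           partials js (\<lambda>x. \<Sum>j\<in>UNIV. c i j x *\<^sub>R partials [j] g (\<tau> x)) x)"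
        by (intro partials_add[of k] Ck_on_sum Cpull Cb Cc b0 c0 gk gj lj) auto
      also have "partials js (\<lambda>x. \<Sum>j\<in>UNIV. c i j x *\<^sub>R partials [j] g (\<tau> x))
          = (\<lambda>x. \<Sum>j\<in>UNIV. partials js (\<lambda>x. c i j x *\<^sub>R partials [j] g (\<tau> x)) x)"
        by (intro partials_sum[of _ k] Cpull Cc c0 gj lj) auto
      finally have "norm (partials is (\<lambda>x. a x *\<^sub>R g (\<tau> x)) x) \<le>
          norm (partials js (\<lambda>x. b i x *\<^sub>R g (\<tau> x)) x) +
          (\<Sum>j\<in>UNIV. norm (partials js (\<lambda>x. c i j x *\<^sub>R partials [j] g (\<tau> x)) x))"
        using norm_triangle_le[OF add_left_mono[OF norm_sum]] by simp
      also have "\<dots> \<le> B1 i * M + (\<Sum>j\<in>UNIV. B2 i j * M)"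
        using M lj by (intro add_mono sum_mono B1(2) B2(2) gk gj Mj) auto
      also have "\<dots> = E i * M" by (simp add: E_def algebra_simps sum_distrib_left)
      also have "\<dots> \<le> (B0 + (\<Sum>i\<in>UNIV. E i)) * M"
        using E1[of i] B0(1) M1 by (intro mult_right_mono) auto
      finally show ?thesis .
    qed
  qed
qed

section \<open>Hoelder norms dominated by one more derivative\<close>

lemma lipschitz_of_partials:
  fixes h :: "real^'n \<Rightarrow> 'b::real_normed_vector"
  assumes "Ck_on (Suc 0) UNIV h" "\<And>i x. norm (partials [i] h x) \<le> M"
  shows "norm (h z - h w) \<le> real CARD('n) * M * norm (z - w)"
proof (rule differentiable_bound[OF convex_UNIV])
  fix x :: "real^'n"
  have d: "(h has_derivative frechet_derivative h (at x)) (at x)"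
    by (rule Ck_on_SucD[OF assms(1)]) auto
  then show "(h has_derivative frechet_derivative h (at x)) (at x within UNIV)" by simp
  show "onorm (frechet_derivative h (at x)) \<le> real CARD('n) * M"
  proof (rule onorm_le)
    fix v :: "real^'n"
    have "norm (frechet_derivative h (at x) v) = norm (\<Sum>j\<in>UNIV. (v $ j) *\<^sub>R frechet_derivative h (at x) (axis j 1))"
      using linear_axis_sum[OF has_derivative_linear[OF d], of v] by simp
    also have "\<dots> \<le> (\<Sum>j\<in>(UNIV :: 'n set). norm v * M)"
      using assms(2) component_le_norm_cart[of v]
      by (intro order_trans[OF norm_sum sum_mono]) (auto intro!: mult_mono)
    finally show "norm (frechet_derivative h (at x) v) \<le> real CARD('n) * M * norm v"
      by (simp add: algebra_simps)
  qed
qed auto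

text \<open>For points at distance at least 1 the sup norm gives 2 M. For closer points the
  Lipschitz bound n M d suffices because d \<le> d^\<delta> when d < 1 and \<delta> \<le> 1. The
  constant 2 + n serves both cases.\<close>

lemma holder_seminorm_le:
  fixes h :: "real^'n \<Rightarrow> 'b::real_normed_vector"
  assumes h: "Ck_on (Suc 0) UNIV h" and M: "\<And>x. norm (h x) \<le> M" "\<And>i x. norm (partials [i] h x) \<le> M"
    and \<delta>: "0 < \<delta>" "\<delta> \<le> 1"
  shows "holder_seminorm \<delta> h \<le> (2 + real CARD('n)) * M"
  unfolding holder_seminorm_def
proof (rule cSUP_least)
  have "(axis undefined 1, 0) \<in> {z :: (real^'n) \<times> (real^'n). fst z \<noteq> snd z}" by simp
  then show "{z :: (real^'n) \<times> (real^'n). fst z \<noteq> snd z} \<noteq> {}" by blast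
  fix p :: "(real^'n) \<times> (real^'n)" assume "p \<in> {z. fst z \<noteq> snd z}"
  then obtain z w where p: "p = (z, w)" "z \<noteq> w" by (cases p) auto
  have M0: "0 \<le> M" using M(1) norm_ge_zero order_trans by blast
  let ?d = "norm (z - w)"
  have d0: "0 < ?d" using p by simp
  have "norm (h z - h w) \<le> (2 + real CARD('n)) * M * ?d powr \<delta>"
  proof (cases "?d \<ge> 1")
    case True
    have "norm (h z - h w) \<le> 2 * M" using M(1)[of z] M(1)[of w] norm_triangle_ineq4[of "h z" "h w"] by linarith
    also have "\<dots> \<le> (2 + real CARD('n)) * M" using M0 by (simp add: algebra_simps)
    also have "\<dots> \<le> (2 + real CARD('n)) * M * ?d powr \<delta>"
      using True \<delta> M0 mult_left_mono[OF ge_one_powr_ge_zero[of ?d \<delta>], of "(2 + real CARD('n)) * M"] by simp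
    finally show ?thesis .
  next
    case False
    have "norm (h z - h w) \<le> real CARD('n) * M * ?d" by (rule lipschitz_of_partials[OF h M(2)])
    also have "\<dots> \<le> (2 + real CARD('n)) * M * ?d" using M0 by (intro mult_right_mono) auto
    also have "\<dots> \<le> (2 + real CARD('n)) * M * ?d powr \<delta>"
      using False d0 \<delta> M0 powr_mono'[of \<delta> 1 ?d] by (intro mult_left_mono) auto
    finally show ?thesis .
  qed
  then show "norm (h (fst p) - h (snd p)) / norm (fst p - snd p) powr \<delta> \<le> (2 + real CARD('n)) * M"
    using p d0 by (simp add: divide_le_eq)
qed

text \<open>With \<gamma> = k + \<delta> and 0 < \<delta> \<le> 1 the ceiling of \<gamma> is k + 1.
  The Hoelder seminorms of the k-th derivatives are controlled by these and the derivatives of order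
  k + 1.\<close>

lemma holder_norm_le:
  assumes "0 < \<gamma>"
  obtains H where "0 \<le> H" "\<And>(g :: real^'n \<Rightarrow> 'b::real_normed_vector) M. Ck_on (nat \<lceil>\<gamma>\<rceil>) UNIV g \<Longrightarrow>
    (\<And>is x. length is \<le> nat \<lceil>\<gamma>\<rceil> \<Longrightarrow> norm (partials is g x) \<le> M) \<Longrightarrow> holder_norm \<gamma> g \<le> H * M"
proof -
  define k where "k = nat \<lceil>\<gamma>\<rceil> - 1"
  have Sk: "nat \<lceil>\<gamma>\<rceil> = Suc k" using assms by (simp add: k_def)
  have \<delta>: "0 < \<gamma> - real k" "\<gamma> - real k \<le> 1"
    using assms Sk by linarith+
  define H where "H = real (card {is :: 'n list. length is \<le> k}) +
    real (card {is :: 'n list. length is = k}) * (2 + real CARD('n))"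
  show ?thesis
  proof
    show "0 \<le> H" unfolding H_def by simp
    fix g :: "real^'n \<Rightarrow> 'b" and M
    assume g: "Ck_on (nat \<lceil>\<gamma>\<rceil>) UNIV g"
      and M: "\<And>is x. length is \<le> nat \<lceil>\<gamma>\<rceil> \<Longrightarrow> norm (partials is g x) \<le> M"
    have "holder_seminorm (\<gamma> - real k) (partials is g) \<le> (2 + real CARD('n)) * M" if "length is = k" for "is"
      using Ck_on_partials[OF g, of "is"] M[of "is"] M[of "_ # is"] that Sk \<delta>
      by (intro holder_seminorm_le) auto
    then have "(\<Sum>is\<in>{is :: 'n list. length is = k}. holder_seminorm (\<gamma> - real k) (partials is g))
        \<le> real (card {is :: 'n list. length is = k}) * ((2 + real CARD('n)) * M)"
      by (intro sum_bounded_above) auto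
    moreover have "Ck_norm k g \<le> real (card {is :: 'n list. length is \<le> k}) * M"
      using M Sk by (intro Ck_norm_le) auto
    ultimately show "holder_norm \<gamma> g \<le> H * M"
      unfolding holder_norm_def Let_def k_def[symmetric] H_def by (simp add: algebra_simps)
  qed
qed

section \<open>Fourier transforms of bounded functions with compact support\<close>

text \<open>This is all that differentiating a Fourier integral requires. The class is closed under
  multiplication by characters and by coordinates, and carrying the radius \<rho> and the bound
  \<open>b\<close> explicitly yields the powers of 2^l in the kernel estimates.\<close>

definition bounded_supp :: "real \<Rightarrow> real \<Rightarrow> (real^'n \<Rightarrow> complex) \<Rightarrow> bool" where
  "bounded_supp \<rho> b u \<longleftrightarrow> u \<in> borel_measurable borel \<and> (\<forall>\<xi>. norm (u \<xi>) \<le> b) \<and>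
     (\<forall>\<xi>. \<rho> < norm \<xi> \<longrightarrow> u \<xi> = 0)"

lemma bounded_suppI:
  assumes "u \<in> borel_measurable borel" "\<And>\<xi>. norm (u \<xi>) \<le> b" "\<And>\<xi>. \<rho> < norm \<xi> \<Longrightarrow> u \<xi> = 0"
  shows "bounded_supp \<rho> b u"
  using assms by (auto simp: bounded_supp_def)

lemma bounded_suppD:
  assumes "bounded_supp \<rho> b u"
  shows "u \<in> borel_measurable borel" "norm (u \<xi>) \<le> b" "\<rho> < norm \<xi> \<Longrightarrow> u \<xi> = 0" "0 \<le> b"
  using assms order_trans[OF norm_ge_zero[of "u 0"], of b] by (auto simp: bounded_supp_def)

lemma bounded_supp_mult:
  assumes "bounded_supp \<rho> b u" "g \<in> borel_measurable borel"
    and "\<And>\<xi>. norm \<xi> \<le> \<rho> \<Longrightarrow> norm (g \<xi>) \<le> c" "0 \<le> c"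
  shows "bounded_supp \<rho> (c * b) (\<lambda>\<xi>. g \<xi> * u \<xi>)"
proof (rule bounded_suppI)
  note [measurable] = bounded_suppD(1)[OF assms(1)] assms(2)
  show "(\<lambda>\<xi>. g \<xi> * u \<xi>) \<in> borel_measurable borel" by measurable
  show "norm (g \<xi> * u \<xi>) \<le> c * b" for \<xi>
  proof (cases "norm \<xi> \<le> \<rho>")
    case True
    then show ?thesis
      unfolding norm_mult using assms(3,4) bounded_suppD(2)[OF assms(1)] by (intro mult_mono) auto
  next
    case False
    then show ?thesis using bounded_suppD(3,4)[OF assms(1)] assms(4) by simp
  qed
qed (use bounded_suppD(3)[OF assms(1)] in auto)

lemma bounded_supp_integrable:
  fixes u :: "real^'n \<Rightarrow> complex"
  assumes "bounded_supp \<rho> b u" "0 \<le> \<rho>"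
  shows "integrable lborel u" "(\<integral>\<xi>. norm (u \<xi>) \<partial>lborel) \<le> b * (2 * \<rho>) ^ CARD('n)"
proof -
  \<comment> \<open>The ball of radius \<rho> lies in this cube, whose volume is explicit.\<close>
  define C :: "(real^'n) set" where "C = cbox (\<chi> i. - \<rho>) (\<chi> i. \<rho>)"
  have C: "measure lborel C = (2 * \<rho>) ^ CARD('n)"
    unfolding C_def using assms(2) by (subst content_cbox_cart) (auto simp: interval_ne_empty_cart)
  have fin: "emeasure lborel C < \<infinity>" unfolding C_def by (rule emeasure_lborel_cbox_finite)
  have le: "norm (u \<xi>) \<le> norm (b * indicator C \<xi>)" for \<xi>
  proof (cases "\<xi> \<in> C")
    case True
    then show ?thesis using bounded_suppD(2,4)[OF assms(1)] by simp
  next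
    case False
    then obtain i where "\<xi> $ i < - \<rho> \<or> \<rho> < \<xi> $ i" by (auto simp: C_def mem_box_cart not_le)
    then have "\<rho> < norm \<xi>" using component_le_norm_cart[of \<xi> i] by linarith
    then show ?thesis using bounded_suppD(3)[OF assms(1)] by simp
  qed
  have Cs: "C \<in> sets lborel" by (simp add: C_def)
  have int: "integrable lborel (\<lambda>\<xi>. b * indicator C \<xi>)"
    using fin Cs by (intro integrable_mult_right integrable_real_indicator) auto
  show i: "integrable lborel u"
    by (rule Bochner_Integration.integrable_bound[OF int]) (use bounded_suppD(1)[OF assms(1)] le in auto)
  have "(\<integral>\<xi>. norm (u \<xi>) \<partial>lborel) \<le> (\<integral>\<xi>. b * indicator C \<xi> \<partial>lborel)"
  proof (rule integral_mono[OF integrable_norm[OF i] int])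
    show "norm (u \<xi>) \<le> b * indicator C \<xi>" for \<xi>
      using le[of \<xi>] bounded_suppD(4)[OF assms(1)] by (cases "\<xi> \<in> C") auto
  qed
  then show "(\<integral>\<xi>. norm (u \<xi>) \<partial>lborel) \<le> b * (2 * \<rho>) ^ CARD('n)"
    using C Cs fin by simp
qed

lemma measurable_cis_inner [measurable]:
  "(\<lambda>x :: real^'n. cis (x \<bullet> z)) \<in> borel_measurable borel"
  "(\<lambda>x :: real^'n. cis (- (x \<bullet> z))) \<in> borel_measurable borel"
  by (auto intro!: borel_measurable_continuous_onI continuous_intros)

lemma bounded_supp_cis:
  assumes "bounded_supp \<rho> b u"
  shows "bounded_supp \<rho> b (\<lambda>x. cis (- (x \<bullet> z)) * u x)"
  using bounded_supp_mult[OF assms, of "\<lambda>x. cis (- (x \<bullet> z))" 1] by simp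

lemma norm_fourier_le:
  fixes u :: "real^'n \<Rightarrow> complex"
  assumes "bounded_supp \<rho> b u" "0 \<le> \<rho>"
  shows "norm (fourier u z) \<le> b * (2 * \<rho>) ^ CARD('n)"
proof -
  have "norm (fourier u z) \<le> (\<integral>x. norm (cis (- (x \<bullet> z)) * u x) \<partial>lborel)"
    unfolding fourier_def by (rule integral_norm_bound)
  also have "\<dots> \<le> b * (2 * \<rho>) ^ CARD('n)"
    by (rule bounded_supp_integrable(2)[OF bounded_supp_cis[OF assms(1)] assms(2)])
  finally show ?thesis .
qed

lemma bounded_supp_coord:
  fixes u :: "real^'n \<Rightarrow> complex"
  assumes "bounded_supp \<rho> b u" "0 \<le> \<rho>"
  shows "bounded_supp \<rho> (\<rho> * b) (\<lambda>\<xi>. - \<i> * of_real (\<xi> $ i) * u \<xi>)"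
proof (rule bounded_supp_mult[OF assms(1) _ _ assms(2)])
  show "(\<lambda>\<xi> :: real^'n. - \<i> * of_real (\<xi> $ i)) \<in> borel_measurable borel" by measurable
  show "norm (- \<i> * complex_of_real (\<xi> $ i)) \<le> \<rho>" if "norm \<xi> \<le> \<rho>" for \<xi> :: "real^'n"
    using that component_le_norm_cart[of \<xi> i] by (simp add: norm_mult)
qed

lemma cis_taylor: "norm (cis t - 1 - \<i> * of_real t) \<le> t\<^sup>2"
  using Taylor_exp[of "\<i> * of_real t" 1]
  by (simp add: cis_conv_exp norm_mult power2_eq_square diff_diff_eq)

text \<open>Differentiation under the integral by a direct estimate: the first order Taylor
  remainder of the character is at most |x . (w - z)|^2, hence at most \<rho>^2 |w - z|^2 where
  \<open>u\<close> is nonzero. Dividing by |w - z| leaves an error that tends to 0.\<close>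

lemma fourier_has_derivative:
  fixes u :: "real^'n \<Rightarrow> complex"
  assumes u: "bounded_supp \<rho> b u" and "0 \<le> \<rho>"
  shows "(fourier u has_derivative
     (\<lambda>v. \<Sum>i\<in>UNIV. (v $ i) *\<^sub>R fourier (\<lambda>\<xi>. - \<i> * of_real (\<xi> $ i) * u \<xi>) z)) (at z)"
    (is "(_ has_derivative ?L) _")
proof (rule has_derivativeI_sandwich[of 1])
  note [measurable] = bounded_suppD(1)[OF u]
  define M where "M = (\<integral>\<xi>. norm (of_real (\<rho>\<^sup>2) * u \<xi>) \<partial>lborel)"
  have int: "integrable lborel (\<lambda>x. cis (- (x \<bullet> z)) * u x)" for z
    by (rule bounded_supp_integrable(1)[OF bounded_supp_cis[OF u] assms(2)])
  have int2: "integrable lborel (\<lambda>x. cis (- (x \<bullet> z)) * (- \<i> * of_real (x $ i) * u x))" for z i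
    by (rule bounded_supp_integrable(1)[OF bounded_supp_cis[OF bounded_supp_coord[OF u]] assms(2)])
      (rule assms(2))
  have "bounded_supp \<rho> (\<rho>\<^sup>2 * b) (\<lambda>\<xi>. of_real (\<rho>\<^sup>2) * u \<xi>)"
    by (rule bounded_supp_mult[OF u]) (auto simp: norm_power)
  note intM = bounded_supp_integrable(1)[OF this assms(2)]
  show "bounded_linear ?L"
    by (intro bounded_linear_sum bounded_linear_compose[OF bounded_linear_scaleR_left bounded_linear_vec_nth])
  show "norm ((fourier u w - fourier u z) - ?L (w - z)) / norm (w - z) \<le> norm (w - z) * M" 
    if "w \<noteq> z" for w
  proof -
    let ?T = "\<lambda>x. \<Sum>i\<in>UNIV. ((w - z) $ i) *\<^sub>R (cis (- (x \<bullet> z)) * (- \<i> * of_real (x $ i) * u x))"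
    let ?E = "\<lambda>x. cis (- (x \<bullet> w)) * u x - cis (- (x \<bullet> z)) * u x
        - cis (- (x \<bullet> z)) * (\<i> * of_real (- (x \<bullet> (w - z)))) * u x"
    have "?L (w - z) = (\<Sum>i\<in>UNIV. (\<integral>x. ((w - z) $ i) *\<^sub>R (cis (- (x \<bullet> z)) * (- \<i> * of_real (x $ i) * u x)) \<partial>lborel))"
      unfolding fourier_def by (intro sum.cong refl integral_scaleR_right[symmetric] int2)
    also have "\<dots> = (\<integral>x. ?T x \<partial>lborel)"
      by (intro Bochner_Integration.integral_sum[symmetric] integrable_scaleR_right int2)
    finally have L: "?L (w - z) = \<dots>" .
    have eq: "?T x
       = cis (- (x \<bullet> z)) * (\<i> * of_real (- (x \<bullet> (w - z)))) * u x" for x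
    proof -
      have "?T x
         = (\<Sum>i\<in>UNIV. of_real (x $ i * (w - z) $ i) * (cis (- (x \<bullet> z)) * (- \<i>) * u x))"
        by (intro sum.cong refl) (simp add: scaleR_conv_of_real mult_ac del: vector_minus_component)
      also have "\<dots> = of_real (x \<bullet> (w - z)) * (cis (- (x \<bullet> z)) * (- \<i>) * u x)"
        unfolding sum_distrib_right[symmetric] of_real_sum[symmetric] inner_vec_def by simp
      finally show ?thesis by (simp add: mult_ac)
    qed
    have intL: "integrable lborel (\<lambda>x. ?T x)"
      by (intro Bochner_Integration.integrable_sum integrable_scaleR_right int2)
    have "(fourier u w - fourier u z) - ?L (w - z) = (\<integral>x. ?E x \<partial>lborel)"
      unfolding L unfolding fourier_def using int intL unfolding eq by simp
    then have "norm ((fourier u w - fourier u z) - ?L (w - z)) \<le> (\<integral>x. norm (?E x) \<partial>lborel)"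
      by (simp only: integral_norm_bound)
    also have "\<dots> \<le> (\<integral>x. (norm (w - z))\<^sup>2 * norm (of_real (\<rho>\<^sup>2) * u x) \<partial>lborel)"
    proof (rule integral_mono)
      show "integrable lborel (\<lambda>x. norm (?E x))"
        using int intL unfolding eq by (intro integrable_norm Bochner_Integration.integrable_diff)
      show "integrable lborel (\<lambda>x. (norm (w - z))\<^sup>2 * norm (of_real (\<rho>\<^sup>2) * u x))"
        by (intro integrable_mult_right integrable_norm intM)
      fix x :: "real^'n"
      let ?t = "- (x \<bullet> (w - z))"
      have c: "cis (- (x \<bullet> w)) = cis (- (x \<bullet> z)) * cis ?t"
        by (simp add: cis_mult inner_diff_right)
      have "norm (?E x) =
         norm (cis (- (x \<bullet> z)) * (cis ?t - 1 - \<i> * of_real ?t) * u x)"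
        unfolding c by (simp add: algebra_simps)
      also have "\<dots> \<le> ?t\<^sup>2 * norm (u x)"
        unfolding norm_mult norm_cis mult_1 by (intro mult_right_mono cis_taylor norm_ge_zero)
      also have "\<dots> \<le> (norm (w - z))\<^sup>2 * norm (of_real (\<rho>\<^sup>2) * u x)"
      proof (cases "norm x \<le> \<rho>")
        case True
        have "\<bar>x \<bullet> (w - z)\<bar> \<le> norm x * norm (w - z)" by (rule Cauchy_Schwarz_ineq2)
        also have "\<dots> \<le> \<rho> * norm (w - z)" using True by (intro mult_right_mono) auto
        finally have "\<bar>x \<bullet> (w - z)\<bar>\<^sup>2 \<le> (\<rho> * norm (w - z))\<^sup>2" by (intro power_mono) auto
        then have "?t\<^sup>2 * norm (u x) \<le> (\<rho> * norm (w - z))\<^sup>2 * norm (u x)"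
          by (intro mult_right_mono) auto
        then show ?thesis by (simp add: norm_mult norm_power power_mult_distrib mult_ac)
      next
        case False
        then show ?thesis using bounded_suppD(3)[OF u] by simp
      qed
      finally show "norm (?E x) \<le> (norm (w - z))\<^sup>2 * norm (of_real (\<rho>\<^sup>2) * u x)" .
    qed
    also have "\<dots> = (norm (w - z))\<^sup>2 * M" by (simp add: M_def)
    finally show ?thesis using that by (simp add: divide_le_eq power2_eq_square mult_ac)
  qed
  show "((\<lambda>w. norm (w - z) * M) \<longlongrightarrow> 0) (at z within UNIV)"
    by (rule tendsto_eq_intros refl | simp)+
qed auto

lemma Ck_on_fourier:
  fixes u :: "real^'n \<Rightarrow> complex"
  assumes "bounded_supp \<rho> b u" "0 \<le> \<rho>"
  shows "Ck_on k UNIV (fourier u)"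
  using assms(1)
proof (induction k arbitrary: b u)
  case 0
  have "continuous (at z) (fourier u)" for z
    using fourier_has_derivative[OF 0 assms(2)] has_derivative_continuous by blast
  then show ?case by (simp add: continuous_on_eq_continuous_at)
next
  case (Suc k)
  show ?case
    by (rule Ck_on_SucI[OF open_UNIV fourier_has_derivative[OF Suc.prems assms(2)]])
      (intro Ck_on_sum Ck_on_scaleR Ck_on_const open_UNIV Suc.IH[OF bounded_supp_coord[OF Suc.prems assms(2)]])
qed

text \<open>Each derivative multiplies the symbol by -i \<xi>_i and so costs a factor \<rho>. The
  innermost derivative is removed first, so that the induction hypothesis meets a Fourier transform
  again.\<close>

lemma norm_partials_fourier_le:
  fixes u :: "real^'n \<Rightarrow> complex"
  assumes "bounded_supp \<rho> b u" "0 \<le> \<rho>"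
  shows "norm (partials is (fourier u) z) \<le> \<rho> ^ length is * b * (2 * \<rho>) ^ CARD('n)"
  using assms(1)
proof (induction "is" arbitrary: b u rule: rev_induct)
  case Nil
  then show ?case using norm_fourier_le[OF _ assms(2)] by simp
next
  case (snoc i "is")
  have "partials [i] (fourier u) = fourier (\<lambda>\<xi>. - \<i> * of_real (\<xi> $ i) * u \<xi>)"
  proof
    fix z
    have "partials [i] (fourier u) z = (\<Sum>j\<in>UNIV. (axis i 1 $ j) *\<^sub>R fourier (\<lambda>\<xi>. - \<i> * of_real (\<xi> $ j) * u \<xi>) z)"
      using partials_Cons_eq[of "[]" "fourier u", OF _ , of _ z i] fourier_has_derivative[OF snoc.prems assms(2), of z] by simp
    also have "\<dots> = (\<Sum>j\<in>UNIV. if j = i then fourier (\<lambda>\<xi>. - \<i> * of_real (\<xi> $ j) * u \<xi>) z else 0)"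
      by (intro sum.cong) (auto simp: axis_def)
    finally show "partials [i] (fourier u) z = fourier (\<lambda>\<xi>. - \<i> * of_real (\<xi> $ i) * u \<xi>) z" by simp
  qed
  then show ?case
    using snoc.IH[OF bounded_supp_coord[OF snoc.prems assms(2)], of i] by (simp add: partials_append mult_ac)
qed

section \<open>Integrability of Fourier transforms of test functions\<close>

text \<open>Smoothness of the symbol is what makes the Fourier transform decay;
  \<open>bounded_supp\<close> alone makes it smooth.\<close>

definition test_fun :: "(real^'n \<Rightarrow> complex) \<Rightarrow> bool" where
  "test_fun u \<longleftrightarrow> (\<forall>k. Ck_on k UNIV u) \<and> (\<exists>\<rho>\<ge>0. \<forall>\<xi>. \<rho> < norm \<xi> \<longrightarrow> u \<xi> = 0)"

lemma test_fun_bounded_supp: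
  assumes "test_fun u"
  obtains \<rho> b where "0 \<le> \<rho>" "bounded_supp \<rho> b u"
proof -
  obtain \<rho> where \<rho>: "0 \<le> \<rho>" "\<And>\<xi>. \<rho> < norm \<xi> \<Longrightarrow> u \<xi> = 0" and C: "\<And>k. Ck_on k UNIV u"
    using assms by (auto simp: test_fun_def)
  obtain b where b: "\<And>x. norm (partials [] u x) \<le> b"
    using partials_bounded[OF C[of 0] compact_cball[of 0 \<rho>]] \<rho>(2) by (metis dist_0_norm le0 list.size(3) mem_cball not_le)
  have "u \<in> borel_measurable borel"
    using C[of 0] by (intro borel_measurable_continuous_onI) simp
  then have "bounded_supp \<rho> b u" using b \<rho> by (intro bounded_suppI) auto
  with that \<rho> show ?thesis by blast
qed

lemma test_fun_partial:
  assumes "test_fun u"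
  shows "test_fun (partials [i] u)"
proof -
  obtain \<rho> where \<rho>: "0 \<le> \<rho>" "\<And>\<xi>. \<rho> < norm \<xi> \<Longrightarrow> u \<xi> = 0" and C: "\<And>k. Ck_on k UNIV u"
    using assms by (auto simp: test_fun_def)
  have "partials [i] u \<xi> = 0" if "\<rho> < norm \<xi>" for \<xi>
    by (rule partials_zero_outside[of "cball 0 \<rho>"]) (use \<rho> that in auto)
  moreover have "Ck_on k UNIV (partials [i] u)" for k using C[of "Suc k"] by simp
  ultimately show ?thesis using \<rho>(1) by (auto simp: test_fun_def)
qed

lemma test_fun_diff:
  assumes "test_fun u" "test_fun \<theta>"
  shows "test_fun (\<lambda>x. u x - \<theta> x)"
proof -
  obtain \<rho>1 where \<rho>1: "0 \<le> \<rho>1" "\<And>\<xi>. \<rho>1 < norm \<xi> \<Longrightarrow> u \<xi> = 0" and C1: "\<And>k. Ck_on k UNIV u"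
    using assms by (auto simp: test_fun_def)
  obtain \<rho>2 where \<rho>2: "0 \<le> \<rho>2" "\<And>\<xi>. \<rho>2 < norm \<xi> \<Longrightarrow> \<theta> \<xi> = 0" and C2: "\<And>k. Ck_on k UNIV \<theta>"
    using assms by (auto simp: test_fun_def)
  show ?thesis unfolding test_fun_def
    using \<rho>1 \<rho>2 C1 C2 by (auto intro!: Ck_on_diff exI[of _ "max \<rho>1 \<rho>2"])
qed

section \<open>Integration by parts and decay of the Fourier transform\<close>

lemma integral_translate:
  fixes h :: "real^'n \<Rightarrow> complex"
  assumes "h \<in> borel_measurable borel"
  shows "(\<integral>x. h (c + x) \<partial>lborel) = (\<integral>x. h x \<partial>lborel)"
proof -
  have "(\<integral>x. h x \<partial>distr lborel borel ((+) c)) = (\<integral>x. h (c + x) \<partial>lborel)"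
    using assms by (intro integral_distr) auto
  then show ?thesis by (simp add: lborel_distr_plus)
qed

lemma eventually_at_ne_0_real: "(\<And>s::real. s \<noteq> 0 \<Longrightarrow> P s) \<Longrightarrow> eventually P (at 0)"
  by (auto simp: eventually_at_filter)

text \<open>Difference quotients have integral 0 by translation invariance of Lebesgue measure, and
  they converge to the derivative under a common integrable bound.\<close>

lemma integral_partial_eq_0:
  fixes h :: "real^'n \<Rightarrow> complex"
  assumes "test_fun h"
  shows "(\<integral>x. partials [i] h x \<partial>lborel) = 0"
proof -
  obtain \<rho> where \<rho>: "0 \<le> \<rho>" "\<And>\<xi>. \<rho> < norm \<xi> \<Longrightarrow> h \<xi> = 0" and C: "\<And>k. Ck_on k UNIV h"
    using assms by (auto simp: test_fun_def)
  obtain \<rho>' b where *: "0 \<le> \<rho>'" "bounded_supp \<rho>' b h" using test_fun_bounded_supp[OF assms] .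
  note int = bounded_supp_integrable(1)[OF *(2,1)]
  have [measurable]: "h \<in> borel_measurable borel" using bounded_suppD(1)[OF *(2)] .
  obtain M where M: "0 \<le> M" "\<And>is x. length is \<le> 1 \<Longrightarrow> norm (partials is h x) \<le> M"
    using partials_bounded[OF C[of 1] compact_cball[of 0 \<rho>]] \<rho>(2) by (metis dist_0_norm mem_cball not_le)
  define t where "t n = inverse (real (Suc n))" for n
  have t: "0 < t n" "t n \<le> 1" for n by (auto simp: t_def inverse_le_1_iff)
  have tlim: "t \<longlonglongrightarrow> 0" unfolding t_def by (rule LIMSEQ_inverse_real_of_nat)
  let ?e = "axis i 1 :: real^'n"
  define q where "q n x = (h (t n *\<^sub>R ?e + x) - h x) /\<^sub>R t n" for n x
  define B where "B = real CARD('n) * M"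
  have B0: "0 \<le> B" using M(1) by (simp add: B_def)
  have q0: "(\<integral>x. q n x \<partial>lborel) = 0" for n
  proof -
    have "integrable (distr lborel borel ((+) (t n *\<^sub>R ?e))) h" using int by (simp add: lborel_distr_plus)
    then have "integrable lborel (\<lambda>x. h (t n *\<^sub>R ?e + x))" by (subst (asm) integrable_distr_eq) auto
    with int have "(\<integral>x. h (t n *\<^sub>R ?e + x) - h x \<partial>lborel) = 0"
      by (simp add: integral_translate)
    then show ?thesis unfolding q_def by simp
  qed
  \<comment> \<open>The increments \<open>t n\<close> are at most 1, so all quotients vanish outside
    the ball of radius \<rho> + 1; inside it the Lipschitz constant bounds them.\<close>
  have qb: "norm (q n x) \<le> norm (complex_of_real (B * indicator (cball 0 (\<rho> + 1)) x))" for n x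
  proof (cases "x \<in> cball 0 (\<rho> + 1)")
    case True
    have "norm (h (t n *\<^sub>R ?e + x) - h x) \<le> B * norm (t n *\<^sub>R ?e + x - x)"
      unfolding B_def by (rule lipschitz_of_partials[OF C M(2)]) simp
    also have "\<dots> = B * t n" using t[of n] by (simp add: norm_axis_1)
    finally have "norm (h (t n *\<^sub>R ?e + x) - h x) / t n \<le> B" by (simp only: pos_divide_le_eq[OF t(1)])
    moreover have "norm (q n x) = norm (h (t n *\<^sub>R ?e + x) - h x) / t n"
      unfolding q_def norm_scaleR abs_inverse abs_of_pos[OF t(1)] by (simp only: divide_inverse mult.commute)
    ultimately show ?thesis using True B0 by simp
  next
    case False
    have "norm x \<le> norm (t n *\<^sub>R ?e + x) + norm (t n *\<^sub>R ?e)"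
      using norm_triangle_ineq4[of "t n *\<^sub>R ?e + x" "t n *\<^sub>R ?e"] by simp
    moreover have "norm (t n *\<^sub>R ?e) \<le> 1" using t[of n] by (simp add: norm_axis_1)
    ultimately have "\<rho> < norm (t n *\<^sub>R ?e + x)" "\<rho> < norm x" using False by auto
    then show ?thesis using \<rho>(2) by (simp add: q_def)
  qed
  have intB: "integrable lborel (\<lambda>x :: real^'n. norm (complex_of_real (B * indicator (cball 0 (\<rho> + 1)) x)))"
    by (intro integrable_norm integrable_of_real integrable_mult_right integrable_real_indicator)
      (auto simp: emeasure_bounded_finite[OF bounded_cball, unfolded infinity_ennreal_def])
  have "(\<lambda>n. q n x) \<longlonglongrightarrow> partials [i] h x" for x
  proof -
    have d: "(h has_derivative frechet_derivative h (at x)) (at x)"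
      by (rule Ck_on_SucD[OF C]) auto
    let ?Q = "\<lambda>s. (h (x + s *\<^sub>R ?e) - h x - s *\<^sub>R partials [i] h x) /\<^sub>R \<bar>s\<bar>"
    have "((\<lambda>s. x + s *\<^sub>R ?e) has_vector_derivative ?e) (at 0)"
      by (auto intro!: derivative_eq_intros)
    then have "((\<lambda>s. h (x + s *\<^sub>R ?e)) has_vector_derivative frechet_derivative h (at x) ?e) (at 0)"
      using vector_derivative_diff_chain_within[of "\<lambda>s. x + s *\<^sub>R ?e" ?e 0 UNIV h "frechet_derivative h (at x)"]
        has_derivative_at_withinI[OF d] by (simp add: o_def)
    then have "((\<lambda>s. ?Q s) \<longlongrightarrow> 0) (at 0)"
      unfolding has_vector_derivative_def has_derivative_at_within by simp
    then have "((\<lambda>s. norm (?Q s)) \<longlongrightarrow> 0) (at 0)"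
      by (rule tendsto_norm_zero)
    moreover have "\<forall>\<^sub>F s in at 0. norm (?Q s)
        = norm ((h (x + s *\<^sub>R ?e) - h x) /\<^sub>R s - partials [i] h x)"
    proof (rule eventually_at_ne_0_real)
      fix s :: real assume "s \<noteq> 0"
      then have "(h (x + s *\<^sub>R ?e) - h x) /\<^sub>R s - partials [i] h x = (h (x + s *\<^sub>R ?e) - h x - s *\<^sub>R partials [i] h x) /\<^sub>R s"
        by (simp add: scaleR_diff_right)
      then show "norm (?Q s)
        = norm ((h (x + s *\<^sub>R ?e) - h x) /\<^sub>R s - partials [i] h x)"
        by (simp only: norm_scaleR abs_inverse abs_abs)
    qed
    ultimately have "((\<lambda>s. norm ((h (x + s *\<^sub>R ?e) - h x) /\<^sub>R s - partials [i] h x)) \<longlongrightarrow> 0) (at 0)"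
      by (rule Lim_transform_eventually)
    then have "((\<lambda>s. (h (x + s *\<^sub>R ?e) - h x) /\<^sub>R s) \<longlongrightarrow> partials [i] h x) (at 0)"
      by (subst Lim_null) (rule tendsto_norm_zero_cancel)
    moreover have "filterlim t (at 0) sequentially"
      using tlim t by (intro filterlim_atI) (auto simp: less_imp_neq[symmetric])
    ultimately have "(\<lambda>n. (h (x + t n *\<^sub>R ?e) - h x) /\<^sub>R t n) \<longlonglongrightarrow> partials [i] h x"
      by (rule filterlim_compose)
    then show ?thesis by (simp add: q_def add.commute)
  qed
  moreover have "q n \<in> borel_measurable lborel" for n unfolding q_def by measurable
  moreover have "partials [i] h \<in> borel_measurable lborel"
    using partials_continuous[OF C[of 1], of "[i]"] by (auto intro: borel_measurable_continuous_onI)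
  ultimately have "(\<lambda>n. \<integral>x. q n x \<partial>lborel) \<longlonglongrightarrow> (\<integral>x. partials [i] h x \<partial>lborel)"
    using qb by (intro integral_dominated_convergence[OF _ _ intB]) auto
  then show ?thesis unfolding q0 by (simp add: LIMSEQ_const_iff)
qed

text \<open>Integration by parts, obtained by applying \<open>integral_partial_eq_0\<close> to the
  product of \<open>u\<close> with the character.\<close>

lemma fourier_partial:
  assumes "test_fun u"
  shows "fourier (partials [i] u) z = \<i> * of_real (z $ i) * fourier u z"
proof -
  obtain \<rho> where \<rho>: "0 \<le> \<rho>" "\<And>\<xi>. \<rho> < norm \<xi> \<Longrightarrow> u \<xi> = 0" and C: "\<And>k. Ck_on k UNIV u"
    using assms by (auto simp: test_fun_def)
  define h where "h x = cis (- (x \<bullet> z)) * u x" for x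
  have dc: "((\<lambda>x. cis (- (x \<bullet> z))) has_derivative (\<lambda>v. of_real (v \<bullet> z) * (- \<i> * cis (- (x \<bullet> z))))) (at x)" for x
  proof -
    have "((\<lambda>x. \<i> * of_real (- (x \<bullet> z))) has_derivative (\<lambda>v. \<i> * of_real (- (v \<bullet> z)))) (at x)"
      by (auto intro!: derivative_eq_intros)
    from has_derivative_compose[OF this DERIV_exp[unfolded has_field_derivative_def]]
    show ?thesis by (simp add: cis_conv_exp mult_ac)
  qed
  have Cc: "Ck_on k UNIV (\<lambda>x. cis (- (x \<bullet> z)))" for k
  proof (induction k)
    case 0
    show ?case by (auto intro!: continuous_intros)
  next
    case (Suc k)
    show ?case
      by (rule Ck_on_SucI[OF open_UNIV dc]) (intro Ck_on_mult Ck_on_const open_UNIV Suc)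
  qed
  have "test_fun h"
    unfolding test_fun_def h_def using \<rho> by (auto intro!: Ck_on_mult Cc C)
  have ph: "partials [i] h x = cis (- (x \<bullet> z)) * partials [i] u x - \<i> * of_real (z $ i) * (cis (- (x \<bullet> z)) * u x)" for x
  proof -
    have "(u has_derivative frechet_derivative u (at x)) (at x)" by (rule Ck_on_SucD[OF C]) auto
    from has_derivative_mult[OF dc this]
    have "(partials [] h has_derivative (\<lambda>v. cis (- (x \<bullet> z)) * frechet_derivative u (at x) v
        + of_real (v \<bullet> z) * (- \<i> * cis (- (x \<bullet> z))) * u x)) (at x)"
      by (simp add: h_def[abs_def])
    from partials_Cons_eq[OF this] show ?thesis by (simp add: inner_axis' inner_real_def mult_ac)
  qed
  obtain \<rho>1 b1 where 1: "0 \<le> \<rho>1" "bounded_supp \<rho>1 b1 u" using test_fun_bounded_supp[OF assms] .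
  obtain \<rho>2 b2 where 2: "0 \<le> \<rho>2" "bounded_supp \<rho>2 b2 (partials [i] u)"
    using test_fun_bounded_supp[OF test_fun_partial[OF assms]] .
  have "0 = (\<integral>x. partials [i] h x \<partial>lborel)"
    using integral_partial_eq_0[OF \<open>test_fun h\<close>] by simp
  also have "\<dots> = fourier (partials [i] u) z - \<i> * of_real (z $ i) * fourier u z"
    unfolding ph fourier_def
    using bounded_supp_integrable(1)[OF bounded_supp_cis[OF 1(2)] 1(1), of z]
      bounded_supp_integrable(1)[OF bounded_supp_cis[OF 2(2)] 2(1), of z]
    by (subst Bochner_Integration.integral_diff) auto
  finally show ?thesis by simp
qed

lemma fourier_diff:
  assumes "test_fun u" "test_fun \<theta>"
  shows "fourier (\<lambda>x. u x - \<theta> x) z = fourier u z - fourier \<theta> z"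
proof -
  obtain \<rho>1 b1 where 1: "0 \<le> \<rho>1" "bounded_supp \<rho>1 b1 u" using test_fun_bounded_supp[OF assms(1)] .
  obtain \<rho>2 b2 where 2: "0 \<le> \<rho>2" "bounded_supp \<rho>2 b2 \<theta>" using test_fun_bounded_supp[OF assms(2)] .
  show ?thesis
    unfolding fourier_def right_diff_distrib
    using bounded_supp_integrable(1)[OF bounded_supp_cis[OF 1(2)] 1(1), of z]
      bounded_supp_integrable(1)[OF bounded_supp_cis[OF 2(2)] 2(1), of z]
    by (rule Bochner_Integration.integral_diff)
qed

text \<open>The Fourier transform of u - partial_i partial_i u is (1 + z_i^2) times that of u, and
  the difference is again a test function, so the coordinates can be treated one after another. With
  a product as weight, integrability reduces to the one-dimensional integral of 1/(1 + x^2).\<close>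

lemma fourier_decay:
  assumes "finite I" "test_fun u"
  shows "\<exists>C. \<forall>z. norm (fourier u z) * (\<Prod>i\<in>I. 1 + (z $ i)\<^sup>2) \<le> C"
  using assms
proof (induction I arbitrary: u)
  case empty
  obtain \<rho> b where "0 \<le> \<rho>" "bounded_supp \<rho> b u" using test_fun_bounded_supp[OF empty] .
  then show ?case using norm_fourier_le by fastforce
next
  case (insert i I)
  define u' where "u' x = u x - partials [i] (partials [i] u) x" for x
  note t = test_fun_partial[OF insert.prems, of i]
  have "test_fun u'" unfolding u'_def by (intro test_fun_diff test_fun_partial insert.prems)
  then obtain C where C: "\<And>z. norm (fourier u' z) * (\<Prod>i\<in>I. 1 + (z $ i)\<^sup>2) \<le> C"
    using insert.IH by blast
  have "fourier u' z = of_real (1 + (z $ i)\<^sup>2) * fourier u z" for z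
    unfolding u'_def fourier_diff[OF insert.prems test_fun_partial[OF t]] fourier_partial[OF t]
      fourier_partial[OF insert.prems]
    by (simp add: algebra_simps power2_eq_square)
  moreover have "\<bar>1 + (z $ i)\<^sup>2\<bar> = 1 + (z $ i)\<^sup>2" for z :: "real^'a" by (simp add: add_nonneg_nonneg)
  ultimately have "norm (fourier u z) * (\<Prod>i\<in>insert i I. 1 + (z $ i)\<^sup>2) = norm (fourier u' z) * (\<Prod>i\<in>I. 1 + (z $ i)\<^sup>2)" for z
    using insert.hyps by (simp add: norm_mult del: of_real_add)
  with C show ?case by metis
qed

lemma nn_integral_inverse_1_plus_square:
  "(\<integral>\<^sup>+x. ennreal (inverse (1 + x\<^sup>2)) \<partial>lborel) < \<infinity>"
proof -
  let ?f = "\<lambda>x::real. inverse (1 + x\<^sup>2)"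
  have half: "(\<integral>\<^sup>+x. ennreal (?f x) * indicator {0..} x \<partial>lborel) = ennreal (pi / 2 - arctan 0)"
  proof (rule nn_integral_FTC_atLeast)
    show "(arctan \<longlongrightarrow> pi / 2) at_top" by (rule tendsto_arctan_at_top)
    show "DERIV arctan x :> ?f x" for x by (rule DERIV_arctan)
  qed auto
  have "(\<integral>\<^sup>+x. ennreal (?f x) * indicator {..0} x \<partial>lborel)
      = (\<integral>\<^sup>+x. ennreal (?f (0 + -1 * x)) * indicator {..0} (0 + -1 * x) \<partial>lborel)"
    by (subst nn_integral_real_affine[of _ "-1" 0]) auto
  also have "\<dots> = (\<integral>\<^sup>+x. ennreal (?f x) * indicator {0..} x \<partial>lborel)"
    by (intro nn_integral_cong) (auto simp: indicator_def)
  finally have half': "(\<integral>\<^sup>+x. ennreal (?f x) * indicator {..0} x \<partial>lborel) = ennreal (pi / 2 - arctan 0)"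
    using half by simp
  have "(\<integral>\<^sup>+x. ennreal (?f x) \<partial>lborel) \<le>
      (\<integral>\<^sup>+x. ennreal (?f x) * indicator {0..} x + ennreal (?f x) * indicator {..0} x \<partial>lborel)"
    by (intro nn_integral_mono) (auto simp: indicator_def)
  also have "\<dots> = ennreal (pi / 2 - arctan 0) + ennreal (pi / 2 - arctan 0)"
    using half half' by (subst nn_integral_add) auto
  also have "\<dots> < \<infinity>" by simp
  finally show ?thesis .
qed

lemma integrable_prod_inverse:
  "integrable lborel (\<lambda>z::real^'n. \<Prod>i\<in>UNIV. inverse (1 + (z $ i)\<^sup>2))"
proof (rule integrableI_bounded)
  show "(\<lambda>z::real^'n. \<Prod>i\<in>UNIV. inverse (1 + (z $ i)\<^sup>2)) \<in> borel_measurable lborel" by measurable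
  have pos: "0 \<le> inverse (1 + t\<^sup>2)" for t :: real by (simp add: add_nonneg_nonneg)
  have B: "(Basis :: (real^'n) set) = range (\<lambda>i. axis i 1)" by (auto simp: Basis_vec_def)
  have inj: "inj (\<lambda>i :: 'n. axis i (1::real))" by (auto simp: inj_on_def axis_eq_axis)
  have "(\<integral>\<^sup>+z. ennreal (norm (\<Prod>i\<in>UNIV. inverse (1 + ((z :: real^'n) $ i)\<^sup>2))) \<partial>lborel)
      = (\<integral>\<^sup>+z. (\<Prod>b\<in>Basis. ennreal (inverse (1 + ((z :: real^'n) \<bullet> b)\<^sup>2))) \<partial>lborel)"
    unfolding B prod.reindex[OF inj] o_def
    using pos by (intro nn_integral_cong) (simp add: prod_ennreal prod_nonneg inner_axis abs_prod)
  also have "\<dots> = (\<Prod>b\<in>(Basis :: (real^'n) set). (\<integral>\<^sup>+x. ennreal (inverse (1 + x\<^sup>2)) \<partial>lborel))"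
    by (intro nn_integral_lborel_prod) auto
  also have "\<dots> < \<infinity>"
    using nn_integral_inverse_1_plus_square by (simp add: power_less_top_ennreal)
  finally show "(\<integral>\<^sup>+z. ennreal (norm (\<Prod>i\<in>UNIV. inverse (1 + ((z :: real^'n) $ i)\<^sup>2))) \<partial>lborel) < \<infinity>" .
qed

lemma integrable_decay:
  fixes g :: "real^'n \<Rightarrow> complex"
  assumes "g \<in> borel_measurable borel" "\<And>z. norm (g z) * (\<Prod>i\<in>UNIV. 1 + (z $ i)\<^sup>2) \<le> C"
  shows "integrable lborel g"
proof (rule Bochner_Integration.integrable_bound[OF integrable_mult_right[OF integrable_prod_inverse, of C]])
  have "norm (g z) \<le> norm (C * (\<Prod>i\<in>UNIV. inverse (1 + (z $ i)\<^sup>2)))" for z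
  proof -
    have pos: "0 < (\<Prod>i\<in>UNIV. 1 + (z $ i)\<^sup>2)" by (intro prod_pos) (simp add: add_pos_nonneg)
    then have "norm (g z) \<le> C * inverse (\<Prod>i\<in>UNIV. 1 + (z $ i)\<^sup>2)"
      using assms(2)[of z] by (simp add: field_simps)
    moreover have "inverse (\<Prod>i\<in>UNIV. 1 + (z $ i)\<^sup>2) = (\<Prod>i\<in>UNIV. inverse (1 + (z $ i)\<^sup>2))"
      using prod_inversef[of "\<lambda>i. 1 + (z $ i)\<^sup>2" UNIV] by (simp add: o_def)
    ultimately have "norm (g z) \<le> C * (\<Prod>i\<in>UNIV. inverse (1 + (z $ i)\<^sup>2))" by (simp only:)
    then show ?thesis unfolding real_norm_def by linarith
  qed
  then show "AE z in lborel. norm (g z) \<le> norm (C * (\<Prod>i\<in>UNIV. inverse (1 + (z $ i)\<^sup>2)))" by simp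
qed (use assms in auto)

lemma fourier_measurable:
  assumes "bounded_supp \<rho> b u" "0 \<le> \<rho>"
  shows "fourier u \<in> borel_measurable borel"
  using Ck_on_fourier[OF assms, of 0] by (intro borel_measurable_continuous_onI) simp

lemma fourier_integrable:
  assumes "test_fun u"
  shows "integrable lborel (fourier u)"
proof -
  obtain C where C: "\<And>z. norm (fourier u z) * (\<Prod>i\<in>UNIV. 1 + (z $ i)\<^sup>2) \<le> C"
    using fourier_decay[OF finite_class.finite_UNIV assms] by blast
  obtain \<rho> b where "0 \<le> \<rho>" "bounded_supp \<rho> b u" using test_fun_bounded_supp[OF assms] .
  then show ?thesis using fourier_measurable integrable_decay C by blast
qed

section \<open>Dilations\<close>

lemma lborel_scale:
  assumes "0 < c"
  shows "(lborel :: (real^'n) measure) = density (distr lborel borel (\<lambda>x. c *\<^sub>R x)) (\<lambda>_. ennreal (c ^ CARD('n)))"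
  using lborel_affine[of c "0 :: real^'n"] assms by simp

lemma nn_integral_scale:
  fixes f :: "real^'n \<Rightarrow> ennreal"
  assumes [measurable]: "f \<in> borel_measurable borel" and "0 < c"
  shows "(\<integral>\<^sup>+x. f x \<partial>lborel) = ennreal (c ^ CARD('n)) * (\<integral>\<^sup>+x. f (c *\<^sub>R x) \<partial>lborel)"
  by (subst lborel_scale[OF assms(2)]) (simp add: nn_integral_density nn_integral_distr nn_integral_cmult)

lemma integral_scale:
  fixes f :: "real^'n \<Rightarrow> complex"
  assumes [measurable]: "f \<in> borel_measurable borel" and "0 < c"
  shows "(\<integral>x. f x \<partial>lborel) = c ^ CARD('n) *\<^sub>R (\<integral>x. f (c *\<^sub>R x) \<partial>lborel)"
  using assms(2) by (subst lborel_scale[OF assms(2)]) (simp add: integral_density integral_distr)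

lemma fourier_scale:
  fixes u :: "real^'n \<Rightarrow> complex"
  assumes [measurable]: "u \<in> borel_measurable borel" and c: "0 < c"
  shows "fourier (\<lambda>x. u ((1 / c) *\<^sub>R x)) z = of_real (c ^ CARD('n)) * fourier u (c *\<^sub>R z)"
proof -
  have "fourier (\<lambda>x. u ((1 / c) *\<^sub>R x)) z = c ^ CARD('n) *\<^sub>R (\<integral>x. cis (- (c *\<^sub>R x \<bullet> z)) * u ((1 / c) *\<^sub>R (c *\<^sub>R x)) \<partial>lborel)"
    unfolding fourier_def by (rule integral_scale[OF _ c]) measurable
  also have "(\<integral>x. cis (- (c *\<^sub>R x \<bullet> z)) * u ((1 / c) *\<^sub>R (c *\<^sub>R x)) \<partial>lborel) = fourier u (c *\<^sub>R z)"
    unfolding fourier_def using c by simp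
  finally show ?thesis by (simp only: scaleR_conv_of_real)
qed

text \<open>The factor c^n gained by the Fourier transform cancels the Jacobian of the dilation z ->
  c z. With c = 2^l this is the source of the uniformity in l.\<close>

lemma nn_integral_fourier_scale:
  fixes u :: "real^'n \<Rightarrow> complex"
  assumes "test_fun u" and c: "0 < c"
  shows "(\<integral>\<^sup>+z. ennreal (norm (fourier (\<lambda>x. u ((1 / c) *\<^sub>R x)) z)) \<partial>lborel) = (\<integral>\<^sup>+z. ennreal (norm (fourier u z)) \<partial>lborel)"
proof -
  obtain \<rho> b where b: "0 \<le> \<rho>" "bounded_supp \<rho> b u" using test_fun_bounded_supp[OF assms(1)] .
  note [measurable] = bounded_suppD(1)[OF b(2)] fourier_measurable[OF b(2,1)]
  show ?thesis
    using c by (subst nn_integral_scale[OF _ c, of "\<lambda>z. ennreal (norm (fourier u z))"])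
      (simp_all add: fourier_scale norm_mult norm_power ennreal_mult nn_integral_cmult)
qed

section \<open>Fourier multipliers as convolutions\<close>

lemma schwartz_Ck: "\<phi> \<in> schwartz \<Longrightarrow> Ck_on k UNIV \<phi>"
  by (auto simp: schwartz_def Cr_on_def)

lemma schwartz_norm_ge:
  fixes \<phi> :: "real^'n \<Rightarrow> complex"
  assumes "\<phi> \<in> schwartz" "length is \<le> N"
  shows "norm (partials is \<phi> x) \<le> schwartz_norm N \<phi>"
proof -
  have bdd: "bdd_above (range (\<lambda>x. (1 + norm x) ^ N * norm (partials is \<phi> x)))" for "is"
  proof -
    have "bounded (range (\<lambda>x. (1 + norm x) ^ N *\<^sub>R partials is \<phi> x))"
      using assms(1) by (auto simp: schwartz_def)
    then show ?thesis
      by (auto simp: bounded_iff bdd_above_def norm_power)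
  qed
  have up: "(1 + norm x) ^ N * norm (partials is \<phi> x) \<le> (SUP x. (1 + norm x) ^ N * norm (partials is \<phi> x))" for "is" x
    by (rule cSUP_upper[OF UNIV_I bdd])
  have nn: "0 \<le> (SUP x. (1 + norm x) ^ N * norm (partials is \<phi> x))" for "is"
    by (rule order_trans[OF _ up[of 0]]) simp
  have "finite {is :: 'n list. length is \<le> N}"
    using finite_lists_length_le[of "UNIV :: 'n set" N] by simp
  then have "(SUP x. (1 + norm x) ^ N * norm (partials is \<phi> x)) \<le> schwartz_norm N \<phi>"
    unfolding schwartz_norm_def using assms(2) nn
    by (intro member_le_sum[where f = "\<lambda>is. SUP x. (1 + norm x) ^ N * norm (partials is \<phi> x)"]) auto
  moreover have "1 * norm (partials is \<phi> x) \<le> (1 + norm x) ^ N * norm (partials is \<phi> x)"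
    by (intro mult_right_mono) auto
  ultimately show ?thesis using up[of x "is"] by linarith
qed

lemma schwartz_integrable:
  fixes \<phi> :: "real^'n \<Rightarrow> complex"
  assumes "\<phi> \<in> schwartz"
  shows "integrable lborel \<phi>"
proof -
  \<comment> \<open>The weight is of order 2n because each of the n factors 1 + x_i^2 is at most (1
    + |x|)^2.\<close>
  have "bounded (range (\<lambda>x. (1 + norm x) ^ (2 * CARD('n)) *\<^sub>R partials [] \<phi> x))"
    using assms unfolding schwartz_def by blast
  then obtain C where C: "\<And>x. (1 + norm x) ^ (2 * CARD('n)) * norm (\<phi> x) \<le> C"
    by (auto simp: bounded_iff norm_power)
  show ?thesis
  proof (rule integrable_decay)
    show "\<phi> \<in> borel_measurable borel"
      using schwartz_Ck[OF assms, of 0] by (intro borel_measurable_continuous_onI) simp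
    fix x :: "real^'n"
    have "(\<Prod>i\<in>UNIV. 1 + (x $ i)\<^sup>2) \<le> (\<Prod>i\<in>(UNIV :: 'n set). (1 + norm x)\<^sup>2)"
    proof (intro prod_mono conjI)
      fix i
      show "0 \<le> 1 + (x $ i)\<^sup>2" by (simp add: add_nonneg_nonneg)
      have "\<bar>x $ i\<bar>\<^sup>2 \<le> (norm x)\<^sup>2" by (intro power_mono component_le_norm_cart) simp
      then have "(x $ i)\<^sup>2 \<le> (norm x)\<^sup>2" by simp
      moreover have "(1 + norm x)\<^sup>2 = 1 + 2 * norm x + (norm x)\<^sup>2" by (simp add: power2_sum)
      ultimately show "1 + (x $ i)\<^sup>2 \<le> (1 + norm x)\<^sup>2" using norm_ge_zero[of x] by linarith
    qed
    also have "\<dots> = (1 + norm x) ^ (2 * CARD('n))" by (simp add: power_mult)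
    finally have "norm (\<phi> x) * (\<Prod>i\<in>UNIV. 1 + (x $ i)\<^sup>2) \<le> norm (\<phi> x) * (1 + norm x) ^ (2 * CARD('n))"
      by (rule mult_left_mono) simp
    with C[of x] show "norm (\<phi> x) * (\<Prod>i\<in>UNIV. 1 + (x $ i)\<^sup>2) \<le> C" by (simp add: mult.commute)
  qed
qed

lemma integrable_pair_mult:
  fixes u :: "'a \<Rightarrow> complex" and v :: "'b \<Rightarrow> complex"
  assumes "sigma_finite_measure M" "sigma_finite_measure N" and u: "integrable M u" and v: "integrable N v"
  shows "integrable (M \<Otimes>\<^sub>M N) (\<lambda>(x, y). u x * v y)"
proof -
  interpret pair_sigma_finite M N using assms(1,2) by (rule pair_sigma_finite.intro)
  note [measurable] = borel_measurable_integrable[OF u] borel_measurable_integrable[OF v]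
  show ?thesis
  proof (rule Fubini_integrable)
    show "integrable M (\<lambda>x. \<integral>y. norm (case (x, y) of (x, y) \<Rightarrow> u x * v y) \<partial>N)"
      using u by (simp add: norm_mult)
  qed (use v in auto)
qed

text \<open>\<open>kernel \<psi> (x - y)\<close> is the inverse Fourier transform of \<psi> at y -
  x. The forward transform appears because a multiplier acts on test functions by transposition: its
  value at \<open>y\<close> is the distribution tested against x ->
  \<open>kernel \<psi> (x - y)\<close>.\<close>

definition kernel :: "(real^'n \<Rightarrow> real) \<Rightarrow> real^'n \<Rightarrow> complex" where
  "kernel \<psi> z = of_real (1 / (2 * pi) ^ CARD('n)) * fourier (\<lambda>\<xi>. of_real (\<psi> \<xi>)) z"

text \<open>Carrying out the \<xi>-integral first produces the kernel. Fubini applies since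
  \<psi>(\<xi>) \<phi>(y) is integrable in both variables and the characters have modulus 1.\<close>

lemma fourier_inv_fourier_eq:
  fixes \<phi> :: "real^'n \<Rightarrow> complex"
  assumes \<psi>: "bounded_supp \<rho> b (\<lambda>\<xi>. of_real (\<psi> \<xi>))" "0 \<le> \<rho>" and \<phi>: "integrable lborel \<phi>"
  shows "fourier (\<lambda>\<xi>. of_real (\<psi> \<xi>) * inv_fourier \<phi> \<xi>) x = (\<integral>y. kernel \<psi> (x - y) * \<phi> y \<partial>lborel)"
proof -
  define c where "c = complex_of_real (1 / (2 * pi) ^ CARD('n))"
  note [measurable] = bounded_suppD(1)[OF \<psi>(1)] borel_measurable_integrable[OF \<phi>]
  define F where "F \<xi> y = cis (- (\<xi> \<bullet> x)) * of_real (\<psi> \<xi>) * c * (cis (\<xi> \<bullet> y) * \<phi> y)" for \<xi> y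
  have m: "(\<lambda>p :: (real^'n) \<times> (real^'n). cis (fst p \<bullet> snd p)) \<in> borel_measurable borel"
    by (auto intro!: borel_measurable_continuous_onI continuous_intros)
  have "integrable (lborel \<Otimes>\<^sub>M lborel) (\<lambda>(\<xi>, y). (of_real (\<psi> \<xi>) * c) * \<phi> y)"
    by (intro integrable_pair_mult integrable_mult_left bounded_supp_integrable(1)[OF \<psi>] \<phi>) unfold_locales
  then have "integrable (lborel \<Otimes>\<^sub>M lborel) (\<lambda>(\<xi>, y). F \<xi> y)"
  proof (rule Bochner_Integration.integrable_bound)
    have [measurable]: "(\<lambda>p :: (real^'n) \<times> (real^'n). cis (fst p \<bullet> snd p)) \<in> borel_measurable (lborel \<Otimes>\<^sub>M lborel)"
      using m by (simp add: lborel_prod)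
    show "(\<lambda>(\<xi>, y). F \<xi> y) \<in> borel_measurable (lborel \<Otimes>\<^sub>M lborel)"
      unfolding F_def case_prod_beta by measurable
  qed (auto simp: F_def norm_mult)
  then have "(\<integral>y. (\<integral>\<xi>. F \<xi> y \<partial>lborel) \<partial>lborel) = (\<integral>\<xi>. (\<integral>y. F \<xi> y \<partial>lborel) \<partial>lborel)"
    by (rule lborel_pair.Fubini_integral)
  moreover have "(\<integral>\<xi>. F \<xi> y \<partial>lborel) = kernel \<psi> (x - y) * \<phi> y" for y
  proof -
    have "F \<xi> y = (cis (- (\<xi> \<bullet> (x - y))) * of_real (\<psi> \<xi>)) * (c * \<phi> y)" for \<xi>
      by (simp add: F_def inner_diff_right mult_ac flip: cis_mult)
        (metis cis_mult diff_conv_add_uminus minus_diff_eq mult.commute)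
    then show ?thesis by (simp add: kernel_def fourier_def c_def mult_ac)
  qed
  moreover have "(\<integral>y. F \<xi> y \<partial>lborel) = cis (- (\<xi> \<bullet> x)) * (of_real (\<psi> \<xi>) * inv_fourier \<phi> \<xi>)" for \<xi>
    unfolding F_def inv_fourier_def c_def[symmetric] integral_mult_right_zero by (simp only: mult_ac)
  ultimately show ?thesis by (simp add: fourier_def)
qed

section \<open>Littlewood-Paley kernels\<close>

lemma lp_cutoff_bounds:
  fixes \<psi>0 :: "real^'n \<Rightarrow> real"
  assumes "lp_cutoff \<psi>0"
  shows "0 \<le> \<psi>0 x" "\<psi>0 x \<le> 1" "2 < norm x \<Longrightarrow> \<psi>0 x = 0" "\<psi>0 0 = 1" "Ck_on k UNIV \<psi>0"
proof -
  note c = assms[unfolded lp_cutoff_def]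
  have mono: "\<psi>0 (t *\<^sub>R x) \<le> \<psi>0 (s *\<^sub>R x)" if "0 \<le> s" "s \<le> t" for x s t
    using c[THEN conjunct2, THEN conjunct2, THEN conjunct1, rule_format, OF conjI[OF that]] .
  have out: "\<psi>0 x = 0" if "norm x > 2" for x
    using c[THEN conjunct2, THEN conjunct2, THEN conjunct2, THEN conjunct2, rule_format, OF that] .
  have one: "\<psi>0 0 = 1"
    by (rule c[THEN conjunct2, THEN conjunct2, THEN conjunct2, THEN conjunct1, rule_format]) simp
  have smooth: "Cr_on \<infinity> UNIV \<psi>0" by (rule c[THEN conjunct1])
  show "\<psi>0 0 = 1" by (rule one)
  show "\<psi>0 x = 0" if "2 < norm x" using out that .
  show "\<psi>0 x \<le> 1" using mono[of 0 1 x] one by simp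
  \<comment> \<open>Moving outwards along a ray can only decrease the cutoff, and it ends at 0; the
    factor 3 / |x| reaches a point beyond radius 2.\<close>
  show "0 \<le> \<psi>0 x"
  proof (cases "norm x > 0")
    case True
    let ?t = "max 1 (3 / norm x)"
    have "3 \<le> norm (?t *\<^sub>R x)" using True by (simp add: max_def field_simps)
    then have "\<psi>0 (?t *\<^sub>R x) = 0" by (intro out) linarith
    then show ?thesis using mono[of 1 ?t x] by simp
  qed (use one in auto)
  show "Ck_on k UNIV \<psi>0" using smooth by (simp add: Cr_on_def)
qed

lemma test_fun_cutoff:
  fixes \<psi>0 :: "real^'n \<Rightarrow> real"
  assumes "lp_cutoff \<psi>0" "0 < c"
  shows "test_fun (\<lambda>x. complex_of_real (\<psi>0 (c *\<^sub>R x)))"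
  unfolding test_fun_def
proof (intro conjI allI exI impI)
  have "Ck_on k UNIV (\<lambda>x. \<psi>0 (c *\<^sub>R x))" for k
    by (rule Ck_on_compose[OF open_UNIV open_UNIV UNIV_I Ck_on_bounded_linear[OF bounded_linear_scaleR_right]
       lp_cutoff_bounds(5)[OF assms(1)]])
  then show "Ck_on k UNIV (\<lambda>x. complex_of_real (\<psi>0 (c *\<^sub>R x)))" for k
    by (rule Ck_on_linear_comp[OF bounded_linear_of_real open_UNIV])
  show "0 \<le> 2 / c" using assms by simp
  show "complex_of_real (\<psi>0 (c *\<^sub>R x)) = 0" if "2 / c < norm x" for x
    using that assms lp_cutoff_bounds(3)[OF assms(1), of "c *\<^sub>R x"] by (simp add: field_simps)
qed

lemma lp_piece_bounded_supp:
  fixes \<psi>0 :: "real^'n \<Rightarrow> real"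
  assumes "lp_cutoff \<psi>0"
  shows "bounded_supp (2 * 2 ^ l) 1 (\<lambda>\<xi>. complex_of_real (lp_piece \<psi>0 l \<xi>))"
proof (rule bounded_suppI)
  have [measurable]: "\<psi>0 \<in> borel_measurable borel"
    using lp_cutoff_bounds(5)[OF assms, of 0] by (intro borel_measurable_continuous_onI) simp
  show "(\<lambda>\<xi>. complex_of_real (lp_piece \<psi>0 l \<xi>)) \<in> borel_measurable borel"
    unfolding lp_piece_def by measurable
  have "\<bar>\<psi>0 x\<bar> \<le> 1" "\<bar>\<psi>0 x - \<psi>0 y\<bar> \<le> 1" for x y
    using lp_cutoff_bounds(1,2)[OF assms, of x] lp_cutoff_bounds(1,2)[OF assms, of y] by linarith+
  then show "norm (complex_of_real (lp_piece \<psi>0 l \<xi>)) \<le> 1" for \<xi>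
    by (simp add: lp_piece_def)
  show "complex_of_real (lp_piece \<psi>0 l \<xi>) = 0" if "2 * 2 ^ l < norm \<xi>" for \<xi>
  proof -
    have "2 < norm ((1 / 2 ^ l) *\<^sub>R \<xi>)" using that by (simp add: field_simps)
    then show ?thesis
      using lp_cutoff_bounds(3)[OF assms, of "(1 / 2 ^ l) *\<^sub>R \<xi>"]
        lp_cutoff_bounds(3)[OF assms, of "2 *\<^sub>R ((1 / 2 ^ l) *\<^sub>R \<xi>)"]
      by (cases "l = 0") (auto simp: lp_piece_def)
  qed
qed

text \<open>A translation by \<open>y\<close> becomes a modulation of the symbol, which changes
  neither its size nor its support. The bounds for Fourier transforms thus hold uniformly in
  \<open>y\<close>.\<close>

lemma kernel_translate:
  "(\<lambda>x. kernel \<psi> (x - y)) =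
     fourier (\<lambda>\<xi>. (complex_of_real (1 / (2 * pi) ^ CARD('n::finite)) * cis (\<xi> \<bullet> y)) * of_real (\<psi> (\<xi> :: real^'n)))"
proof
  fix x
  show "kernel \<psi> (x - y) =
     fourier (\<lambda>\<xi>. (complex_of_real (1 / (2 * pi) ^ CARD('n)) * cis (\<xi> \<bullet> y)) * of_real (\<psi> \<xi>)) x"
    unfolding kernel_def fourier_def integral_mult_right_zero[symmetric]
  proof (intro Bochner_Integration.integral_cong refl)
    fix \<xi> :: "real^'n"
    have c: "cis (- (\<xi> \<bullet> (x - y))) = cis (- (\<xi> \<bullet> x)) * cis (\<xi> \<bullet> y)"
      by (simp add: cis_mult inner_diff_right)
    show "complex_of_real (1 / (2 * pi) ^ CARD('n)) * (cis (- (\<xi> \<bullet> (x - y))) * of_real (\<psi> \<xi>)) =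
      cis (- (\<xi> \<bullet> x)) * (complex_of_real (1 / (2 * pi) ^ CARD('n)) * cis (\<xi> \<bullet> y) * of_real (\<psi> \<xi>))"
      unfolding c by (simp only: mult_ac)
  qed
qed

lemma kernel_bounded_supp:
  fixes \<psi>0 :: "real^'n \<Rightarrow> real"
  assumes "lp_cutoff \<psi>0"
  shows "bounded_supp (2 * 2 ^ l) 1
    (\<lambda>\<xi>. (complex_of_real (1 / (2 * pi) ^ CARD('n)) * cis (\<xi> \<bullet> y)) * of_real (lp_piece \<psi>0 l \<xi>))"
proof -
  have "1 ^ CARD('n) \<le> (2 * pi) ^ CARD('n)" using pi_gt3 by (intro power_mono) auto
  then have "norm (complex_of_real (1 / (2 * pi) ^ CARD('n)) * cis (\<xi> \<bullet> y)) \<le> 1" for \<xi> :: "real^'n"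
    by (simp add: norm_mult norm_divide norm_power)
  then have "bounded_supp (2 * 2 ^ l) (1 * 1)
     (\<lambda>\<xi>. (complex_of_real (1 / (2 * pi) ^ CARD('n)) * cis (\<xi> \<bullet> y)) * of_real (lp_piece \<psi>0 l \<xi>))"
    by (intro bounded_supp_mult[OF lp_piece_bounded_supp[OF assms]]) auto
  then show ?thesis by simp
qed

lemma Ck_on_kernel:
  fixes \<psi>0 :: "real^'n \<Rightarrow> real"
  assumes "lp_cutoff \<psi>0"
  shows "Ck_on k UNIV (\<lambda>x. kernel (lp_piece \<psi>0 l) (x - y))"
  unfolding kernel_translate by (rule Ck_on_fourier[OF kernel_bounded_supp[OF assms]]) simp

text \<open>The symbol lives in radius 2 * 2^l. Enlarging all factors to powers of 4 * 2^l brings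
  the bound to the form constant times Q^l that the summation over j expects.\<close>

lemma norm_partials_kernel_le:
  fixes \<psi>0 :: "real^'n \<Rightarrow> real"
  assumes "lp_cutoff \<psi>0" "length is \<le> k"
  shows "norm (partials is (\<lambda>x. kernel (lp_piece \<psi>0 l) (x - y)) x) \<le> 4 ^ (k + CARD('n)) * (2 ^ (k + CARD('n))) ^ l"
proof -
  have "norm (partials is (\<lambda>x. kernel (lp_piece \<psi>0 l) (x - y)) x)
      \<le> (2 * 2 ^ l) ^ length is * 1 * (2 * (2 * 2 ^ l)) ^ CARD('n)"
    unfolding kernel_translate by (rule norm_partials_fourier_le[OF kernel_bounded_supp[OF assms(1)]]) simp
  also have "\<dots> \<le> (4 * 2 ^ l) ^ k * 1 * (4 * 2 ^ l) ^ CARD('n)"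
  proof (intro mult_mono)
    have "(2 * 2 ^ l :: real) ^ length is \<le> (4 * 2 ^ l) ^ length is" by (intro power_mono) auto
    also have "\<dots> \<le> (4 * 2 ^ l) ^ k"
    proof (rule power_increasing[OF assms(2)])
      show "1 \<le> 4 * (2::real) ^ l" using one_le_power[of "2::real" l] by linarith
    qed
    finally show "(2 * 2 ^ l :: real) ^ length is \<le> (4 * 2 ^ l) ^ k" .
  qed auto
  also have "\<dots> = 4 ^ (k + CARD('n)) * (2 ^ (k + CARD('n))) ^ l"
  proof -
    have "(2 ^ l) ^ m = ((2::real) ^ m) ^ l" for m
      by (simp only: power_mult[symmetric] mult.commute)
    moreover have "(4 * 2 ^ l) ^ k * 1 * (4 * 2 ^ l) ^ CARD('n) = (4 * 2 ^ l :: real) ^ (k + CARD('n))"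
      by (simp only: power_add mult_1_right)
    ultimately show ?thesis by (simp only: power_mult_distrib)
  qed
  finally show ?thesis .
qed

text \<open>There are only two L1 norms to bound: \<open>u0\<close> is the symbol for l = 0, and
  every later symbol is a dilate of the annular symbol \<open>u1\<close>. Both have integrable
  Fourier transforms, and the modulus of the normalising factor is at most 1.\<close>

lemma kernel_L1_bound:
  fixes \<psi>0 :: "real^'n \<Rightarrow> real"
  assumes "lp_cutoff \<psi>0"
  obtains C where "0 \<le> C" "\<And>l y. (\<integral>\<^sup>+x. ennreal (norm (kernel (lp_piece \<psi>0 l) (x - y))) \<partial>lborel) \<le> ennreal C"
proof -
  define u0 where "u0 x = complex_of_real (\<psi>0 (1 *\<^sub>R x))" for x
  define u1 where "u1 x = complex_of_real (\<psi>0 (1 *\<^sub>R x)) - complex_of_real (\<psi>0 (2 *\<^sub>R x))" for x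
  have t0: "test_fun u0" unfolding u0_def by (rule test_fun_cutoff[OF assms]) simp
  have t1: "test_fun u1" unfolding u1_def by (intro test_fun_diff test_fun_cutoff[OF assms]) auto
  define I where "I u = (\<integral>\<^sup>+z. ennreal (norm (fourier u z)) \<partial>lborel)" for u :: "real^'n \<Rightarrow> complex"
  have fin: "I u0 < \<infinity>" "I u1 < \<infinity>"
    using fourier_integrable[OF t0] fourier_integrable[OF t1] by (auto simp: I_def integrable_iff_bounded)
  define C where "C = enn2real (I u0 + I u1)"
  have C: "ennreal C = I u0 + I u1" unfolding C_def using fin by simp
  show ?thesis
  proof
    show "0 \<le> C" by (simp add: C_def)
    fix l :: nat and y :: "real^'n"
    let ?\<psi> = "\<lambda>\<xi>. complex_of_real (lp_piece \<psi>0 l \<xi>)"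
    have "?\<psi> = (if l = 0 then u0 else (\<lambda>x. u1 ((1 / 2 ^ l) *\<^sub>R x)))"
      by (auto simp: lp_piece_def u0_def u1_def)
    then have I: "I ?\<psi> \<le> ennreal C"
      using nn_integral_fourier_scale[OF t1, of "2 ^ l"] unfolding C by (auto simp: I_def)
    have c: "0 \<le> 1 / (2 * pi) ^ CARD('n)" "1 / (2 * pi) ^ CARD('n) \<le> 1"
    proof -
      have "1 ^ CARD('n) \<le> (2 * pi) ^ CARD('n)" using pi_gt3 by (intro power_mono) auto
      then show "1 / (2 * pi) ^ CARD('n) \<le> 1" by simp
    qed simp
    have [measurable]: "fourier ?\<psi> \<in> borel_measurable borel"
      by (rule fourier_measurable[OF lp_piece_bounded_supp[OF assms]]) simp
    have "norm (kernel (lp_piece \<psi>0 l) z) \<le> norm (fourier ?\<psi> z)" for z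
    proof -
      have "norm (complex_of_real (1 / (2 * pi) ^ CARD('n))) \<le> 1" using c by (simp only: norm_of_real abs_of_nonneg)
      from mult_right_mono[OF this norm_ge_zero[of "fourier ?\<psi> z"]]
      show ?thesis unfolding kernel_def norm_mult by (simp only: mult_1)
    qed
    then have "(\<integral>\<^sup>+x. ennreal (norm (kernel (lp_piece \<psi>0 l) (x - y))) \<partial>lborel)
       \<le> (\<integral>\<^sup>+x. ennreal (norm (fourier ?\<psi> (x - y))) \<partial>lborel)"
      by (intro nn_integral_mono ennreal_leI) auto
    also have "\<dots> = (\<integral>\<^sup>+x. ennreal (norm (fourier ?\<psi> x)) \<partial>distr lborel borel ((+) (- y)))"
      by (subst nn_integral_distr) auto
    also have "\<dots> = I ?\<psi>" by (simp add: lborel_distr_plus I_def)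
    finally show "(\<integral>\<^sup>+x. ennreal (norm (kernel (lp_piece \<psi>0 l) (x - y))) \<partial>lborel) \<le> ennreal C"
      using I by simp
  qed
qed

section \<open>Charts and functions of class \<open>C\<^sup>r\<close>\<close>

lemma Cr_onD: "Cr_on r U g \<Longrightarrow> enat k \<le> r \<Longrightarrow> Ck_on k U g"
  by (simp add: Cr_on_def)

lemma Cr_on_subset: "Cr_on r U g \<Longrightarrow> V \<subseteq> U \<Longrightarrow> Cr_on r V g"
  unfolding Cr_on_def using Ck_on_subset by blast

lemma Cr_on_cong_imp: "open U \<Longrightarrow> (\<And>x. x \<in> U \<Longrightarrow> f x = g x) \<Longrightarrow> Cr_on r U f \<Longrightarrow> Cr_on r U g"
  unfolding Cr_on_def using Ck_on_cong_imp by blast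

lemma Cr_on_continuous:
  assumes "Cr_on r U g"
  shows "continuous_on U g"
  using Cr_onD[OF assms, of 0] by (simp add: zero_enat_def[symmetric])

lemma Cr_on_local:
  assumes "\<And>x. x \<in> U \<Longrightarrow> \<exists>V. open V \<and> x \<in> V \<and> Cr_on r V g"
  shows "Cr_on r U g"
  unfolding Cr_on_def
proof (intro allI impI Ck_on_local)
  fix k x assume "enat k \<le> r" "x \<in> U"
  then show "\<exists>V. open V \<and> x \<in> V \<and> Ck_on k V g" using assms[of x] by (auto simp: Cr_on_def)
qed

lemma Cr_on_compose:
  fixes f :: "'a::real_normed_vector \<Rightarrow> 'b::euclidean_space"
  assumes "open U" "open V" "\<And>x. x \<in> U \<Longrightarrow> f x \<in> V" "Cr_on r U f" "Cr_on r V g"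
  shows "Cr_on r U (\<lambda>x. g (f x))"
  unfolding Cr_on_def
proof (intro allI impI)
  show "Ck_on k U (\<lambda>x. g (f x))" if "enat k \<le> r" for k
    using Ck_on_compose[OF assms(1-3) Cr_onD[OF assms(4) that] Cr_onD[OF assms(5) that]] .
qed

lemma is_chartD:
  assumes "is_chart c"
  shows "open (dom_of c)" "open (img_of c)" "continuous_on (dom_of c) (coord c)"
    and "continuous_on (img_of c) (point_of c)"
    and "\<And>p. p \<in> dom_of c \<Longrightarrow> point_of c (coord c p) = p"
    and "\<And>x. x \<in> img_of c \<Longrightarrow> point_of c x \<in> dom_of c"
    and "\<And>x. x \<in> img_of c \<Longrightarrow> coord c (point_of c x) = x"
    and "\<And>W. open W \<Longrightarrow> W \<subseteq> dom_of c \<Longrightarrow> open (coord c ` W)"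
    and "\<And>V. open V \<Longrightarrow> open {p \<in> dom_of c. coord c p \<in> V}"
proof -
  from assms obtain g where g: "homeomorphism (dom_of c) (img_of c) (coord c) g"
    and o: "open (dom_of c)" "open (img_of c)" by (auto simp: is_chart_def)
  have inj: "inj_on (coord c) (dom_of c)" using homeomorphism_apply1[OF g] by (metis inj_onI)
  show "open (dom_of c)" "open (img_of c)" by (fact o)+
  show c: "continuous_on (dom_of c) (coord c)" using g by (simp add: homeomorphism_def)
  show p: "point_of c (coord c p) = p" if "p \<in> dom_of c" for p using inv_into_f_f[OF inj that] .
  show "point_of c x \<in> dom_of c" if "x \<in> img_of c" for x using inv_into_into[OF that] .
  show "coord c (point_of c x) = x" if "x \<in> img_of c" for x using f_inv_into_f[OF that] .
  have "continuous_on (img_of c) g" using g by (simp add: homeomorphism_def)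
  moreover have "g x = point_of c x" if "x \<in> img_of c" for x
    using that p homeomorphism_apply1[OF g] by auto
  ultimately show cp: "continuous_on (img_of c) (point_of c)" by (metis (no_types, lifting) continuous_on_cong)
  show "open (coord c ` W)" if "open W" "W \<subseteq> dom_of c" for W
  proof -
    have "coord c ` W = img_of c \<inter> point_of c -` W" using that p by force
    then show ?thesis using continuous_on_open_vimage[OF o(2)] cp that by (metis Int_commute)
  qed
  show "open {p \<in> dom_of c. coord c p \<in> V}" if "open V" for V
  proof -
    have "{p \<in> dom_of c. coord c p \<in> V} = coord c -` V \<inter> dom_of c" by auto
    then show ?thesis using continuous_on_open_vimage[OF o(1)] c that by metis
  qed
qed

lemma transfer_chart:
  fixes c d :: "('m::topological_space, 'n::finite) chart"
  assumes c: "is_chart c" and d: "is_chart d" and t: "transition_Cr r d c"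
    and W: "open W" "W \<subseteq> dom_of c \<inter> dom_of d"
    and \<phi>: "Cr_on r (coord c ` W) (\<lambda>x. \<phi> (point_of c x))"
  shows "Cr_on r (coord d ` W) (\<lambda>x. \<phi> (point_of d x))"
proof -
  have oW: "open (coord d ` W)" "open (coord c ` W)" using W is_chartD(8)[OF c] is_chartD(8)[OF d] by auto
  have "Cr_on r (coord d ` W) (\<lambda>x. coord c (point_of d x))"
    by (rule Cr_on_subset[OF t[unfolded transition_Cr_def]]) (use W(2) in auto)
  then have "Cr_on r (coord d ` W) (\<lambda>x. \<phi> (point_of c (coord c (point_of d x))))"
    using W(2) is_chartD(5)[OF d] by (intro Cr_on_compose[OF oW _ _ \<phi>]) auto
  moreover have "\<phi> (point_of c (coord c (point_of d x))) = \<phi> (point_of d x)" if "x \<in> coord d ` W" for x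
  proof -
    from that obtain p where "x = coord d p" "p \<in> dom_of c" "p \<in> dom_of d" using W(2) by blast
    then show ?thesis using is_chartD(5)[OF d] is_chartD(5)[OF c] by simp
  qed
  ultimately show ?thesis by (rule Cr_on_cong_imp[OF oW(1), rotated])
qed

locale compact_manifold =
  fixes A :: "('m::{t2_space, second_countable_topology}, 'n::finite) chart set" and r :: enat
  assumes compact_UNIV: "compact (UNIV :: 'm set)" and atlas: "Cr_atlas r A"
begin

lemma atlasD: "c \<in> A \<Longrightarrow> is_chart c" "c \<in> A \<Longrightarrow> d \<in> A \<Longrightarrow> transition_Cr r c d"
  using atlas by (auto simp: Cr_atlas_def)

lemma atlas_cover: obtains c where "c \<in> A" "p \<in> dom_of c"
  using atlas unfolding Cr_atlas_def by blast

lemma chartsD: "c \<in> charts r A \<Longrightarrow> is_chart c"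
  "c \<in> charts r A \<Longrightarrow> d \<in> A \<Longrightarrow> transition_Cr r c d" "c \<in> charts r A \<Longrightarrow> d \<in> A \<Longrightarrow> transition_Cr r d c"
  by (auto simp: charts_def)

lemma atlas_charts: "c \<in> A \<Longrightarrow> c \<in> charts r A"
  using atlasD by (auto simp: charts_def)

text \<open>Charts of the maximal atlas are compatible with \<open>A\<close> by definition; near a
  point covered by some \<open>e\<close> in \<open>A\<close> the transition between two of them
  factors through \<open>e\<close>.\<close>

lemma charts_transition:
  assumes c: "c \<in> charts r A" and d: "d \<in> charts r A"
  shows "transition_Cr r c d"
  unfolding transition_Cr_def
proof (rule Cr_on_local)
  fix x assume "x \<in> coord c ` (dom_of c \<inter> dom_of d)"
  then obtain p where p: "p \<in> dom_of c" "p \<in> dom_of d" "x = coord c p" by auto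
  obtain e where e: "e \<in> A" "p \<in> dom_of e" by (rule atlas_cover)
  note ch = chartsD(1)[OF c] chartsD(1)[OF d] atlasD(1)[OF e(1)]
  let ?W = "dom_of c \<inter> dom_of d \<inter> dom_of e"
  have W: "open ?W" using is_chartD(1) ch by blast
  have "Cr_on r (coord e ` ?W) (\<lambda>x. coord d (point_of e x))"
    using chartsD(3)[OF d e(1)] unfolding transition_Cr_def by (rule Cr_on_subset) auto
  then have "Cr_on r (coord c ` ?W) (\<lambda>x. coord d (point_of c x))"
    by (intro transfer_chart[OF ch(3,1) chartsD(2)[OF c e(1)] W]) auto
  moreover have "open (coord c ` ?W)" using is_chartD(8)[OF ch(1) W] by auto
  ultimately show "\<exists>V. open V \<and> x \<in> V \<and> Cr_on r V (\<lambda>x. coord d (point_of c x))"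
    using p e by (intro exI[of _ "coord c ` ?W"]) auto
qed

lemma Cr_funI:
  assumes "\<And>p. \<exists>c W. c \<in> charts r A \<and> open W \<and> p \<in> W \<and> W \<subseteq> dom_of c \<and> Cr_on r (coord c ` W) (\<lambda>x. \<phi> (point_of c x))"
  shows "\<phi> \<in> Cr_fun r A"
  unfolding Cr_fun_def mem_Collect_eq
proof (intro ballI Cr_on_local)
  fix d x assume d: "d \<in> A" and "x \<in> img_of d"
  then obtain p where p: "p \<in> dom_of d" "x = coord d p" by auto
  obtain c W where c: "c \<in> charts r A" "open W" "p \<in> W" "W \<subseteq> dom_of c"
    "Cr_on r (coord c ` W) (\<lambda>x. \<phi> (point_of c x))" using assms[of p] by blast
  note ch = chartsD(1)[OF c(1)] atlasD(1)[OF d]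
  let ?W = "W \<inter> dom_of d"
  have W: "open ?W" using is_chartD(1)[OF ch(2)] c(2) by blast
  have "Cr_on r (coord d ` ?W) (\<lambda>x. \<phi> (point_of d x))"
    using c by (intro transfer_chart[OF ch chartsD(3)[OF c(1) d] W] Cr_on_subset[OF c(5)]) auto
  moreover have "open (coord d ` ?W)" using is_chartD(8)[OF ch(2) W] by auto
  ultimately show "\<exists>V. open V \<and> x \<in> V \<and> Cr_on r V (\<lambda>x. \<phi> (point_of d x))"
    using p c by (intro exI[of _ "coord d ` ?W"]) auto
qed

lemma Cr_funD:
  assumes \<phi>: "\<phi> \<in> Cr_fun r A" and c: "c \<in> charts r A"
  shows "Cr_on r (img_of c) (\<lambda>x. \<phi> (point_of c x))"
proof (rule Cr_on_local)
  fix x assume "x \<in> img_of c"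
  then obtain p where p: "p \<in> dom_of c" "x = coord c p" by auto
  obtain e where e: "e \<in> A" "p \<in> dom_of e" by (rule atlas_cover)
  note ch = chartsD(1)[OF c] atlasD(1)[OF e(1)]
  let ?W = "dom_of c \<inter> dom_of e"
  have W: "open ?W" using is_chartD(1) ch by blast
  have "Cr_on r (coord e ` ?W) (\<lambda>x. \<phi> (point_of e x))"
    using \<phi> e(1) unfolding Cr_fun_def by (auto intro: Cr_on_subset)
  then have "Cr_on r (coord c ` ?W) (\<lambda>x. \<phi> (point_of c x))"
    by (intro transfer_chart[OF ch(2,1) chartsD(2)[OF c e(1)] W]) auto
  moreover have "open (coord c ` ?W)" using is_chartD(8)[OF ch(1) W] by auto
  ultimately show "\<exists>V. open V \<and> x \<in> V \<and> Cr_on r V (\<lambda>x. \<phi> (point_of c x))"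
    using p e by (intro exI[of _ "coord c ` ?W"]) auto
qed

lemma Cr_fun_continuous:
  assumes "\<phi> \<in> Cr_fun r A"
  shows "continuous_on UNIV \<phi>"
proof -
  have "continuous (at p) \<phi>" for p
  proof -
    obtain c where c: "c \<in> A" "p \<in> dom_of c" by (rule atlas_cover)
    note ch = atlasD(1)[OF c(1)]
    have "Cr_on r (img_of c) (\<lambda>x. \<phi> (point_of c x))" using assms c by (simp add: Cr_fun_def)
    then have "continuous_on (dom_of c) (\<lambda>p. \<phi> (point_of c (coord c p)))"
      by (intro continuous_on_compose2[OF Cr_on_continuous is_chartD(3)[OF ch]]) auto
    then have "continuous_on (dom_of c) \<phi>"
      using is_chartD(5)[OF ch] by (metis (no_types, lifting) continuous_on_cong)
    then show ?thesis using c(2) is_chartD(1)[OF ch] by (simp add: continuous_on_eq_continuous_at)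
  qed
  then show ?thesis by (simp add: continuous_on_eq_continuous_at)
qed

lemma Cr_fun_atlasD: "\<phi> \<in> Cr_fun r A \<Longrightarrow> c \<in> A \<Longrightarrow> enat k \<le> r \<Longrightarrow> Ck_on k (img_of c) (\<lambda>x. \<phi> (point_of c x))"
  unfolding Cr_fun_def Cr_on_def by blast

lemma Cr_fun_atlasI:
  assumes "\<And>c k. c \<in> A \<Longrightarrow> open (img_of c) \<Longrightarrow> enat k \<le> r \<Longrightarrow> Ck_on k (img_of c) (\<lambda>x. \<phi> (point_of c x))"
  shows "\<phi> \<in> Cr_fun r A"
  unfolding Cr_fun_def Cr_on_def using assms is_chartD(2)[OF atlasD(1)] by blast

lemma Cr_fun_linear_comp:
  assumes "bounded_linear L" "\<phi> \<in> Cr_fun r A"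
  shows "(\<lambda>p. L (\<phi> p)) \<in> Cr_fun r A"
  by (rule Cr_fun_atlasI) (rule Ck_on_linear_comp[OF assms(1) _ Cr_fun_atlasD[OF assms(2)]])

lemma Cr_fun_bilinear:
  assumes "bounded_bilinear B" "\<phi> \<in> Cr_fun r A" "\<theta> \<in> Cr_fun r A"
  shows "(\<lambda>p. B (\<phi> p) (\<theta> p)) \<in> Cr_fun r A"
  by (rule Cr_fun_atlasI)
    (rule Ck_on_bilinear[OF assms(1) _ Cr_fun_atlasD[OF assms(2)] Cr_fun_atlasD[OF assms(3)]])

lemma Cr_fun_sum:
  assumes "\<And>i. i \<in> I \<Longrightarrow> \<phi> i \<in> Cr_fun r A"
  shows "(\<lambda>p. \<Sum>i\<in>I. \<phi> i p) \<in> Cr_fun r A"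
  by (rule Cr_fun_atlasI) (rule Ck_on_sum[OF _ Cr_fun_atlasD[OF assms]])

lemma Cr_fun_inverse:
  fixes \<phi> :: "'m \<Rightarrow> real"
  assumes "\<phi> \<in> Cr_fun r A" "\<And>p. \<phi> p \<noteq> 0"
  shows "(\<lambda>p. inverse (\<phi> p)) \<in> Cr_fun r A"
  by (rule Cr_fun_atlasI) (rule Ck_on_inverse[OF _ Cr_fun_atlasD[OF assms(1)] assms(2)])

section \<open>Localization in a chart and test functions supported in a chart\<close>

abbreviation support :: "('m \<Rightarrow> real) \<Rightarrow> 'm set" where
  "support \<eta> \<equiv> closure {p. \<eta> p \<noteq> 0}"

definition supported_in :: "('m, 'n) chart \<Rightarrow> ('m \<Rightarrow> real) \<Rightarrow> bool" where
  "supported_in c \<eta> \<longleftrightarrow> c \<in> charts r A \<and> \<eta> \<in> Cr_fun r A \<and> support \<eta> \<subseteq> dom_of c"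

lemma mem_support: "\<eta> p \<noteq> 0 \<Longrightarrow> p \<in> support \<eta>"
  by (rule subsetD[OF closure_subset]) simp

lemma supported_zero: "supported_in c \<eta> \<Longrightarrow> p \<notin> dom_of c \<Longrightarrow> \<eta> p = 0"
  unfolding supported_in_def using mem_support[of \<eta> p] by blast

lemma compact_closed: "closed K \<Longrightarrow> compact (K :: 'm set)"
  using compact_Int_closed[OF compact_UNIV] by simp

lemma localize_compact:
  assumes c: "c \<in> charts r A" and K: "closed K" "K \<subseteq> dom_of c"
  shows "compact (coord c ` K)" "coord c ` K \<subseteq> img_of c"
  using compact_continuous_image[OF continuous_on_subset[OF is_chartD(3)[OF chartsD(1)[OF c]] K(2)] compact_closed[OF K(1)]] K
  by auto

lemma localize_zero:
  assumes c: "supported_in c \<eta>" and x: "x \<notin> coord c ` support \<eta>"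
  shows "localize c \<eta> \<phi> x = 0"
proof -
  have "\<eta> (point_of c x) = 0" if "x \<in> img_of c"
  proof (rule ccontr)
    assume "\<eta> (point_of c x) \<noteq> 0"
    then have "point_of c x \<in> support \<eta>" by (rule mem_support)
    then have "coord c (point_of c x) \<in> coord c ` support \<eta>" by (rule imageI)
    then show False using x is_chartD(7)[OF chartsD(1)] that c by (simp add: supported_in_def)
  qed
  then show ?thesis by (simp add: localize_def)
qed

lemma localize_Ck:
  assumes c: "supported_in c \<eta>" and \<phi>: "\<phi> \<in> Cr_fun r A" and k: "enat k \<le> r"
  shows "Ck_on k UNIV (localize c \<eta> \<phi>)"
proof -
  have cc: "c \<in> charts r A" and \<eta>: "\<eta> \<in> Cr_fun r A" and cl: "support \<eta> \<subseteq> dom_of c"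
    using c by (auto simp: supported_in_def)
  note ch = chartsD(1)[OF cc]
  note K = localize_compact[OF cc closed_closure cl]
  have "Ck_on k (img_of c) (\<lambda>x. \<eta> (point_of c x) *\<^sub>R \<phi> (point_of c x))"
    by (intro Ck_on_scaleR is_chartD(2)[OF ch] Cr_onD[OF Cr_funD[OF _ cc] k] \<phi> \<eta>)
  then have "Ck_on k (img_of c) (localize c \<eta> \<phi>)"
    by (rule Ck_on_cong_imp[OF is_chartD(2)[OF ch], rotated]) (auto simp: localize_def)
  then show ?thesis
    by (rule Ck_on_ext0[OF is_chartD(2)[OF ch] compact_imp_closed[OF K(1)] K(2)]) (rule localize_zero[OF c])
qed

lemma Cr_fun_ext0:
  assumes d: "d \<in> charts r A" and K: "closed K" "K \<subseteq> dom_of d" and \<phi>0: "\<And>p. p \<notin> K \<Longrightarrow> \<phi> p = 0"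
    and \<phi>: "Cr_on r (img_of d) (\<lambda>x. \<phi> (point_of d x))"
  shows "\<phi> \<in> Cr_fun r A"
proof (rule Cr_funI)
  fix p
  note ch = chartsD(1)[OF d]
  show "\<exists>c W. c \<in> charts r A \<and> open W \<and> p \<in> W \<and> W \<subseteq> dom_of c \<and> Cr_on r (coord c ` W) (\<lambda>x. \<phi> (point_of c x))"
  proof (cases "p \<in> dom_of d")
    case True
    then show ?thesis using d \<phi> is_chartD(1)[OF ch] by blast
  next
    case False
    obtain e where e: "e \<in> A" "p \<in> dom_of e" by (rule atlas_cover)
    note ech = atlasD(1)[OF e(1)]
    \<comment> \<open>A point outside the domain of \<open>d\<close> has a neighbourhood that avoids
      the closed set \<open>K\<close>, and \<phi> is 0 there.\<close>
    let ?W = "dom_of e - K"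
    have W: "open ?W" using is_chartD(1)[OF ech] K(1) by blast
    have oW: "open (coord e ` ?W)" using is_chartD(8)[OF ech W] by auto
    have "Cr_on r (coord e ` ?W) (\<lambda>x. \<phi> (point_of e x))"
      unfolding Cr_on_def
    proof (intro allI impI)
      show "Ck_on k (coord e ` ?W) (\<lambda>x. \<phi> (point_of e x))" for k
      proof (rule Ck_on_cong_imp[OF oW _ Ck_on_const[of _ _ 0]])
        fix x assume "x \<in> coord e ` ?W"
        then obtain q where q: "x = coord e q" "q \<in> ?W" by blast
        then have "point_of e x = q" using is_chartD(5)[OF ech] by simp
        then show "0 = \<phi> (point_of e x)" using \<phi>0[of q] q(2) by simp
      qed
    qed
    moreover have "p \<in> ?W" using e(2) False K(2) by blast
    ultimately show ?thesis using W atlas_charts[OF e(1)] by blast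
  qed
qed

text \<open>This is the test function to which \<open>coord_dist c \<eta> u\<close> applies
  \<open>u\<close>.\<close>

abbreviation (input) pushforward :: "('m, 'n) chart \<Rightarrow> ('m \<Rightarrow> real) \<Rightarrow> (real^'n \<Rightarrow> complex) \<Rightarrow> 'm \<Rightarrow> complex" where
  "pushforward c \<eta> \<theta> \<equiv> \<lambda>p. complex_of_real (\<eta> p) * \<theta> (coord c p)"

lemma Cr_fun_pushforward:
  assumes c: "supported_in c \<eta>" and \<theta>: "Cr_on r UNIV \<theta>"
  shows "pushforward c \<eta> \<theta> \<in> Cr_fun r A"
proof -
  have cc: "c \<in> charts r A" and \<eta>: "\<eta> \<in> Cr_fun r A" and cl: "support \<eta> \<subseteq> dom_of c"
    using c by (auto simp: supported_in_def)
  note ch = chartsD(1)[OF cc]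
  have "Cr_on r (img_of c) (\<lambda>x. complex_of_real (\<eta> (point_of c x)) * \<theta> x)"
    unfolding Cr_on_def
    by (intro allI impI Ck_on_mult is_chartD(2)[OF ch] Ck_on_linear_comp[OF bounded_linear_of_real]
        Cr_onD[OF Cr_funD[OF \<eta> cc]] Ck_on_subset[OF Cr_onD[OF \<theta>]]) auto
  then have "Cr_on r (img_of c) (\<lambda>x. complex_of_real (\<eta> (point_of c x)) * \<theta> (coord c (point_of c x)))"
    by (rule Cr_on_cong_imp[OF is_chartD(2)[OF ch], rotated]) (simp add: is_chartD(7)[OF ch])
  then show ?thesis
    by (intro Cr_fun_ext0[OF cc closed_closure cl]) (use mem_support[of \<eta>] in auto)
qed

text \<open>Seen in the chart \<open>d\<close>, the function is \<zeta> \<eta> times \<theta>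
  composed with the transition map, hence a cut-off pullback. The cut-off is supported in the image
  of the intersection of both supports, a compact set inside the domain of the transition
  map.\<close>

lemma localize_pushforward:
  assumes c: "supported_in c \<eta>" and d: "supported_in d \<zeta>" and k: "enat k \<le> r"
  shows "\<exists>B\<ge>0. \<forall>\<theta> M. Ck_on k UNIV \<theta> \<longrightarrow>
      partials_le k M \<theta> \<longrightarrow>
      partials_le k (B * M) (localize d \<zeta> (pushforward c \<eta> \<theta>))"
proof -
  have cc: "c \<in> charts r A" and \<eta>: "\<eta> \<in> Cr_fun r A" and cl: "support \<eta> \<subseteq> dom_of c"
    using c by (auto simp: supported_in_def)
  have dd: "d \<in> charts r A" and \<zeta>: "\<zeta> \<in> Cr_fun r A" and dl: "support \<zeta> \<subseteq> dom_of d"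
    using d by (auto simp: supported_in_def)
  note ch = chartsD(1)[OF cc] chartsD(1)[OF dd]
  let ?a = "localize d \<zeta> \<eta>" and ?\<tau> = "\<lambda>x. coord c (point_of d x)"
  let ?W = "dom_of d \<inter> dom_of c" and ?K = "support \<zeta> \<inter> support \<eta>"
  have W: "open ?W" using is_chartD(1) ch by blast
  have oW: "open (coord d ` ?W)" using is_chartD(8)[OF ch(2) W] by auto
  have K: "compact (coord d ` ?K)" by (rule localize_compact(1)[OF dd]) (use dl in auto)
  have KW: "coord d ` ?K \<subseteq> coord d ` ?W" using cl dl by blast
  have a0: "?a x = 0" if x: "x \<notin> coord d ` ?K" for x
  proof (cases "x \<in> img_of d")
    case True
    have "point_of d x \<notin> ?K"
    proof
      assume "point_of d x \<in> ?K"
      then have "coord d (point_of d x) \<in> coord d ` ?K" by (rule imageI)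
      then show False using x by (simp only: is_chartD(7)[OF ch(2) True])
    qed
    then have "\<zeta> (point_of d x) = 0 \<or> \<eta> (point_of d x) = 0"
      using mem_support[of \<eta> "point_of d x"] mem_support[of \<zeta> "point_of d x"] by blast
    then show ?thesis by (auto simp: localize_def)
  qed (simp add: localize_def)
  have \<tau>: "Ck_on k (coord d ` ?W) ?\<tau>"
    using Cr_onD[OF charts_transition[OF dd cc, unfolded transition_Cr_def] k] .
  have eq: "localize d \<zeta> (pushforward c \<eta> \<theta>) = (\<lambda>x. ?a x *\<^sub>R \<theta> (?\<tau> x))" for \<theta>
    by (auto simp: localize_def scaleR_conv_of_real)
  show ?thesis unfolding eq
    by (rule pullback_bound[OF oW K KW \<tau> localize_Ck[OF d \<eta> k] a0])
qed

end

section \<open>Coordinates in which a volume form is standard\<close>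

text \<open>The points on the line through \<open>x\<close> parallel to the k-th axis: s = 1 gives
  \<open>x\<close> and s = 0 its projection to the hyperplane where coordinate \<open>k\<close>
  equals \<open>a\<close>.\<close>

definition shrink :: "'n \<Rightarrow> real \<Rightarrow> real \<Rightarrow> real^'n \<Rightarrow> real^'n" where
  "shrink k a s x = x - ((1 - s) * (x $ k - a)) *\<^sub>R axis k 1"

lemma shrink_in_ball:
  assumes "x \<in> ball x0 e" "s \<in> {0..1}"
  shows "shrink k (x0 $ k) s x \<in> ball x0 e"
proof -
  have "\<bar>(x0 - shrink k (x0 $ k) s x) $ i\<bar> \<le> \<bar>(x0 - x) $ i\<bar>" for i
  proof (cases "i = k")
    case True
    have "(x0 - shrink k (x0 $ k) s x) $ i = s * (x0 - x) $ i"
      using True by (simp add: shrink_def algebra_simps)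
    then show ?thesis using assms(2) mult_right_mono[of s 1 "\<bar>(x0 - x) $ i\<bar>"] by (simp add: abs_mult)
  next
    case False
    then show ?thesis by (simp add: shrink_def axis_def)
  qed
  then have "norm (x0 - shrink k (x0 $ k) s x) \<le> norm (x0 - x)" by (intro norm_le_componentwise_cart) simp
  then show ?thesis using assms(1) by (simp add: dist_norm)
qed

lemma shrink_continuous:
  fixes g :: "real^'n \<Rightarrow> 'b::topological_space"
  assumes "continuous_on (ball x0 e) g"
  shows "continuous_on (ball x0 e \<times> {0..1}) (\<lambda>p. g (shrink k (x0 $ k) (snd p) (fst p)))"
proof (rule continuous_on_compose2[OF assms])
  show "continuous_on (ball x0 e \<times> {0..1}) (\<lambda>p. shrink k (x0 $ k) (snd p) (fst p))"
    unfolding shrink_def by (intro continuous_intros)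
qed (use shrink_in_ball in fastforce)

lemma shrink_continuous_right:
  fixes g :: "real^'n \<Rightarrow> 'b::topological_space"
  assumes "continuous_on (ball x0 e) g" "x \<in> ball x0 e"
  shows "continuous_on {0..1} (\<lambda>s. g (shrink k (x0 $ k) s x))"
proof (rule continuous_on_compose2[OF assms(1)])
  show "continuous_on {0..1} (\<lambda>s. shrink k (x0 $ k) s x)"
    unfolding shrink_def by (intro continuous_intros)
qed (use shrink_in_ball[OF assms(2)] in auto)

text \<open>For m = 0, multiplying by x_k - a gives the integral of \<open>h\<close> along
  coordinate \<open>k\<close> from \<open>a\<close> to x_k, here rescaled to a fixed interval so
  that one can differentiate under the integral. The weight s^m makes the family closed under
  differentiation, because each derivative in direction \<open>k\<close> brings down a factor
  s.\<close>

definition ray_integral :: "'n \<Rightarrow> real \<Rightarrow> nat \<Rightarrow> (real^'n \<Rightarrow> real) \<Rightarrow> real^'n \<Rightarrow> real" where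
  "ray_integral k a m h x = integral {0..1} (\<lambda>s. s ^ m * h (shrink k a s x))"

lemma ray_integral_has_derivative:
  fixes h :: "real^'n \<Rightarrow> real"
  assumes h: "Ck_on (Suc 0) (ball x0 e) h" and x: "x \<in> ball x0 e"
  shows "(ray_integral k (x0 $ k) m h has_derivative
    (\<lambda>v. \<Sum>i\<in>UNIV. v $ i * ray_integral k (x0 $ k) (if i = k then Suc m else m)
       (\<lambda>z. frechet_derivative h (at z) (axis i 1)) x)) (at x)"
proof -
  let ?W = "ball x0 e" and ?sh = "shrink k (x0 $ k)"
  define p where "p i z = frechet_derivative h (at z) (axis i 1)" for i z
  have pc: "continuous_on ?W (p i)" for i using h unfolding p_def by simp
  have hc: "continuous_on ?W h" by (rule Ck_on_continuous[OF h])
  \<comment> \<open>The inner derivative of \<open>shrink\<close> in direction \<open>i\<close>: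
    moving x_k by t moves the point by s t only.\<close>
  define w where "w i s = (if i = k then s else 1 :: real)" for i s
  \<comment> \<open>The derivative of the integrand is written as a bounded linear map, since the
    Leibniz rule integrates values in that space.\<close>
  define F where "F x s = (\<Sum>i\<in>UNIV. (s ^ m * (w i s * p i (?sh s x))) *\<^sub>R blinfun_inner_left (axis i 1 :: real^'n))" for x s
  have wc: "continuous_on S (w i)" for i S unfolding w_def by (cases "i = k") (auto intro: continuous_intros)
  have int: "(\<lambda>s. s ^ m * (w i s * p i (?sh s x))) integrable_on {0..1}" for i
    by (intro integrable_continuous_real continuous_intros wc shrink_continuous_right[OF pc x])
  have "((\<lambda>x. integral (cbox 0 1) (\<lambda>s. s ^ m * h (?sh s x))) has_derivative integral (cbox 0 1) (F x)) (at x within ?W)"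
  proof (rule leibniz_rule[OF _ _ _ x convex_ball])
    show "(\<lambda>s. s ^ m * h (?sh s z)) integrable_on cbox 0 1" if "z \<in> ?W" for z
      unfolding cbox_interval
      by (intro integrable_continuous_real continuous_intros shrink_continuous_right[OF hc that])
    show "continuous_on (?W \<times> cbox 0 1) (\<lambda>(x, t). F x t)"
      unfolding F_def case_prod_beta cbox_interval
      by (intro continuous_intros shrink_continuous pc continuous_on_compose2[OF wc[of UNIV]]) auto
    fix z :: "real^'n" and t :: real assume z: "z \<in> ?W" and "t \<in> cbox 0 1"
    then have t: "t \<in> {0..1}" by simp
    have dh: "(h has_derivative frechet_derivative h (at (?sh t z))) (at (?sh t z))"
      by (rule Ck_on_SucD[OF h shrink_in_ball[OF z t]])
    have ds: "(?sh t has_derivative (\<lambda>v. v - ((1 - t) * (v $ k)) *\<^sub>R axis k 1)) (at z)"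
      unfolding shrink_def by (auto intro!: derivative_eq_intros bounded_linear_imp_has_derivative)
    have "((\<lambda>x. h (?sh t x)) has_derivative (\<lambda>v. frechet_derivative h (at (?sh t z)) (v - ((1 - t) * (v $ k)) *\<^sub>R axis k 1))) (at z)"
      by (rule has_derivative_compose[OF ds dh])
    then have "((\<lambda>x. t ^ m * h (?sh t x)) has_derivative (\<lambda>v. t ^ m * frechet_derivative h (at (?sh t z)) (v - ((1 - t) * (v $ k)) *\<^sub>R axis k 1))) (at z)"
      by (rule has_derivative_mult_right)
    moreover have "t ^ m * frechet_derivative h (at (?sh t z)) (v - ((1 - t) * (v $ k)) *\<^sub>R axis k 1) = blinfun_apply (F z t) v" for v
    proof -
      have "frechet_derivative h (at (?sh t z)) (v - ((1 - t) * (v $ k)) *\<^sub>R axis k 1)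
        = (\<Sum>i\<in>UNIV. (v - ((1 - t) * (v $ k)) *\<^sub>R axis k 1) $ i *\<^sub>R p i (?sh t z))"
        unfolding p_def by (rule linear_axis_sum[OF has_derivative_linear[OF dh]])
      also have "\<dots> = (\<Sum>i\<in>UNIV. w i t * p i (?sh t z) * v $ i)"
        by (intro sum.cong refl) (auto simp: w_def axis_def algebra_simps)
      finally show ?thesis
        by (simp add: F_def blinfun.sum_left blinfun.scaleR_left inner_axis sum_distrib_left mult_ac)
    qed
    ultimately show "((\<lambda>x. t ^ m * h (?sh t x)) has_derivative blinfun_apply (F z t)) (at z within ?W)"
      by (simp add: has_derivative_at_withinI)
  qed
  note deriv = this
  have "blinfun_apply (integral {0..1} (F x)) v =
     (\<Sum>i\<in>UNIV. v $ i * ray_integral k (x0 $ k) (if i = k then Suc m else m) (p i) x)" for v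
  proof -
    have intF: "F x integrable_on {0..1}"
      unfolding F_def
      by (intro integrable_continuous_real continuous_intros wc shrink_continuous_right[OF pc x])
    have "blinfun_apply (integral {0..1} (F x)) v = integral {0..1} (\<lambda>s. blinfun_apply (F x s) v)"
      using integral_linear[OF intF blinfun.bounded_linear_left[of v]] by (simp add: o_def)
    also have "\<dots> = integral {0..1} (\<lambda>s. \<Sum>i\<in>UNIV. v $ i * (s ^ m * (w i s * p i (?sh s x))))"
      by (simp add: F_def blinfun.sum_left blinfun.scaleR_left inner_axis mult_ac)
    also have "\<dots> = (\<Sum>i\<in>UNIV. integral {0..1} (\<lambda>s. v $ i * (s ^ m * (w i s * p i (?sh s x)))))"
      by (rule integral_sum) (auto intro: integrable_on_mult_right int)
    also have "\<dots> = (\<Sum>i\<in>UNIV. v $ i * ray_integral k (x0 $ k) (if i = k then Suc m else m) (p i) x)"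
    proof (intro sum.cong refl)
      fix i
      have "(\<lambda>s. s ^ m * (w i s * p i (?sh s x))) = (\<lambda>s. s ^ (if i = k then Suc m else m) * p i (?sh s x))"
        by (auto simp: w_def mult_ac)
      then show "integral {0..1} (\<lambda>s. v $ i * (s ^ m * (w i s * p i (?sh s x))))
         = v $ i * ray_integral k (x0 $ k) (if i = k then Suc m else m) (p i) x"
        unfolding ray_integral_def integral_mult_right by simp
    qed
    finally show ?thesis .
  qed
  then have "blinfun_apply (integral (cbox 0 1) (F x)) =
     (\<lambda>v. \<Sum>i\<in>UNIV. v $ i * ray_integral k (x0 $ k) (if i = k then Suc m else m) (p i) x)"
    unfolding cbox_interval by (rule ext)
  moreover have "frechet_derivative h (at z) (axis i 1) = p i z" for i z
    unfolding p_def ..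
  ultimately show ?thesis
    using deriv unfolding ray_integral_def[abs_def] at_within_open[OF x open_ball] cbox_interval by (simp only:)
qed

lemma Ck_on_ray_integral:
  fixes h :: "real^'n \<Rightarrow> real"
  assumes "Ck_on j (ball x0 e) h"
  shows "Ck_on j (ball x0 e) (ray_integral k (x0 $ k) m h)"
  using assms
proof (induction j arbitrary: h m)
  case 0
  then have "continuous_on (ball x0 e) h" by simp
  then have "continuous_on (ball x0 e \<times> cbox 0 1) (\<lambda>(x, s). s ^ m * h (shrink k (x0 $ k) s x))"
    unfolding case_prod_beta cbox_interval by (intro continuous_intros shrink_continuous)
  then show ?case unfolding ray_integral_def[abs_def]
    using integral_continuous_on_param[where a = "0::real" and b = 1] by (simp add: cbox_interval)
next
  case (Suc j)
  have h1: "Ck_on (Suc 0) (ball x0 e) h" using Suc.prems by (rule Ck_on_mono) simp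
  have "Ck_on j (ball x0 e) (\<lambda>z. frechet_derivative h (at z) (axis i 1))" for i using Suc.prems by simp
  then show ?case
    by (intro Ck_on_SucI[OF open_ball ray_integral_has_derivative[OF h1]] Ck_on_sum Ck_on_mult Ck_on_const open_ball Suc.IH)
qed

text \<open>The coordinate \<open>x\<^sub>k\<close> is replaced by \<open>\<integral> h dx\<^sub>k\<close>, so that the Jacobian matrix is the identity
  except in the row \<open>k\<close>, whose diagonal entry is \<open>h\<close>.\<close>

lemma straighten_density:
  fixes h :: "real^'n \<Rightarrow> real"
  assumes U: "open U" "x0 \<in> U" and h: "\<And>j. Ck_on j U h" and h0: "\<And>x. x \<in> U \<Longrightarrow> h x \<noteq> 0"
  obtains W \<Phi> \<Psi> where "open W" "x0 \<in> W" "W \<subseteq> U" "open (\<Phi> ` W)"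
    "\<And>j. Ck_on j W \<Phi>" "\<And>j. Ck_on j (\<Phi> ` W) \<Psi>" "\<And>x. x \<in> W \<Longrightarrow> \<Psi> (\<Phi> x) = x"
    "\<And>x. x \<in> W \<Longrightarrow> det (matrix (frechet_derivative \<Phi> (at x))) = h x"
proof -
  obtain e where e: "0 < e" "ball x0 e \<subseteq> U" using U open_contains_ball by blast
  define W where "W = ball x0 e"
  obtain k :: 'n where True by blast
  let ?a = "x0 $ k" and ?e = "axis k 1 :: real^'n"
  have oW: "open W" by (simp add: W_def)
  have hW: "Ck_on j W h" for j using Ck_on_subset[OF h] e by (simp add: W_def)
  have hW0: "h x \<noteq> 0" if "x \<in> W" for x using h0 e that by (auto simp: W_def)
  define G where "G = ray_integral k ?a 0 h"
  have G: "Ck_on j W G" for j unfolding G_def W_def using Ck_on_ray_integral[OF hW[unfolded W_def]] .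
  \<comment> \<open>By the substitution t = a + s (x_k - a) this is the integral of \<open>h\<close>
    along coordinate \<open>k\<close> from \<open>a\<close> to x_k.\<close>
  define I where "I x = (x $ k - ?a) * G x" for x
  have nthk: "Ck_on j W (\<lambda>x. x $ k)" for j by (rule Ck_on_bounded_linear[OF bounded_linear_vec_nth])
  have I: "Ck_on j W I" for j unfolding I_def
    by (intro Ck_on_mult Ck_on_diff Ck_on_const oW nthk G)
  define DI where "DI x = frechet_derivative I (at x)" for x
  have dI: "(I has_derivative DI x) (at x)" if "x \<in> W" for x
    unfolding DI_def by (rule Ck_on_SucD[OF I that])
  have DIC: "Ck_on j W (\<lambda>x. DI x v)" for j v
    using I[of "Suc j"] by (simp add: DI_def)
  have DIk: "DI x ?e = h x" if x: "x \<in> W" for x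
  proof -
    let ?p = "\<lambda>z. frechet_derivative h (at z) ?e"
    have h1: "Ck_on (Suc 0) (ball x0 e) h" using hW[of "Suc 0"] by (simp only: W_def)
    have dG: "(G has_derivative (\<lambda>v. \<Sum>i\<in>UNIV. v $ i * ray_integral k ?a (if i = k then Suc 0 else 0)
       (\<lambda>z. frechet_derivative h (at z) (axis i 1)) x)) (at x)"
      unfolding G_def using ray_integral_has_derivative[OF h1] x by (simp only: W_def)
    have "((\<lambda>x. x $ k - ?a) has_derivative (\<lambda>v. v $ k)) (at x)"
      by (auto intro!: derivative_eq_intros bounded_linear_imp_has_derivative)
    from has_derivative_unique[OF dI[OF x] has_derivative_mult[OF this dG, folded I_def]]
    have "DI x ?e = (x $ k - ?a) * (\<Sum>i\<in>UNIV. ?e $ i * ray_integral k ?a (if i = k then Suc 0 else 0)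
       (\<lambda>z. frechet_derivative h (at z) (axis i 1)) x) + G x"
      by simp
    also have "(\<Sum>i\<in>UNIV. ?e $ i * ray_integral k ?a (if i = k then Suc 0 else 0)
       (\<lambda>z. frechet_derivative h (at z) (axis i 1)) x)
       = (\<Sum>i\<in>UNIV. if i = k then ray_integral k ?a (Suc 0) ?p x else 0)"
      by (intro sum.cong) (auto simp: axis_def)
    finally have D: "DI x ?e = (x $ k - ?a) * ray_integral k ?a (Suc 0) ?p x + G x" by simp
    \<comment> \<open>The product rule has left G + (x_k - a) partial_k G. It is the integral over
      [0, 1] of the s-derivative of \<open>?q\<close>, and \<open>?q\<close> runs from 0 to
      h(x).\<close>
    let ?q = "\<lambda>s. s * h (shrink k ?a s x)"
    let ?q' = "\<lambda>s. h (shrink k ?a s x) + s * ((x $ k - ?a) * ?p (shrink k ?a s x))"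
    have hc: "continuous_on (ball x0 e) h" and pc: "continuous_on (ball x0 e) ?p"
      using h1 Ck_on_continuous[OF h1] by auto
    have "(?q has_vector_derivative ?q' s) (at s within {0..1})" if s: "s \<in> {0..1}" for s
    proof -
      have dh: "(h has_derivative frechet_derivative h (at (shrink k ?a s x))) (at (shrink k ?a s x))"
        using Ck_on_SucD[OF h1 shrink_in_ball[OF _ s]] x by (simp add: W_def)
      have "((\<lambda>s. shrink k ?a s x) has_derivative (\<lambda>t. (t * (x $ k - ?a)) *\<^sub>R ?e)) (at s within {0..1})"
        unfolding shrink_def by (auto intro!: derivative_eq_intros simp: algebra_simps)
      from has_derivative_compose[OF this dh]
      have "((\<lambda>s. h (shrink k ?a s x)) has_derivative (\<lambda>t. (t * (x $ k - ?a)) * ?p (shrink k ?a s x))) (at s within {0..1})"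
        by (simp add: linear_scale[OF has_derivative_linear[OF dh]])
      from has_derivative_mult[OF has_derivative_ident this]
      show ?thesis unfolding has_vector_derivative_def by (simp add: algebra_simps)
    qed
    from fundamental_theorem_of_calculus[OF _ this]
    have "(?q' has_integral h x) {0..1}" by (simp add: shrink_def)
    then have "h x = integral {0..1} ?q'" by (simp add: integral_unique)
    also have "\<dots> = integral {0..1} (\<lambda>s. h (shrink k ?a s x)) + integral {0..1} (\<lambda>s. (x $ k - ?a) * (s * ?p (shrink k ?a s x)))"
    proof (subst integral_add[symmetric])
      show "(\<lambda>s. h (shrink k ?a s x)) integrable_on {0..1}"
        using x by (intro integrable_continuous_real shrink_continuous_right[OF hc]) (simp add: W_def)
      show "(\<lambda>s. (x $ k - ?a) * (s * ?p (shrink k ?a s x))) integrable_on {0..1}"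
        using x by (intro integrable_continuous_real continuous_intros shrink_continuous_right[OF pc]) (simp add: W_def)
    qed (simp add: mult_ac)
    also have "\<dots> = G x + (x $ k - ?a) * ray_integral k ?a (Suc 0) ?p x"
      unfolding G_def ray_integral_def integral_mult_right by simp
    finally show ?thesis using D by simp
  qed
  define \<Phi> where "\<Phi> x = x + (I x - x $ k) *\<^sub>R ?e" for x
  have \<Phi>C: "Ck_on j W \<Phi>" for j unfolding \<Phi>_def
    by (intro Ck_on_add Ck_on_scaleR Ck_on_diff Ck_on_const oW nthk I Ck_on_bounded_linear bounded_linear_ident)
  define D\<Phi> where "D\<Phi> x v = v + (DI x v - v $ k) *\<^sub>R ?e" for x v
  have d\<Phi>: "(\<Phi> has_derivative D\<Phi> x) (at x)" if "x \<in> W" for x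
    unfolding \<Phi>_def[abs_def] D\<Phi>_def[abs_def]
    by (auto intro!: derivative_eq_intros dI[OF that] bounded_linear_imp_has_derivative)
  have \<Phi>k: "\<Phi> x $ k = I x" and \<Phi>i: "i \<noteq> k \<Longrightarrow> \<Phi> x $ i = x $ i" for x i
    by (auto simp: \<Phi>_def axis_def)
  \<comment> \<open>Points with equal images differ at most in coordinate \<open>k\<close>. On the
    segment between them, which stays in the ball, the mean value theorem gives (y_k - x_k) h = 0 at
    some point, and \<open>h\<close> has no zero.\<close>
  have inj: "inj_on \<Phi> W"
  proof (rule inj_onI)
    fix x y assume x: "x \<in> W" and y: "y \<in> W" and eq: "\<Phi> x = \<Phi> y"
    have yx: "y - x = (y $ k - x $ k) *\<^sub>R ?e"
    proof (rule vec_eq_iff[THEN iffD2], rule allI)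
      fix i
      show "(y - x) $ i = ((y $ k - x $ k) *\<^sub>R ?e) $ i"
        using \<Phi>i[of i x] \<Phi>i[of i y] eq by (cases "i = k") (auto simp: axis_def)
    qed
    have seg: "x + t *\<^sub>R (y - x) \<in> W" if "0 \<le> t" "t \<le> 1" for t
      using convexD_alt[OF convex_ball[of x0 e], of x y t] x y that by (simp add: W_def algebra_simps)
    have "((\<lambda>t. I (x + t *\<^sub>R (y - x))) has_derivative (\<lambda>s. DI (x + t *\<^sub>R (y - x)) (s *\<^sub>R (y - x)))) (at t within {0..1})"
      if "0 \<le> t" "t \<le> 1" for t
      by (rule has_derivative_compose[where f = "\<lambda>t. x + t *\<^sub>R (y - x)" and g = I, OF _ dI[OF seg[OF that]]])
        (auto intro!: derivative_eq_intros)
    from mvt_simple[of 0 1, OF _ this]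
    obtain t where t: "t \<in> {0<..<1}" "I y - I x = DI (x + t *\<^sub>R (y - x)) (y - x)" by auto
    have z: "x + t *\<^sub>R (y - x) \<in> W" using seg t(1) by auto
    have "I y = I x" using \<Phi>k eq by metis
    moreover have "DI (x + t *\<^sub>R (y - x)) (y - x) = (y $ k - x $ k) * h (x + t *\<^sub>R (y - x))"
      unfolding yx using linear_scale[OF has_derivative_linear[OF dI[OF z]]] DIk[OF z] yx by simp
    ultimately have "(y $ k - x $ k) * h (x + t *\<^sub>R (y - x)) = 0" using t(2) by simp
    then show "x = y" using hW0[OF z] yx by simp
  qed
  have cont: "continuous_on W \<Phi>" by (rule Ck_on_continuous[OF \<Phi>C])
  \<comment> \<open>Invariance of domain provides an open image and a continuous inverse on the
    whole ball; differentiability of the inverse is proved afterwards from the explicit inverse of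
    the derivative.\<close>
  obtain \<Psi> where \<Psi>: "homeomorphism W (\<Phi> ` W) \<Phi> \<Psi>"
    using invariance_of_domain_homeomorphism[OF oW cont order_refl inj] .
  have o\<Phi>: "open (\<Phi> ` W)" by (rule invariance_of_domain[OF cont oW inj])
  have \<Psi>c: "continuous_on (\<Phi> ` W) \<Psi>" using \<Psi> by (simp add: homeomorphism_def)
  have \<Psi>1: "\<Psi> (\<Phi> x) = x" if "x \<in> W" for x using homeomorphism_apply1[OF \<Psi> that] .
  have \<Psi>W: "\<Psi> y \<in> W" and \<Psi>2: "\<Phi> (\<Psi> y) = y" if "y \<in> \<Phi> ` W" for y using that \<Psi>1 by auto
  \<comment> \<open>Inverse of the derivative of \<Phi>: solve w = v + (DI v - v_k) e_k for v. Only
    coordinate \<open>k\<close> changes, and the direction e_k is stretched by h(x).\<close>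
  define M where "M x v = v + ((v $ k - DI x v) / h x) *\<^sub>R ?e" for x v
  have MC: "Ck_on j W (\<lambda>x. M x v)" for j v
    unfolding M_def divide_inverse
    by (intro Ck_on_add Ck_on_scaleR Ck_on_mult Ck_on_diff Ck_on_inverse Ck_on_const oW DIC hW hW0)
  have d\<Psi>: "(\<Psi> has_derivative M (\<Psi> y)) (at y)" if y: "y \<in> \<Phi> ` W" for y
  proof (rule has_derivative_inverse_basic[OF d\<Phi>[OF \<Psi>W[OF y]] _ _ _ o\<Phi> y \<Psi>2])
    let ?x = "\<Psi> y"
    note lin = has_derivative_bounded_linear[OF dI[OF \<Psi>W[OF y]]]
    show "bounded_linear (M ?x)"
      unfolding M_def divide_inverse
      by (intro bounded_linear_add bounded_linear_ident bounded_linear_compose[OF bounded_linear_scaleR_left]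
          bounded_linear_compose[OF bounded_linear_mult_left] bounded_linear_sub bounded_linear_vec_nth lin)
    show "M ?x \<circ> D\<Phi> ?x = id"
    proof
      fix v
      have D: "DI ?x (D\<Phi> ?x v) = DI ?x v + (DI ?x v - v $ k) * h ?x"
        unfolding D\<Phi>_def using linear_add[OF bounded_linear.linear[OF lin]] linear_scale[OF bounded_linear.linear[OF lin]]
          DIk[OF \<Psi>W[OF y]] by simp
      have "(D\<Phi> ?x v $ k - DI ?x (D\<Phi> ?x v)) / h ?x = v $ k - DI ?x v"
        unfolding D using hW0[OF \<Psi>W[OF y]] by (simp add: D\<Phi>_def field_simps)
      then have "M ?x (D\<Phi> ?x v) = D\<Phi> ?x v + (v $ k - DI ?x v) *\<^sub>R ?e" by (simp add: M_def)
      also have "\<dots> = v" by (simp add: D\<Phi>_def algebra_simps)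
      finally show "(M ?x \<circ> D\<Phi> ?x) v = id v" by simp
    qed
    show "continuous (at y) \<Psi>" using continuous_on_eq_continuous_at[OF o\<Phi>] \<Psi>c y by blast
  qed
  \<comment> \<open>Bootstrap: the derivative of \<Psi> at y is \<open>M (\<Psi> y)\<close>, with
    smooth \<open>M\<close>, so C^j regularity of \<Psi> implies C^(j+1).\<close>
  have \<Psi>C: "Ck_on j (\<Phi> ` W) \<Psi>" for j
  proof (induction j)
    case 0
    show ?case using \<Psi>c by simp
  next
    case (Suc j)
    show ?case
      by (rule Ck_on_SucI[OF o\<Phi> d\<Psi>]) (auto intro: Ck_on_compose[OF o\<Phi> oW \<Psi>W Suc MC])
  qed
  have det: "det (matrix (frechet_derivative \<Phi> (at x))) = h x" if x: "x \<in> W" for x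
  proof -
    \<comment> \<open>Row \<open>k\<close> of the Jacobian matrix is the gradient \<open>b\<close>
      of \<open>I\<close>, a combination of the rows of the identity; Cramer's lemma then leaves the
      entry b_k = h(x).\<close>
    define b where "b = (\<chi> j. DI x (axis j 1))"
    have "frechet_derivative \<Phi> (at x) = D\<Phi> x" using frechet_derivative_at[OF d\<Phi>[OF x]] by simp
    then have "matrix (frechet_derivative \<Phi> (at x)) =
       (\<chi> i. if i = k then \<Sum>i\<in>UNIV. b $ i *s row i (mat 1) else row i (mat 1))"
      unfolding vec_eq_iff
      by (auto simp: matrix_def D\<Phi>_def b_def row_def mat_def axis_def if_distrib[of "\<lambda>x. _ * x"] cong: if_cong)
    also have "det \<dots> = b $ k * det (mat 1 :: real^'n^'n)" by (rule cramer_lemma_transpose)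
    finally show ?thesis using DIk[OF x] by (simp add: b_def)
  qed
  show ?thesis
    using that[OF oW _ _ o\<Phi> \<Phi>C \<Psi>C \<Psi>1 det] e by (simp add: W_def)
qed

section \<open>Volume preserving charts and subordinate partitions of unity\<close>

context compact_manifold
begin

text \<open>The Jacobian determinant of \<Phi> is the density of the form in the chart
  \<open>c\<close>, so the transformation rule leaves density 1 after composing with \<Phi>, sign
  included. Since \<Phi> and its inverse are C^infinity, the new chart belongs to the C^r structure
  for every r.\<close>

lemma volume_chart_exists:
  assumes \<omega>: "smooth_volume_form r A \<omega>"
  obtains d where "d \<in> charts r A" "p \<in> dom_of d" "\<And>q. q \<in> dom_of d \<Longrightarrow> \<omega> d q = 1"
proof -
  obtain c where c: "c \<in> charts r A" "p \<in> dom_of c" "Cr_on \<infinity> (img_of c) (\<lambda>x. \<omega> c (point_of c x))"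
    using \<omega> unfolding smooth_volume_form_def by blast
  have nz: "\<omega> c q \<noteq> 0" if "q \<in> dom_of c" for q
    using \<omega> c(1) that unfolding smooth_volume_form_def by blast
  note ch = chartsD(1)[OF c(1)]
  define h where "h x = \<omega> c (point_of c x)" for x
  have hC: "Ck_on j (img_of c) h" for j using Cr_onD[OF c(3)] by (simp add: h_def[abs_def])
  have h0: "h x \<noteq> 0" if "x \<in> img_of c" for x using nz is_chartD(6)[OF ch that] by (simp add: h_def)
  obtain W \<Phi> \<Psi> where W: "open W" "coord c p \<in> W" "W \<subseteq> img_of c" "open (\<Phi> ` W)"
    and \<Phi>: "\<And>j. Ck_on j W \<Phi>" and \<Psi>: "\<And>j. Ck_on j (\<Phi> ` W) \<Psi>" and inv: "\<And>x. x \<in> W \<Longrightarrow> \<Psi> (\<Phi> x) = x"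
    and det: "\<And>x. x \<in> W \<Longrightarrow> det (matrix (frechet_derivative \<Phi> (at x))) = h x"
    using straighten_density[OF is_chartD(2)[OF ch] imageI[OF c(2)] hC h0] by blast
  define N where "N = {q \<in> dom_of c. coord c q \<in> W}"
  define d where "d = (N, \<lambda>q. \<Phi> (coord c q))"
  have dd: "dom_of d = N" "coord d q = \<Phi> (coord c q)" for q by (auto simp: d_def)
  have N: "open N" unfolding N_def by (rule is_chartD(9)[OF ch W(1)])
  have cN: "coord c ` N = W"
  proof
    show "W \<subseteq> coord c ` N"
    proof
      fix x assume x: "x \<in> W"
      then have "point_of c x \<in> N" using W(3) is_chartD(6,7)[OF ch, of x] by (auto simp: N_def)
      then show "x \<in> coord c ` N" using is_chartD(7)[OF ch, of x] W(3) x by (metis image_eqI subsetD)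
    qed
  qed (auto simp: N_def)
  have img: "img_of d = \<Phi> ` W" unfolding dd using cN by (metis image_image)
  have c\<Phi>: "continuous_on W \<Phi>" and c\<Psi>: "continuous_on (\<Phi> ` W) \<Psi>"
    using Ck_on_continuous \<Phi> \<Psi> by blast+
  have \<Psi>W: "\<Psi> y \<in> W" and \<Phi>\<Psi>: "\<Phi> (\<Psi> y) = y" if "y \<in> \<Phi> ` W" for y using that inv by auto
  have hom: "homeomorphism N (\<Phi> ` W) (coord d) (\<lambda>y. point_of c (\<Psi> y))"
    unfolding homeomorphism_def
  proof (intro conjI ballI)
    show "continuous_on N (coord d)" unfolding d_def snd_conv
      by (rule continuous_on_compose2[OF c\<Phi> continuous_on_subset[OF is_chartD(3)[OF ch]]]) (auto simp: N_def)
    show "continuous_on (\<Phi> ` W) (\<lambda>y. point_of c (\<Psi> y))"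
      by (rule continuous_on_compose2[OF is_chartD(4)[OF ch] c\<Psi>]) (use \<Psi>W W(3) in blast)
    show i: "point_of c (\<Psi> (coord d q)) = q" if "q \<in> N" for q
      using that inv is_chartD(5)[OF ch] by (auto simp: N_def dd)
    have "(\<lambda>y. point_of c (\<Psi> y)) ` coord d ` N = N"
      unfolding image_image by (simp add: i)
    then show "(\<lambda>y. point_of c (\<Psi> y)) ` \<Phi> ` W = N"
      by (simp only: img[unfolded dd(1)])
    show "coord d (point_of c (\<Psi> y)) = y" if "y \<in> \<Phi> ` W" for y
      using \<Phi>\<Psi>[OF that] is_chartD(7)[OF ch] \<Psi>W[OF that] W(3) by (simp add: dd subsetD)
    show "coord d ` N = \<Phi> ` W" using img dd by simp
  qed
  have dch: "is_chart d" unfolding is_chart_def using N W(4) hom img dd(1) by auto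
  have pd: "point_of d y = point_of c (\<Psi> y)" if "y \<in> \<Phi> ` W" for y
  proof -
    from that obtain q where q: "q \<in> N" "y = coord d q" using img dd(1) by auto
    then show ?thesis using is_chartD(5)[OF dch, of q] homeomorphism_apply1[OF hom q(1)] dd(1) by simp
  qed
  have "transition_Cr r d e \<and> transition_Cr r e d" if e: "e \<in> A" for e
  proof
    note ech = atlasD(1)[OF e]
    let ?N = "N \<inter> dom_of e"
    have oN: "open ?N" using N is_chartD(1)[OF ech] by blast
    have o1: "open (coord d ` ?N)" and o2: "open (coord e ` ?N)" and o3: "open (coord c ` ?N)"
      using is_chartD(8)[OF dch oN] is_chartD(8)[OF ech oN] is_chartD(8)[OF ch oN] by (auto simp: dd(1) N_def)
    have ce: "Cr_on r (coord c ` ?N) (\<lambda>x. coord e (point_of c x))"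
      by (rule Cr_on_subset[OF chartsD(2)[OF c(1) e, unfolded transition_Cr_def]]) (auto simp: N_def)
    have ec: "Cr_on r (coord e ` ?N) (\<lambda>x. coord c (point_of e x))"
      by (rule Cr_on_subset[OF chartsD(3)[OF c(1) e, unfolded transition_Cr_def]]) (auto simp: N_def)
    have dN: "coord d ` ?N \<subseteq> \<Phi> ` W" using img dd(1) by blast
    have "Cr_on r (coord d ` ?N) (\<lambda>y. coord e (point_of c (\<Psi> y)))"
    proof (rule Cr_on_compose[OF o1 o3 _ _ ce])
      show "Cr_on r (coord d ` ?N) \<Psi>" unfolding Cr_on_def using Ck_on_subset[OF \<Psi> dN] by blast
      show "\<Psi> y \<in> coord c ` ?N" if "y \<in> coord d ` ?N" for y
        using that inv by (auto simp: dd N_def)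
    qed
    then have "Cr_on r (coord d ` ?N) (\<lambda>y. coord e (point_of d y))"
      by (rule Cr_on_cong_imp[OF o1, rotated]) (simp only: pd[OF subsetD[OF dN]])
    then show "transition_Cr r d e"
      unfolding transition_Cr_def dd(1) .
    have "Cr_on r (coord e ` ?N) (\<lambda>x. \<Phi> (coord c (point_of e x)))"
    proof (rule Cr_on_compose[OF o2 W(1) _ ec])
      show "Cr_on r W \<Phi>" unfolding Cr_on_def using \<Phi> by blast
      show "coord c (point_of e x) \<in> W" if "x \<in> coord e ` ?N" for x
        using that is_chartD(5)[OF ech] by (auto simp: N_def)
    qed
    then show "transition_Cr r e d"
      unfolding transition_Cr_def dd by (simp add: Int_commute)
  qed
  then have dA: "d \<in> charts r A" using dch by (simp add: charts_def)
  moreover have "p \<in> dom_of d" using c(2) W(2) by (simp add: dd N_def)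
  moreover have "\<omega> d q = 1" if q: "q \<in> dom_of d" for q
  proof -
    have q': "q \<in> dom_of c" "coord c q \<in> W" using q by (auto simp: dd N_def)
    have "((\<lambda>x. coord d (point_of c x)) has_derivative frechet_derivative \<Phi> (at (coord c q))) (at (coord c q))"
    proof (rule has_derivative_transform_within_open[OF Ck_on_SucD[OF \<Phi> q'(2)] W(1) q'(2)])
      show "\<Phi> x = coord d (point_of c x)" if "x \<in> W" for x
        using that is_chartD(7)[OF ch] W(3) by (simp add: dd subsetD)
    qed
    then have "frechet_derivative (\<lambda>x. coord d (point_of c x)) (at (coord c q)) = frechet_derivative \<Phi> (at (coord c q))"
      by (rule frechet_derivative_at[symmetric])
    moreover have "\<omega> c q = det (matrix (frechet_derivative (\<lambda>x. coord d (point_of c x)) (at (coord c q)))) * \<omega> d q"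
      using \<omega> c(1) dA q q'(1) unfolding smooth_volume_form_def by blast
    ultimately have "\<omega> c q = \<omega> c q * \<omega> d q"
      using det[OF q'(2)] is_chartD(5)[OF ch q'(1)] by (simp add: h_def)
    then show ?thesis using nz[OF q'(1)] by simp
  qed
  ultimately show ?thesis using that by blast
qed

lemma bump_exists:
  fixes \<psi>0 :: "real^'n \<Rightarrow> real"
  assumes \<psi>0: "lp_cutoff \<psi>0" and d: "d \<in> charts r A" and p: "p \<in> dom_of d"
  obtains \<beta> where "supported_in d \<beta>" "\<And>q. 0 \<le> \<beta> q" "0 < \<beta> p"
proof -
  note ch = chartsD(1)[OF d]
  obtain e where e: "0 < e" "cball (coord d p) e \<subseteq> img_of d"
    using is_chartD(2)[OF ch] p open_contains_cball by blast
  \<comment> \<open>The factor 2 / e carries the radius 2, beyond which \<psi>0 vanishes, to the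
    radius e of a closed ball inside the chart image.\<close>
  define g where "g x = \<psi>0 ((2 / e) *\<^sub>R (x - coord d p))" for x
  define \<beta> where "\<beta> q = (if q \<in> dom_of d then g (coord d q) else 0)" for q
  define K where "K = point_of d ` cball (coord d p) e"
  have Kd: "K \<subseteq> dom_of d" unfolding K_def using is_chartD(6)[OF ch] e(2) by blast
  have "compact K" unfolding K_def
    by (rule compact_continuous_image[OF continuous_on_subset[OF is_chartD(4)[OF ch] e(2)] compact_cball])
  then have K: "closed K" by (rule compact_imp_closed)
  have \<beta>K: "\<beta> q = 0" if "q \<notin> K" for q
  proof (cases "q \<in> dom_of d")
    case True
    then have "coord d q \<notin> cball (coord d p) e"
      using that is_chartD(5)[OF ch True] unfolding K_def by (metis imageI)
    then have "2 < norm ((2 / e) *\<^sub>R (coord d q - coord d p))"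
      unfolding norm_scaleR using e(1) by (simp add: dist_norm norm_minus_commute field_simps)
    then show ?thesis using lp_cutoff_bounds(3)[OF \<psi>0] by (simp add: \<beta>_def g_def)
  qed (simp add: \<beta>_def)
  have "{q. \<beta> q \<noteq> 0} \<subseteq> K" using \<beta>K by auto
  then have cl: "support \<beta> \<subseteq> dom_of d" using closure_minimal[OF _ K] Kd by blast
  have "Ck_on j UNIV (\<lambda>x. (2 / e) *\<^sub>R (x - coord d p))" for j
    by (intro Ck_on_scaleR Ck_on_diff Ck_on_const open_UNIV Ck_on_bounded_linear bounded_linear_ident)
  then have "Ck_on j UNIV g" for j unfolding g_def
    by (rule Ck_on_compose[OF open_UNIV open_UNIV UNIV_I _ lp_cutoff_bounds(5)[OF \<psi>0]])
  then have "Cr_on r (img_of d) g" unfolding Cr_on_def using Ck_on_subset by blast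
  then have "Cr_on r (img_of d) (\<lambda>x. \<beta> (point_of d x))"
    by (rule Cr_on_cong_imp[OF is_chartD(2)[OF ch], rotated])
      (use is_chartD(6,7)[OF ch] in \<open>simp add: \<beta>_def\<close>)
  then have "\<beta> \<in> Cr_fun r A" using Cr_fun_ext0[OF d K Kd] \<beta>K by blast
  then have "supported_in d \<beta>" using cl d by (simp add: supported_in_def)
  moreover have "0 \<le> \<beta> q" for q using lp_cutoff_bounds(1)[OF \<psi>0] by (simp add: \<beta>_def g_def)
  moreover have "0 < \<beta> p" using lp_cutoff_bounds(4)[OF \<psi>0] p by (simp add: \<beta>_def g_def)
  ultimately show ?thesis using that by blast
qed

lemma volume_chart_system_exists:
  fixes \<psi>0 :: "real^'n \<Rightarrow> real"
  assumes \<psi>0: "lp_cutoff \<psi>0" and \<omega>: "smooth_volume_form r A \<omega>"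
  shows "\<exists>S. volume_chart_system r A \<omega> S"
proof -
  have "\<forall>p. \<exists>d \<beta>. supported_in d \<beta> \<and> (\<forall>q. 0 \<le> \<beta> q) \<and> 0 < \<beta> p \<and> (\<forall>q\<in>dom_of d. \<omega> d q = 1)"
  proof
    fix p
    obtain d where d: "d \<in> charts r A" "p \<in> dom_of d" "\<And>q. q \<in> dom_of d \<Longrightarrow> \<omega> d q = 1"
      using volume_chart_exists[OF \<omega>, of p] by blast
    obtain \<beta> where "supported_in d \<beta>" "\<And>q. 0 \<le> \<beta> q" "0 < \<beta> p" using bump_exists[OF \<psi>0 d(1,2)] by blast
    with d(3) show "\<exists>d \<beta>. supported_in d \<beta> \<and> (\<forall>q. 0 \<le> \<beta> q) \<and> 0 < \<beta> p \<and> (\<forall>q\<in>dom_of d. \<omega> d q = 1)" by blast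
  qed
  then obtain d \<beta> where s: "\<And>p. supported_in (d p) (\<beta> p)" and nn: "\<And>p q. 0 \<le> \<beta> p q"
    and pos: "\<And>p. 0 < \<beta> p p" and one: "\<And>p q. q \<in> dom_of (d p) \<Longrightarrow> \<omega> (d p) q = 1"
    by metis
  have C: "\<beta> p \<in> Cr_fun r A" for p using s by (simp add: supported_in_def)
  have op: "open {q. 0 < \<beta> p q}" for p
    using Cr_fun_continuous[OF C[of p]] by (intro open_Collect_less continuous_intros) 
  obtain P where P: "finite P" "UNIV \<subseteq> (\<Union>p\<in>P. {q. 0 < \<beta> p q})"
  proof (rule compactE_image[OF compact_UNIV, of UNIV "\<lambda>p. {q. 0 < \<beta> p q}"])
    show "UNIV \<subseteq> (\<Union>p. {q. 0 < \<beta> p q})" using pos by blast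
  qed (use op in auto)
  define s where "s q = (\<Sum>p\<in>P. \<beta> p q)" for q
  have s0: "0 < s q" for q
  proof -
    obtain p where p: "p \<in> P" "0 < \<beta> p q" using P(2) by blast
    have "\<beta> p q \<le> s q" unfolding s_def using P(1) p(1) nn by (intro member_le_sum) auto
    with p(2) show ?thesis by linarith
  qed
  have sC: "s \<in> Cr_fun r A" unfolding s_def by (intro Cr_fun_sum C)
  \<comment> \<open>Dividing by the positive sum makes the bumps add up to 1 without changing their
    supports.\<close>
  define \<eta> where "\<eta> p q = \<beta> p q * inverse (s q)" for p q
  have "s q \<noteq> 0" for q using s0[of q] by simp
  then have \<eta>C: "\<eta> p \<in> Cr_fun r A" for p
    unfolding \<eta>_def by (intro Cr_fun_bilinear[OF bounded_bilinear_mult] C Cr_fun_inverse sC)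
  have supp: "{q. \<eta> p q \<noteq> 0} = {q. \<beta> p q \<noteq> 0}" for p using s0 by (auto simp: \<eta>_def less_imp_neq[symmetric])
  obtain ps where ps: "set ps = P" "distinct ps" using finite_distinct_list[OF P(1)] by blast
  have "volume_chart_system r A \<omega> (map (\<lambda>p. (d p, \<eta> p)) ps)"
    unfolding volume_chart_system_def chart_system_def
  proof (intro conjI allI)
    show "\<forall>(c, \<eta>')\<in>set (map (\<lambda>p. (d p, \<eta> p)) ps). c \<in> charts r A \<and> \<eta>' \<in> Cr_fun r A \<and> (\<forall>p. 0 \<le> \<eta>' p) \<and> closure {p. \<eta>' p \<noteq> 0} \<subseteq> dom_of c"
      using s \<eta>C supp nn s0 by (auto simp: supported_in_def \<eta>_def less_imp_le)
    show "(\<Sum>(c, \<eta>')\<leftarrow>map (\<lambda>p. (d p, \<eta> p)) ps. \<eta>' q) = 1" for q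
    proof -
      have "(\<Sum>(c, \<eta>')\<leftarrow>map (\<lambda>p. (d p, \<eta> p)) ps. \<eta>' q) = (\<Sum>p\<in>P. \<eta> p q)"
        using ps sum_list_distinct_conv_sum_set[OF ps(2), of "\<lambda>p. \<eta> p q"] by (simp add: o_def)
      also have "\<dots> = s q * inverse (s q)" by (simp add: \<eta>_def s_def sum_distrib_right)
      finally show ?thesis using s0[of q] by simp
    qed
    show "\<forall>(c, \<eta>')\<in>set (map (\<lambda>p. (d p, \<eta> p)) ps). \<forall>p\<in>dom_of c. \<omega> c p = 1"
      using one by auto
  qed
  then show ?thesis by blast
qed

end

section \<open>Correlations with a rapidly mixing observable\<close>

text \<open>The cut is made at j = l N. Below it each term is at most \<open>b\<close>; above it the
  factor Q^l q^(l N) = (Q q^N)^l is at most 1, so the tail is dominated by the geometric series d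
  q^j, independently of l.\<close>

lemma suminf_min_geometric_bound:
  fixes a :: "nat \<Rightarrow> real"
  assumes a: "\<And>j. a j \<le> b" "\<And>j. a j \<le> d * Q ^ l * q ^ j" "\<And>j. 0 \<le> a j" and q: "0 < q" "q < 1"
    and N: "0 \<le> Q" "Q * q ^ N \<le> 1" and d: "0 \<le> d"
  shows "summable a" "suminf a \<le> real (l * N) * b + d / (1 - q)"
proof -
  have geo: "summable (\<lambda>j. d * Q ^ l * q ^ j)" using q by (intro summable_mult summable_geometric) simp
  show s: "summable a"
    by (rule summable_comparison_test[OF _ geo]) (use a(2,3) in auto)
  have sd: "summable (\<lambda>j. d * q ^ j)" using q by (intro summable_mult summable_geometric) simp
  have Ql: "Q ^ l * q ^ (l * N) \<le> 1"
    using power_le_one[of "Q * q ^ N" l] N q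
    by (simp add: power_mult_distrib power_mult[symmetric] mult.commute)
  have tail: "a (j + l * N) \<le> d * q ^ j" for j
  proof -
    have "a (j + l * N) \<le> (d * q ^ j) * (Q ^ l * q ^ (l * N))"
      using a(2)[of "j + l * N"] by (simp add: power_add mult_ac)
    also have "\<dots> \<le> (d * q ^ j) * 1" using Ql d q by (intro mult_left_mono) auto
    finally show ?thesis by simp
  qed
  have "suminf a = (\<Sum>j. a (j + l * N)) + (\<Sum>j<l * N. a j)" by (rule suminf_split_initial_segment[OF s])
  also have "(\<Sum>j. a (j + l * N)) \<le> (\<Sum>j. d * q ^ j)"
    by (rule suminf_le[OF tail summable_ignore_initial_segment[OF s] sd])
  also have "(\<Sum>j. d * q ^ j) = d / (1 - q)" using q by (simp add: suminf_mult suminf_geometric)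
  also have "(\<Sum>j<l * N. a j) \<le> real (l * N) * b"
    using sum_bounded_above[of "{..<l * N}" a b] a(1) by simp
  finally show "suminf a \<le> real (l * N) * b + d / (1 - q)" by linarith
qed

text \<open>The assumption \<open>volume_charts\<close> is discharged in \<open>theorem1\<close> by
  \<open>volume_chart_system_exists\<close>; fixing the essential bound \<open>B0\<close> keeps it
  uniform over all iterates.\<close>

locale mixing_system = compact_manifold A r
  for A :: "('m::{t2_space, second_countable_topology}, 'n::finite) chart set" and r :: enat +
  fixes \<omega> :: "('m, 'n) chart \<Rightarrow> 'm \<Rightarrow> real" and \<mu> :: "'m measure" and f :: "'m \<Rightarrow> 'm" and R :: "'m \<Rightarrow> real"
    and S :: "(('m, 'n) chart \<times> ('m \<Rightarrow> real)) list" and \<gamma> C1 C2 B0 :: real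
  assumes vol: "volume_measure r A \<omega> \<mu>" and bij: "bij f" and mf: "f \<in> measurable \<mu> \<mu>"
    and mfi: "inv f \<in> measurable \<mu> \<mu>" and inv: "distr \<mu> \<mu> f = \<mu>" and intR: "integrable \<mu> R"
    and bdR: "AE x in \<mu>. \<bar>R x\<bar> \<le> B0" and S: "chart_system r A S" and \<gamma>: "0 < \<gamma>" "ereal \<gamma> \<le> ereal_of_enat r"
    and C12: "0 < C1" "0 < C2"
    and decay: "\<And>\<phi> j. \<phi> \<in> Cr_fun r A \<Longrightarrow>
      \<bar>\<integral>x. R (int_iter f j x) * \<phi> x \<partial>\<mu>\<bar> \<le> C1 * exp (- C2 * \<bar>real_of_int j\<bar>) * holder_norm_on S \<gamma> \<phi>"
    and volume_charts: "\<exists>S. volume_chart_system r A \<omega> S"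
begin

section \<open>Invariance of the measure and the correlation functional\<close>

lemma sets_\<mu>: "sets \<mu> = sets borel"
  using vol by (simp add: volume_measure_def)

lemma space_\<mu>: "space \<mu> = UNIV"
  using sets_eq_imp_space_eq[OF sets_\<mu>] by simp

lemma inv_invariant: "distr \<mu> \<mu> (inv f) = \<mu>"
proof -
  have "distr \<mu> \<mu> (inv f) = distr (distr \<mu> \<mu> f) \<mu> (inv f)" by (simp add: inv)
  also have "\<dots> = distr \<mu> \<mu> (inv f \<circ> f)" by (rule distr_distr[OF mfi mf])
  also have "inv f \<circ> f = (\<lambda>x. x)" using bij_is_inj[OF bij] by (auto simp: o_def)
  finally show ?thesis by (simp add: distr_id)
qed

lemma funpow_invariant:
  assumes "g \<in> measurable \<mu> \<mu>" "distr \<mu> \<mu> g = \<mu>"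
  shows "g ^^ n \<in> measurable \<mu> \<mu> \<and> distr \<mu> \<mu> (g ^^ n) = \<mu>"
proof (induction n)
  case 0
  then show ?case by (simp add: distr_id id_def)
next
  case (Suc n)
  then have "distr \<mu> \<mu> (g \<circ> g ^^ n) = distr (distr \<mu> \<mu> (g ^^ n)) \<mu> g"
    by (intro distr_distr[symmetric] assms(1)) blast
  with Suc show ?case unfolding funpow.simps using assms measurable_comp[of "g ^^ n" \<mu> \<mu> g \<mu>] by (simp add: comp_def)
qed

lemma int_iter_measurable [measurable]: "int_iter f j \<in> measurable \<mu> \<mu>"
  and int_iter_invariant: "distr \<mu> \<mu> (int_iter f j) = \<mu>"
  using funpow_invariant[OF mf inv] funpow_invariant[OF mfi inv_invariant] by (simp_all add: int_iter_def)

lemma int_iter_step: "int_iter f (j + 1) x = int_iter f j (f x)"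
proof (cases "0 \<le> j")
  case True
  then have "nat (j + 1) = Suc (nat j)" by simp
  with True show ?thesis by (simp add: int_iter_def funpow_swap1)
next
  case False
  then obtain m where m: "nat (- j) = Suc m" "nat (- (j + 1)) = m"
    by (metis Suc_nat_eq_nat_zadd1 add.commute diff_add_cancel minus_add_distrib neg_0_le_iff_le not_le
        uminus_add_conv_diff zle_diff1_eq)
  have "inv f (f x) = x" using bij_is_inj[OF bij] by simp
  then have "int_iter f j (f x) = (inv f ^^ m) x"
    using False m(1) by (simp add: int_iter_def funpow_swap1)
  moreover have "int_iter f (j + 1) x = (inv f ^^ m) x"
  \<comment> \<open>At exponent 0 the definition of \<open>int_iter\<close> switches from iterates
    of \<open>inv f\<close> to iterates of \<open>f\<close>.\<close>
  proof (cases "j = -1")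
    case True
    then show ?thesis using m by (simp add: int_iter_def)
  next
    case False': False
    then show ?thesis using False m by (simp add: int_iter_def)
  qed
  ultimately show ?thesis by simp
qed

lemma iter_integrable: "integrable \<mu> (\<lambda>x. R (int_iter f j x))"
  using intR by (intro integrable_distr[OF int_iter_measurable]) (simp add: int_iter_invariant)

lemma iter_bounded: "AE x in \<mu>. \<bar>R (int_iter f j x)\<bar> \<le> B0"
  using AE_distrD[OF int_iter_measurable, of \<open>\<lambda>x. \<bar>R x\<bar> \<le> B0\<close>, unfolded int_iter_invariant, OF bdR] .

abbreviation corr :: "('m \<Rightarrow> complex) \<Rightarrow> int \<Rightarrow> complex" where
  "corr \<equiv> birkhoff_term \<mu> f R"

lemma measurable_\<mu>: "g \<in> borel_measurable borel \<Longrightarrow> g \<in> borel_measurable \<mu>"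
  using measurable_cong_sets[OF sets_\<mu> refl] by blast

lemma corr_integrable:
  fixes \<phi> :: "'m \<Rightarrow> complex"
  assumes "\<phi> \<in> borel_measurable \<mu>" "\<And>x. norm (\<phi> x) \<le> b"
  shows "integrable \<mu> (\<lambda>x. \<phi> x * of_real (R (int_iter f j x)))"
proof (rule Bochner_Integration.integrable_bound[OF integrable_mult_right[OF iter_integrable, of b j]])
  note [measurable] = borel_measurable_integrable[OF iter_integrable] assms(1)
  show "(\<lambda>x. \<phi> x * complex_of_real (R (int_iter f j x))) \<in> borel_measurable \<mu>" by measurable
  have "norm (\<phi> x) \<le> \<bar>b\<bar>" for x using assms(2)[of x] by linarith
  then show "AE x in \<mu>. norm (\<phi> x * complex_of_real (R (int_iter f j x))) \<le> norm (b * R (int_iter f j x))"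
    by (auto simp: norm_mult abs_mult intro!: mult_right_mono)
qed

lemma Cr_fun_bounded_measurable:
  fixes \<phi> :: "'m \<Rightarrow> complex"
  assumes "\<phi> \<in> Cr_fun r A"
  obtains b where "\<And>x. norm (\<phi> x) \<le> b" "\<phi> \<in> borel_measurable \<mu>"
proof -
  have "compact (range \<phi>)" using compact_continuous_image[OF Cr_fun_continuous[OF assms] compact_UNIV] .
  then obtain b where "\<And>x. norm (\<phi> x) \<le> b" using compact_imp_bounded bounded_iff by (metis rangeI)
  with that show ?thesis using measurable_\<mu>[OF borel_measurable_continuous_onI[OF Cr_fun_continuous[OF assms]]] by blast
qed

lemma corr_Cr_integrable:
  fixes \<phi> :: "'m \<Rightarrow> complex"
  assumes "\<phi> \<in> Cr_fun r A"
  shows "integrable \<mu> (\<lambda>x. \<phi> x * of_real (R (int_iter f j x)))"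
  using Cr_fun_bounded_measurable[OF assms] corr_integrable by metis

lemma corr_linear:
  assumes "\<phi> \<in> Cr_fun r A" "\<theta> \<in> Cr_fun r A"
  shows "corr (\<lambda>p. a * \<phi> p + b * \<theta> p) j = a * corr \<phi> j + b * corr \<theta> j"
proof -
  have "corr (\<lambda>p. a * \<phi> p + b * \<theta> p) j = (\<integral>x. a * (\<phi> x * of_real (R (int_iter f j x))) + b * (\<theta> x * of_real (R (int_iter f j x))) \<partial>\<mu>)"
    unfolding birkhoff_term_def by (intro Bochner_Integration.integral_cong) (auto simp: algebra_simps)
  also have "\<dots> = a * corr \<phi> j + b * corr \<theta> j"
    unfolding birkhoff_term_def using corr_Cr_integrable[OF assms(1)] corr_Cr_integrable[OF assms(2)] by simp
  finally show ?thesis .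
qed

text \<open>Invariance of \<mu> allows the substitution of f x for x. This handles \<phi> o f^(-1)
  although it need not be of class C^r, and it turns the cohomological equation into a telescoping
  sum.\<close>

lemma corr_shift:
  assumes "\<phi> \<in> Cr_fun r A"
  shows "corr (\<phi> \<circ> inv f) j = corr \<phi> (j + 1)"
proof -
  note [measurable] = measurable_\<mu>[OF borel_measurable_continuous_onI[OF Cr_fun_continuous[OF assms]]]
    mfi borel_measurable_integrable[OF iter_integrable]
  define g where "g x = (\<phi> \<circ> inv f) x * complex_of_real (R (int_iter f j x))" for x
  have g: "g \<in> borel_measurable \<mu>" unfolding g_def o_def by measurable
  have "corr (\<phi> \<circ> inv f) j = (\<integral>x. g x \<partial>distr \<mu> \<mu> f)" by (simp add: inv birkhoff_term_def g_def)
  also have "\<dots> = (\<integral>x. g (f x) \<partial>\<mu>)" by (rule integral_distr[OF mf g])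
  also have "\<dots> = corr \<phi> (j + 1)"
    using bij_is_inj[OF bij] by (simp add: g_def birkhoff_term_def int_iter_step)
  finally show ?thesis .
qed

section \<open>Decay of correlations in terms of C^K bounds\<close>

definition K :: nat where "K = nat \<lceil>\<gamma>\<rceil>"

text \<open>As r is an integer or infinite, \<gamma> \<le> r survives rounding up. Hence the decay
  hypothesis can be read as an estimate in derivatives that C^r test functions possess.\<close>

lemma K_le: "enat K \<le> r"
proof (cases r)
  case (enat m)
  with \<gamma> have "\<gamma> \<le> real m" by simp
  then have "K \<le> m" unfolding K_def by (simp add: ceiling_le_iff)
  with enat show ?thesis by simp
qed simp

lemma S_supported: "(c, \<eta>) \<in> set S \<Longrightarrow> supported_in c \<eta>"
  using S unfolding chart_system_def supported_in_def by blast

text \<open>A pointwise form of "the C^K norm is at most M". It passes through changes of charts and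
  through real and imaginary parts without any statement about suprema.\<close>

definition Ck_bounded :: "('m \<Rightarrow> complex) \<Rightarrow> real \<Rightarrow> bool" where
  "Ck_bounded \<phi> M \<longleftrightarrow> \<phi> \<in> Cr_fun r A \<and> (\<forall>(c, \<eta>)\<in>set S. \<forall>is x. length is \<le> K \<longrightarrow>
     norm (partials is (localize c \<eta> \<phi>) x) \<le> M)"

lemma Ck_bounded_Ck_norm:
  assumes \<phi>: "\<phi> \<in> Cr_fun r A"
  shows "Ck_bounded \<phi> (Ck_norm_on S K \<phi>)"
proof -
  have *: "norm (partials is (localize c \<eta> \<phi>) x) \<le> Ck_norm K (localize c \<eta> \<phi>)"
    if "(c, \<eta>) \<in> set S" "length is \<le> K" for c \<eta> "is" x
  proof -
    note s = S_supported[OF that(1)]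
    have cc: "c \<in> charts r A" and cl: "support \<eta> \<subseteq> dom_of c"
      using s by (auto simp: supported_in_def)
    obtain B where "\<And>is x. length is \<le> K \<Longrightarrow> norm (partials is (localize c \<eta> \<phi>) x) \<le> B"
      using partials_bounded[OF localize_Ck[OF s \<phi> K_le] localize_compact(1)[OF cc closed_closure cl]]
        localize_zero[OF s] by metis
    from Ck_norm_ge[OF this that(2)] show ?thesis by simp
  qed
  have nn: "0 \<le> Ck_norm K (localize c \<eta> \<phi>)" if "(c, \<eta>) \<in> set S" for c \<eta>
    using *[OF that, of "[]"] norm_ge_zero order_trans by (metis le0 list.size(3))
  have "Ck_norm K (localize c \<eta> \<phi>) \<le> Ck_norm_on S K \<phi>" if "(c, \<eta>) \<in> set S" for c \<eta>
    unfolding Ck_norm_on_def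
    by (rule member_le_sum_list) (use that nn in \<open>force+\<close>)
  then have "norm (partials is (localize c \<eta> \<phi>) x) \<le> Ck_norm_on S K \<phi>"
    if "(c, \<eta>) \<in> set S" "length is \<le> K" for c \<eta> "is" x
    using *[OF that] that(1) order_trans by blast
  with \<phi> show ?thesis unfolding Ck_bounded_def by blast
qed

text \<open>The hypothesis concerns real test functions, so it is applied to the real and imaginary
  parts; \<open>L\<close> stands for either of them, and the sum of the two gives the factor
  2.\<close>

lemma corr_decay:
  obtains D where "0 \<le> D" "\<And>\<phi> M j. Ck_bounded \<phi> M \<Longrightarrow> norm (corr \<phi> j) \<le> D * M * exp (- C2 * \<bar>real_of_int j\<bar>)"
proof -
  obtain H where H: "0 \<le> H" "\<And>(g :: real^'n \<Rightarrow> real) M. Ck_on K UNIV g \<Longrightarrow>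
    (\<And>is x. length is \<le> K \<Longrightarrow> norm (partials is g x) \<le> M) \<Longrightarrow> holder_norm \<gamma> g \<le> H * M"
    using holder_norm_le[OF \<gamma>(1)] unfolding K_def by metis
  define D where "D = C1 * (real (length S) * H)"
  have real: "\<bar>\<integral>x. R (int_iter f j x) * L (\<phi> x) \<partial>\<mu>\<bar> \<le> D * M * exp (- C2 * \<bar>real_of_int j\<bar>)"
    if \<phi>: "Ck_bounded \<phi> M" and L: "bounded_linear L" "\<And>z. \<bar>L z\<bar> \<le> norm z" for \<phi> M j and L :: "complex \<Rightarrow> real"
  proof -
    have C: "\<phi> \<in> Cr_fun r A" using \<phi> by (simp add: Ck_bounded_def)
    have "holder_norm \<gamma> (localize c \<eta> (\<lambda>p. L (\<phi> p))) \<le> H * M" if c: "(c, \<eta>) \<in> set S" for c \<eta>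
    proof (rule H(2)[OF localize_Ck[OF S_supported[OF c] Cr_fun_linear_comp[OF L(1) C] K_le]])
      fix "is" :: "'n list" and x assume l: "length is \<le> K"
      have "localize c \<eta> (\<lambda>p. L (\<phi> p)) = (\<lambda>x. L (localize c \<eta> \<phi> x))"
        using linear_scale[OF bounded_linear.linear[OF L(1)]] linear_0[OF bounded_linear.linear[OF L(1)]]
        by (auto simp: localize_def)
      then have "partials is (localize c \<eta> (\<lambda>p. L (\<phi> p))) x = L (partials is (localize c \<eta> \<phi>) x)"
        using partials_linear_comp[OF L(1) localize_Ck[OF S_supported[OF c] C K_le] l] by simp
      then have "norm (partials is (localize c \<eta> (\<lambda>p. L (\<phi> p))) x) \<le> norm (partials is (localize c \<eta> \<phi>) x)"
        using L(2) by simp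
      also have "\<dots> \<le> M" using \<phi> c l unfolding Ck_bounded_def by blast
      finally show "norm (partials is (localize c \<eta> (\<lambda>p. L (\<phi> p))) x) \<le> M" .
    qed
    then have "holder_norm_on S \<gamma> (\<lambda>p. L (\<phi> p)) \<le> (\<Sum>x\<leftarrow>S. H * M)"
      unfolding holder_norm_on_def by (intro sum_list_mono) auto
    also have "\<dots> = real (length S) * (H * M)" by (simp add: sum_list_triv)
    finally have "C1 * exp (- C2 * \<bar>real_of_int j\<bar>) * holder_norm_on S \<gamma> (\<lambda>p. L (\<phi> p))
       \<le> C1 * exp (- C2 * \<bar>real_of_int j\<bar>) * (real (length S) * (H * M))"
      using C12 by (intro mult_left_mono) auto
    with decay[OF Cr_fun_linear_comp[OF L(1) C], of j] show ?thesis by (simp add: D_def mult_ac)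
  qed
  show ?thesis
  proof
    show "0 \<le> 2 * D" using H C12 by (simp add: D_def)
    fix \<phi> M j assume \<phi>: "Ck_bounded \<phi> M"
    then have C: "\<phi> \<in> Cr_fun r A" by (simp add: Ck_bounded_def)
    note int = corr_Cr_integrable[OF C, of j]
    have "Re (corr \<phi> j) = (\<integral>x. R (int_iter f j x) * Re (\<phi> x) \<partial>\<mu>)"
      unfolding birkhoff_term_def integral_Re[OF int, symmetric] by (simp add: mult.commute)
    moreover have "Im (corr \<phi> j) = (\<integral>x. R (int_iter f j x) * Im (\<phi> x) \<partial>\<mu>)"
      unfolding birkhoff_term_def integral_Im[OF int, symmetric] by (simp add: mult.commute)
    ultimately have "norm (corr \<phi> j) \<le> D * M * exp (- C2 * \<bar>real_of_int j\<bar>) + D * M * exp (- C2 * \<bar>real_of_int j\<bar>)"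
      using cmod_le[of "corr \<phi> j"] real[OF \<phi> bounded_linear_Re abs_Re_le_cmod, of j]
        real[OF \<phi> bounded_linear_Im abs_Im_le_cmod, of j] by linarith
    then show "norm (corr \<phi> j) \<le> 2 * D * M * exp (- C2 * \<bar>real_of_int j\<bar>)" by simp
  qed
qed

text \<open>The constant depends on the chart and the cut-off but not on \<theta>, so it serves all
  Littlewood-Paley kernels and all their translates at once. Summing over the charts of
  \<open>S\<close> dominates each of them.\<close>

lemma pushforward_Ck_bounded:
  assumes c: "supported_in c \<eta>"
  obtains B where "0 \<le> B" "\<And>(\<theta> :: real^'n \<Rightarrow> complex) M. (\<And>k. Ck_on k UNIV \<theta>) \<Longrightarrow>
     (\<And>is y. length is \<le> K \<Longrightarrow> norm (partials is \<theta> y) \<le> M) \<Longrightarrow>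
     Ck_bounded (pushforward c \<eta> \<theta>) (B * M)"
proof -
  have "\<forall>s\<in>set S. \<exists>B\<ge>0. \<forall>(\<theta> :: real^'n \<Rightarrow> complex) M. Ck_on K UNIV \<theta> \<longrightarrow>
      partials_le K M \<theta> \<longrightarrow>
      partials_le K (B * M) (localize (fst s) (snd s) (pushforward c \<eta> \<theta>))"
  proof
    fix s assume "s \<in> set S"
    then have "supported_in (fst s) (snd s)" using S_supported by simp
    from localize_pushforward[OF c this K_le] show "\<exists>B\<ge>0. \<forall>(\<theta> :: real^'n \<Rightarrow> complex) M. Ck_on K UNIV \<theta> \<longrightarrow>
      partials_le K M \<theta> \<longrightarrow>
      partials_le K (B * M) (localize (fst s) (snd s) (pushforward c \<eta> \<theta>))" .
  qed
  from bchoice[OF this] obtain B where B: "\<forall>s\<in>set S. 0 \<le> B s \<and> (\<forall>(\<theta> :: real^'n \<Rightarrow> complex) M. Ck_on K UNIV \<theta> \<longrightarrow>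
      partials_le K M \<theta> \<longrightarrow>
      partials_le K (B s * M) (localize (fst s) (snd s) (pushforward c \<eta> \<theta>)))"
    by blast
  show ?thesis
  proof
    show "0 \<le> (\<Sum>s\<in>set S. B s)" using B by (intro sum_nonneg) blast
    fix \<theta> :: "real^'n \<Rightarrow> complex" and M assume \<theta>: "\<And>k. Ck_on k UNIV \<theta>" and M: "\<And>is y. length is \<le> K \<Longrightarrow> norm (partials is \<theta> y) \<le> M"
    have M0: "0 \<le> M" using M[of "[]" 0] norm_ge_zero order_trans by (metis le0 list.size(3))
    have "Cr_on r UNIV \<theta>" using \<theta> by (simp add: Cr_on_def)
    then have "pushforward c \<eta> \<theta> \<in> Cr_fun r A" by (rule Cr_fun_pushforward[OF c])
    moreover have "norm (partials is (localize d \<zeta> (pushforward c \<eta> \<theta>)) x) \<le> (\<Sum>s\<in>set S. B s) * M"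
      if s: "(d, \<zeta>) \<in> set S" and l: "length is \<le> K" for d \<zeta> "is" x
    proof -
      have "norm (partials is (localize d \<zeta> (pushforward c \<eta> \<theta>)) x) \<le> B (d, \<zeta>) * M"
        using B[rule_format, OF s] \<theta> M l unfolding fst_conv snd_conv by blast
      also have "\<dots> \<le> (\<Sum>s\<in>set S. B s) * M"
        using B s M0 by (intro mult_right_mono member_le_sum) auto
      finally show ?thesis .
    qed
    ultimately show "Ck_bounded (pushforward c \<eta> \<theta>) ((\<Sum>s\<in>set S. B s) * M)"
      unfolding Ck_bounded_def by blast
  qed
qed

section \<open>The measure in volume preserving charts\<close>

lemma emeasure_volume_chart:
  assumes c: "c \<in> charts r A" and one: "\<And>q. q \<in> dom_of c \<Longrightarrow> \<omega> c q = 1" and E: "E \<in> sets borel" "E \<subseteq> dom_of c"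
    and I: "coord c ` E \<in> sets borel"
  shows "emeasure \<mu> E = emeasure lborel (coord c ` E)"
proof -
  have "emeasure \<mu> E = (\<integral>\<^sup>+x. ennreal \<bar>\<omega> c (point_of c x)\<bar> * indicator (coord c ` E) x \<partial>lborel)"
    using vol c E unfolding volume_measure_def by blast
  also have "\<dots> = (\<integral>\<^sup>+x. indicator (coord c ` E) x \<partial>lborel)"
    using E(2) one is_chartD(5)[OF chartsD(1)[OF c]]
    by (intro nn_integral_cong) (auto simp: indicator_def subset_iff)
  finally show ?thesis using I by simp
qed

lemma volume_chart_system_cover:
  obtains c where "c \<in> charts r A" "p \<in> dom_of c" "\<And>q. q \<in> dom_of c \<Longrightarrow> \<omega> c q = 1"
proof -
  obtain S' where S': "volume_chart_system r A \<omega> S'" using volume_charts by blast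
  have "(\<Sum>(c, \<eta>)\<leftarrow>S'. \<eta> p) \<noteq> 0" using S' by (simp add: volume_chart_system_def chart_system_def)
  moreover have "(\<Sum>(c, \<eta>)\<leftarrow>S'. \<eta> p) = (\<Sum>x\<leftarrow>S'. 0)" if "\<forall>x\<in>set S'. (\<lambda>(c, \<eta>). \<eta> p) x = 0"
    using that by (intro arg_cong[of _ _ sum_list] map_cong) auto
  ultimately have "\<exists>x\<in>set S'. (\<lambda>(c, \<eta>). \<eta> p) x \<noteq> 0" by (auto simp: sum_list_triv)
  then obtain c \<eta> where c: "(c, \<eta>) \<in> set S'" "\<eta> p \<noteq> 0" by auto
  then have "c \<in> charts r A" "support \<eta> \<subseteq> dom_of c" "\<forall>p\<in>dom_of c. \<omega> c p = 1"
    using S' unfolding volume_chart_system_def chart_system_def by blast+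
  then show ?thesis using that mem_support[of \<eta> p, OF c(2)] by blast
qed

text \<open>\<open>volume_measure\<close> prescribes \<mu> inside chart domains only. Preimages of
  coordinate balls have finite measure and finitely many of them cover the compact space. Finiteness
  makes Fubini available on the product of \<mu> with Lebesgue measure.\<close>

lemma finite_\<mu>: "finite_measure \<mu>"
proof
  have "\<forall>p. \<exists>V. open V \<and> p \<in> V \<and> emeasure \<mu> V < \<infinity>"
  proof
    fix p
    obtain c where c: "c \<in> charts r A" "p \<in> dom_of c" "\<And>q. q \<in> dom_of c \<Longrightarrow> \<omega> c q = 1"
      using volume_chart_system_cover[of p] by blast
    note ch = chartsD(1)[OF c(1)]
    obtain e where e: "0 < e" "ball (coord c p) e \<subseteq> img_of c"
      using is_chartD(2)[OF ch] c(2) open_contains_ball by blast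
    let ?V = "{q \<in> dom_of c. coord c q \<in> ball (coord c p) e}"
    have V: "open ?V" by (rule is_chartD(9)[OF ch open_ball])
    have I: "coord c ` ?V = ball (coord c p) e" using e(2) by blast
    have I2: "coord c ` ?V \<in> sets borel" unfolding I by (rule borel_open[OF open_ball])
    have "emeasure \<mu> ?V = emeasure lborel (coord c ` ?V)"
      by (rule emeasure_volume_chart[OF c(1,3) borel_open[OF V] _ I2]) auto
    also have "\<dots> = emeasure lborel (ball (coord c p) e)" by (simp only: I)
    also have "\<dots> < \<infinity>" by (rule emeasure_bounded_finite[OF bounded_ball])
    finally show "\<exists>V. open V \<and> p \<in> V \<and> emeasure \<mu> V < \<infinity>"
      using V c(2) e(1) by (intro exI[of _ ?V]) auto
  qed
  then obtain V where V: "\<And>p. open (V p)" "\<And>p. p \<in> V p" "\<And>p. emeasure \<mu> (V p) < \<infinity>" by metis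
  obtain P where P: "finite P" "UNIV \<subseteq> (\<Union>p\<in>P. V p)"
    by (rule compactE_image[OF compact_UNIV, of UNIV V]) (use V in blast)+
  have "emeasure \<mu> (space \<mu>) \<le> emeasure \<mu> (\<Union>p\<in>P. V p)"
    using P(2) V(1) by (intro emeasure_mono) (auto simp: sets_\<mu> intro!: borel_open open_UN)
  also have "\<dots> \<le> (\<Sum>p\<in>P. emeasure \<mu> (V p))"
    using P(1) V(1) by (intro emeasure_subadditive_finite) (auto simp: sets_\<mu>)
  also have "\<dots> < \<infinity>" using V(3) P(1) by (simp add: less_top)
  finally show "emeasure \<mu> (space \<mu>) \<noteq> \<infinity>" by simp
qed

text \<open>The values of a coordinate map off its domain are arbitrary; this makes it measurable.\<close>

definition coord0 :: "('m, 'n) chart \<Rightarrow> 'm \<Rightarrow> real^'n" where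
  "coord0 c p = (if p \<in> dom_of c then coord c p else 0)"

lemma coord0_measurable:
  assumes "c \<in> charts r A"
  shows "coord0 c \<in> borel_measurable \<mu>"
  unfolding coord0_def[abs_def] using is_chartD(1,3)[OF chartsD(1)[OF assms]]
  by (intro measurable_\<mu> borel_measurable_continuous_on_if) (auto intro: borel_open)

text \<open>The coordinate map carries \<mu> on the chart domain to Lebesgue measure on the chart
  image; the inequality comes from integrating over the whole space instead of the image.\<close>

lemma nn_integral_volume_chart_le:
  assumes c: "c \<in> charts r A" and one: "\<And>q. q \<in> dom_of c \<Longrightarrow> \<omega> c q = 1"
    and g[measurable]: "g \<in> borel_measurable borel"
  shows "(\<integral>\<^sup>+p. g (coord0 c p) * indicator (dom_of c) p \<partial>\<mu>) \<le> (\<integral>\<^sup>+x. g x \<partial>lborel)"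
proof -
  note ch = chartsD(1)[OF c]
  note [measurable] = coord0_measurable[OF c]
  have dm [measurable]: "dom_of c \<in> sets \<mu>" using is_chartD(1)[OF ch] by (simp add: sets_\<mu> borel_open)
  have im: "img_of c \<in> sets borel" using is_chartD(2)[OF ch] by (rule borel_open)
  let ?D = "distr (density \<mu> (indicator (dom_of c))) borel (coord0 c)"
  have "?D = density lborel (indicator (img_of c))"
  proof (rule measure_eqI)
    fix E assume "E \<in> sets ?D"
    then have E [measurable]: "E \<in> sets borel" by simp
    let ?E = "dom_of c \<inter> (coord0 c -` E \<inter> space \<mu>)"
    have mE: "?E \<in> sets \<mu>" by measurable
    have I: "coord c ` ?E = E \<inter> img_of c" by (auto simp: coord0_def space_\<mu> image_iff)
    have "emeasure ?D E = emeasure (density \<mu> (indicator (dom_of c))) (coord0 c -` E \<inter> space \<mu>)"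
      by (subst emeasure_distr) auto
    also have "\<dots> = emeasure \<mu> ?E"
      by (subst emeasure_density) (auto simp: indicator_inter_arith[symmetric] nn_integral_indicator[OF mE])
    also have "\<dots> = emeasure lborel (coord c ` ?E)"
    proof (rule emeasure_volume_chart[OF c one])
      show "?E \<in> sets borel" using mE by (simp only: sets_\<mu>)
      show "coord c ` ?E \<in> sets borel" unfolding I using im E by (rule sets.Int[rotated])
    qed auto
    also have "\<dots> = emeasure (density lborel (indicator (img_of c))) E"
      unfolding I using im by (simp add: emeasure_density indicator_inter_arith[symmetric] Int_commute)
    finally show "emeasure ?D E = emeasure (density lborel (indicator (img_of c))) E" .
  qed simp
  then have "(\<integral>\<^sup>+x. g x \<partial>?D) = (\<integral>\<^sup>+x. indicator (img_of c) x * g x \<partial>lborel)"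
    using im by (simp add: nn_integral_density)
  also have "\<dots> \<le> (\<integral>\<^sup>+x. g x \<partial>lborel)" by (intro nn_integral_mono) (auto simp: indicator_def)
  finally have "(\<integral>\<^sup>+x. g x \<partial>?D) \<le> (\<integral>\<^sup>+x. g x \<partial>lborel)" .
  moreover have "(\<integral>\<^sup>+x. g x \<partial>?D) = (\<integral>\<^sup>+p. g (coord0 c p) * indicator (dom_of c) p \<partial>\<mu>)"
    by (simp add: nn_integral_distr nn_integral_density mult.commute)
  ultimately show ?thesis by simp
qed

lemma pushforward_coord0:
  "supported_in c \<eta> \<Longrightarrow> complex_of_real (\<eta> p) * \<theta> (coord c p) = complex_of_real (\<eta> p) * \<theta> (coord0 c p)"
  using supported_zero[of c \<eta> p] by (auto simp: coord0_def)

text \<open>The bound that does not improve with j: invariance gives |R o f^j| \<le> B0 almost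
  everywhere for every j, and the rest is an L1 norm in volume preserving coordinates.\<close>

lemma corr_L1_bound:
  assumes c: "supported_in c \<eta>" and one: "\<And>q. q \<in> dom_of c \<Longrightarrow> \<omega> c q = 1" and \<eta>: "\<And>p. \<bar>\<eta> p\<bar> \<le> 1"
    and \<theta>: "\<And>k. Ck_on k UNIV \<theta>" and L1: "(\<integral>\<^sup>+x. ennreal (norm (\<theta> x)) \<partial>lborel) \<le> ennreal C" "0 \<le> C"
  shows "norm (corr (pushforward c \<eta> \<theta>) j) \<le> \<bar>B0\<bar> * C"
proof -
  have cc: "c \<in> charts r A" using c by (simp add: supported_in_def)
  have "Cr_on r UNIV \<theta>" using \<theta> by (simp add: Cr_on_def)
  note C = Cr_fun_pushforward[OF c this]
  have [measurable]: "\<theta> \<in> borel_measurable borel"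
    using \<theta>[of 0] by (intro borel_measurable_continuous_onI) simp
  note [measurable] = coord0_measurable[OF cc]
  have dm [measurable]: "dom_of c \<in> sets \<mu>"
    using is_chartD(1)[OF chartsD(1)[OF cc]] by (simp add: sets_\<mu> borel_open)
  let ?g = "\<lambda>x. complex_of_real (\<eta> x) * \<theta> (coord c x) * of_real (R (int_iter f j x))"
  have "ennreal (norm (corr (pushforward c \<eta> \<theta>) j)) \<le> (\<integral>\<^sup>+x. ennreal (norm (?g x)) \<partial>\<mu>)"
    unfolding birkhoff_term_def by (rule integral_norm_bound_ennreal[OF corr_Cr_integrable[OF C]])
  also have "\<dots> \<le> (\<integral>\<^sup>+x. ennreal \<bar>B0\<bar> * (ennreal (norm (\<theta> (coord0 c x))) * indicator (dom_of c) x) \<partial>\<mu>)"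
  proof (rule nn_integral_mono_AE)
    show "AE x in \<mu>. ennreal (norm (?g x)) \<le> ennreal \<bar>B0\<bar> * (ennreal (norm (\<theta> (coord0 c x))) * indicator (dom_of c) x)"
      using iter_bounded[of j]
    proof (rule AE_mp, intro AE_I2 impI)
      fix x assume b: "\<bar>R (int_iter f j x)\<bar> \<le> B0"
      show "ennreal (norm (?g x)) \<le> ennreal \<bar>B0\<bar> * (ennreal (norm (\<theta> (coord0 c x))) * indicator (dom_of c) x)"
      proof (cases "x \<in> dom_of c")
        case True
        have "norm (?g x) = \<bar>\<eta> x\<bar> * norm (\<theta> (coord0 c x)) * \<bar>R (int_iter f j x)\<bar>"
          using True by (simp add: norm_mult coord0_def)
        also have "\<dots> \<le> 1 * norm (\<theta> (coord0 c x)) * \<bar>B0\<bar>"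
          using b \<eta>[of x] by (intro mult_mono) auto
        finally show ?thesis using True by (simp add: ennreal_mult[symmetric] mult.commute)
      next
        case False
        then show ?thesis using supported_zero[OF c False] by simp
      qed
    qed
  qed
  also have "\<dots> = ennreal \<bar>B0\<bar> * (\<integral>\<^sup>+x. ennreal (norm (\<theta> (coord0 c x))) * indicator (dom_of c) x \<partial>\<mu>)"
    by (rule nn_integral_cmult) measurable
  also have "\<dots> \<le> ennreal \<bar>B0\<bar> * ennreal C"
    using nn_integral_volume_chart_le[OF cc one, of "\<lambda>x. ennreal (norm (\<theta> x))"] L1
    by (intro mult_left_mono) (auto intro: order_trans)
  finally show ?thesis using L1(2) by (simp add: ennreal_mult[symmetric])
qed

section \<open>Birkhoff sums as distributions\<close>

definition index_ok :: "(nat \<Rightarrow> int) \<Rightarrow> bool" where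
  "index_ok \<sigma> \<longleftrightarrow> (\<forall>k. real k \<le> \<bar>real_of_int (\<sigma> k)\<bar>)"

text \<open>Linear growth of |\<sigma> k| turns exponential decay in |j| into a geometric series in
  k. The condition on \<sigma> is general enough for both Birkhoff sums and for the enumerations
  shifted by one.\<close>

lemma exp_le_power:
  assumes "index_ok \<sigma>"
  shows "exp (- C2 * \<bar>real_of_int (\<sigma> k)\<bar>) \<le> exp (- C2) ^ k"
proof -
  have "exp (- C2 * \<bar>real_of_int (\<sigma> k)\<bar>) \<le> exp (- C2 * real k)"
    using assms C12 by (auto simp: index_ok_def intro!: mult_left_mono)
  also have "\<dots> = exp (- C2) ^ k" by (simp add: exp_of_nat_mult[symmetric] mult.commute)
  finally show ?thesis .
qed

lemma corr_summable:
  obtains D where "0 \<le> D" "\<And>\<phi> M \<sigma> k. Ck_bounded \<phi> M \<Longrightarrow> index_ok \<sigma> \<Longrightarrow> 0 \<le> M \<Longrightarrow> norm (corr \<phi> (\<sigma> k)) \<le> D * M * exp (- C2) ^ k"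
    "\<And>\<phi> M \<sigma>. Ck_bounded \<phi> M \<Longrightarrow> index_ok \<sigma> \<Longrightarrow> 0 \<le> M \<Longrightarrow> summable (\<lambda>k. corr \<phi> (\<sigma> k))"
    "\<And>\<phi> M \<sigma>. Ck_bounded \<phi> M \<Longrightarrow> index_ok \<sigma> \<Longrightarrow> 0 \<le> M \<Longrightarrow> norm (\<Sum>k. corr \<phi> (\<sigma> k)) \<le> D / (1 - exp (- C2)) * M"
proof -
  obtain D where D: "0 \<le> D" "\<And>\<phi> M j. Ck_bounded \<phi> M \<Longrightarrow> norm (corr \<phi> j) \<le> D * M * exp (- C2 * \<bar>real_of_int j\<bar>)"
    using corr_decay by blast
  have q: "0 < exp (- C2)" "exp (- C2) < 1" using C12 by auto
  have b: "norm (corr \<phi> (\<sigma> k)) \<le> D * M * exp (- C2) ^ k" if "Ck_bounded \<phi> M" "index_ok \<sigma>" "0 \<le> M" for \<phi> M \<sigma> k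
    using D(2)[OF that(1), of "\<sigma> k"] mult_left_mono[OF exp_le_power[OF that(2), of k], of "D * M"] D(1) that(3)
    by simp
  have geo: "summable (\<lambda>k. c * exp (- C2) ^ k)" for c :: real using q by (intro summable_mult summable_geometric) simp
  show ?thesis
  proof
    show "0 \<le> D" by (rule D(1))
    fix \<phi> M and \<sigma> :: "nat \<Rightarrow> int" assume a: "Ck_bounded \<phi> M" "index_ok \<sigma>" "0 \<le> M"
    show "norm (corr \<phi> (\<sigma> k)) \<le> D * M * exp (- C2) ^ k" for k by (rule b[OF a])
    show "summable (\<lambda>k. corr \<phi> (\<sigma> k))"
      by (rule summable_comparison_test[OF _ geo]) (use b[OF a] in blast)
    have "norm (\<Sum>k. corr \<phi> (\<sigma> k)) \<le> (\<Sum>k. D * M * exp (- C2) ^ k)"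
      by (rule norm_suminf_le[OF b[OF a] geo])
    also have "\<dots> = D / (1 - exp (- C2)) * M"
      using q by (subst suminf_mult) (auto simp: suminf_geometric intro: summable_geometric)
    finally show "norm (\<Sum>k. corr \<phi> (\<sigma> k)) \<le> D / (1 - exp (- C2)) * M" .
  qed
qed

text \<open>Both Birkhoff sums have the form \<open>s \<Sum>\<^sub>k \<langle>\<phi>, R \<circ> f\<^bsup>\<sigma> k\<^esup>\<rangle>\<close> with a sign \<open>s\<close> and an enumeration \<open>\<sigma>\<close>
  of half of the integers.\<close>

definition birkhoff_sum :: "complex \<Rightarrow> (nat \<Rightarrow> int) \<Rightarrow> ('m \<Rightarrow> complex) \<Rightarrow> complex" where
  "birkhoff_sum s \<sigma> \<phi> = s * (\<Sum>k. corr \<phi> (\<sigma> k))"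

lemma u_omega_eq: "u_omega \<mu> f R = birkhoff_sum 1 (\<lambda>k. - 1 - int k)"
  and u_alpha_eq: "u_alpha \<mu> f R = birkhoff_sum (- 1) int"
  by (auto simp: u_omega_def u_alpha_def birkhoff_sum_def)

lemma index_ok_omega: "index_ok (\<lambda>k. - 1 - int k)" and index_ok_alpha: "index_ok int"
  by (auto simp: index_ok_def)

lemma Ck_norm_on_nonneg:
  fixes \<phi> :: "'m \<Rightarrow> complex"
  assumes "\<phi> \<in> Cr_fun r A"
  shows "0 \<le> Ck_norm_on S K \<phi>"
proof (cases "set S = {}")
  case True
  then show ?thesis by (simp add: Ck_norm_on_def)
next
  case False
  then obtain c \<eta> where "(c, \<eta>) \<in> set S" by (metis list.set_intros(1) neq_Nil_conv set_empty surj_pair)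
  then have "norm (partials [] (localize c \<eta> \<phi>) 0) \<le> Ck_norm_on S K \<phi>"
    using Ck_bounded_Ck_norm[OF assms] unfolding Ck_bounded_def by (metis (no_types, lifting) case_prodD le0 list.size(3))
  then show ?thesis using norm_ge_zero order_trans by blast
qed

lemma corr_summable_Cr:
  assumes "\<phi> \<in> Cr_fun r A" "index_ok \<sigma>"
  shows "summable (\<lambda>k. corr \<phi> (\<sigma> k))"
  using corr_summable Ck_bounded_Ck_norm[OF assms(1)] Ck_norm_on_nonneg[OF assms(1)] assms(2) by metis

lemma birkhoff_sum_linear:
  assumes "\<phi> \<in> Cr_fun r A" "\<theta> \<in> Cr_fun r A" "index_ok \<sigma>"
  shows "birkhoff_sum s \<sigma> (\<lambda>p. a * \<phi> p + b * \<theta> p) = a * birkhoff_sum s \<sigma> \<phi> + b * birkhoff_sum s \<sigma> \<theta>"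
  using corr_summable_Cr[OF assms(1,3)] corr_summable_Cr[OF assms(2,3)]
  by (simp add: birkhoff_sum_def corr_linear[OF assms(1,2)] suminf_add[symmetric] suminf_mult summable_mult algebra_simps)

lemma birkhoff_sum_distribution:
  assumes "index_ok \<sigma>"
  shows "distribution_on r A (birkhoff_sum s \<sigma>)"
  unfolding distribution_on_def
proof (intro conjI ballI allI)
  fix \<phi> \<theta> :: "'m \<Rightarrow> complex" and a b assume "\<phi> \<in> Cr_fun r A" "\<theta> \<in> Cr_fun r A"
  then show "birkhoff_sum s \<sigma> (\<lambda>p. a * \<phi> p + b * \<theta> p) = a * birkhoff_sum s \<sigma> \<phi> + b * birkhoff_sum s \<sigma> \<theta>"
    using birkhoff_sum_linear assms by blast
next
  obtain D where D: "\<And>\<phi> M. Ck_bounded \<phi> M \<Longrightarrow> 0 \<le> M \<Longrightarrow> norm (\<Sum>k. corr \<phi> (\<sigma> k)) \<le> D / (1 - exp (- C2)) * M"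
    using corr_summable assms by metis
  have "norm (birkhoff_sum s \<sigma> \<phi>) \<le> (norm s * (D / (1 - exp (- C2)))) * Ck_norm_on S K \<phi>" if "\<phi> \<in> Cr_fun r A" for \<phi>
    using mult_left_mono[OF D[OF Ck_bounded_Ck_norm[OF that] Ck_norm_on_nonneg[OF that]], of "norm s"]
    by (simp add: birkhoff_sum_def norm_mult mult.assoc)
  then show "\<exists>S k C. chart_system r A S \<and> enat k \<le> r \<and> (\<forall>\<phi>\<in>Cr_fun r A. norm (birkhoff_sum s \<sigma> \<phi>) \<le> C * Ck_norm_on S k \<phi>)"
    using S K_le by blast
qed

lemma coord_dist_tempered:
  assumes c: "supported_in c \<eta>" and \<sigma>: "index_ok \<sigma>"
  shows "tempered (coord_dist c \<eta> (birkhoff_sum s \<sigma>))"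
  unfolding tempered_def
proof (intro conjI ballI allI)
  have C: "pushforward c \<eta> \<phi> \<in> Cr_fun r A" if "\<phi> \<in> schwartz" for \<phi>
    using schwartz_Ck[OF that] by (intro Cr_fun_pushforward[OF c]) (simp add: Cr_on_def)
  fix \<phi> \<theta> :: "real^'n \<Rightarrow> complex" and a b assume "\<phi> \<in> schwartz" "\<theta> \<in> schwartz"
  from birkhoff_sum_linear[OF C[OF this(1)] C[OF this(2)] \<sigma>, of s a b]
  show "coord_dist c \<eta> (birkhoff_sum s \<sigma>) (\<lambda>x. a * \<phi> x + b * \<theta> x) =
     a * coord_dist c \<eta> (birkhoff_sum s \<sigma>) \<phi> + b * coord_dist c \<eta> (birkhoff_sum s \<sigma>) \<theta>"
    by (simp add: coord_dist_def algebra_simps)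
next
  obtain D where D: "\<And>\<phi> M. Ck_bounded \<phi> M \<Longrightarrow> 0 \<le> M \<Longrightarrow> norm (\<Sum>k. corr \<phi> (\<sigma> k)) \<le> D / (1 - exp (- C2)) * M"
    using corr_summable \<sigma> by metis
  obtain B where B: "0 \<le> B" "\<And>(\<theta> :: real^'n \<Rightarrow> complex) M. (\<And>k. Ck_on k UNIV \<theta>) \<Longrightarrow>
     (\<And>is y. length is \<le> K \<Longrightarrow> norm (partials is \<theta> y) \<le> M) \<Longrightarrow>
     Ck_bounded (pushforward c \<eta> \<theta>) (B * M)"
    using pushforward_Ck_bounded[OF c] by blast
  have "norm (coord_dist c \<eta> (birkhoff_sum s \<sigma>) \<phi>) \<le> (norm s * (D / (1 - exp (- C2)) * B)) * schwartz_norm K \<phi>"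
    if \<phi>: "\<phi> \<in> schwartz" for \<phi>
  proof -
    have b: "Ck_bounded (pushforward c \<eta> \<phi>) (B * schwartz_norm K \<phi>)"
      using B(2)[OF schwartz_Ck[OF \<phi>] schwartz_norm_ge[OF \<phi>]] .
    have "0 \<le> schwartz_norm K \<phi>"
      using order_trans[OF norm_ge_zero schwartz_norm_ge[OF \<phi>, of "[]" K 0]] by simp
    then have "0 \<le> B * schwartz_norm K \<phi>" using B(1) by simp
    from mult_left_mono[OF D[OF b this], of "norm s"] show ?thesis
      by (simp add: coord_dist_def birkhoff_sum_def norm_mult mult.assoc)
  qed
  then show "\<exists>N C. \<forall>\<phi>\<in>schwartz. norm (coord_dist c \<eta> (birkhoff_sum s \<sigma>) \<phi>) \<le> C * schwartz_norm N \<phi>" by blast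
qed

section \<open>Littlewood-Paley pieces of the Birkhoff sums\<close>

lemma corr_convolution:
  fixes k :: "real^'n \<Rightarrow> complex"
  assumes c: "supported_in c \<eta>" and k: "continuous_on UNIV k" "\<And>z. norm (k z) \<le> b" and \<phi>: "integrable lborel \<phi>"
    and \<eta>: "\<And>p. \<bar>\<eta> p\<bar> \<le> 1"
  shows "corr (\<lambda>p. complex_of_real (\<eta> p) * (\<integral>y. k (coord c p - y) * \<phi> y \<partial>lborel)) j
     = (\<integral>y. corr (pushforward c \<eta> (\<lambda>x. k (x - y))) j * \<phi> y \<partial>lborel)"
proof -
  have cc: "c \<in> charts r A" and \<eta>C: "\<eta> \<in> Cr_fun r A" using c by (auto simp: supported_in_def)
  interpret finite_measure \<mu> by (rule finite_\<mu>)
  interpret pair_sigma_finite \<mu> "lborel :: (real^'n) measure" ..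
  define F where "F p y = complex_of_real (\<eta> p) * k (coord0 c p - y) * complex_of_real (R (int_iter f j p)) * \<phi> y" for p y
  have [measurable]: "k \<in> borel_measurable borel" by (rule borel_measurable_continuous_onI[OF k(1)])
  note [measurable] = coord0_measurable[OF cc] borel_measurable_integrable[OF iter_integrable]
    borel_measurable_integrable[OF \<phi>] measurable_\<mu>[OF borel_measurable_continuous_onI[OF Cr_fun_continuous[OF \<eta>C]]]
  have "integrable (\<mu> \<Otimes>\<^sub>M lborel) (\<lambda>(p, y). complex_of_real b * complex_of_real (R (int_iter f j p)) * \<phi> y)"
    by (rule integrable_pair_mult[OF _ _ integrable_mult_right[OF integrable_of_real[OF iter_integrable]] \<phi>]) unfold_locales
  then have "integrable (\<mu> \<Otimes>\<^sub>M lborel) (\<lambda>(p, y). F p y)"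
  proof (rule Bochner_Integration.integrable_bound)
    show "(\<lambda>(p, y). F p y) \<in> borel_measurable (\<mu> \<Otimes>\<^sub>M lborel)"
      unfolding F_def case_prod_beta by measurable
    have "norm (F p y) \<le> norm (complex_of_real b * complex_of_real (R (int_iter f j p)) * \<phi> y)" for p y
    proof -
      have "norm (k (coord0 c p - y)) \<le> \<bar>b\<bar>" using k(2)[of "coord0 c p - y"] by linarith
      then have "\<bar>\<eta> p\<bar> * norm (k (coord0 c p - y)) * (\<bar>R (int_iter f j p)\<bar> * norm (\<phi> y)) \<le> 1 * \<bar>b\<bar> * (\<bar>R (int_iter f j p)\<bar> * norm (\<phi> y))"
        using \<eta>[of p] by (intro mult_mono) auto
      then show ?thesis by (simp add: F_def norm_mult mult.assoc)
    qed
    then show "AE x in \<mu> \<Otimes>\<^sub>M lborel. norm (case x of (p, y) \<Rightarrow> F p y)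
        \<le> norm (case x of (p, y) \<Rightarrow> complex_of_real b * complex_of_real (R (int_iter f j p)) * \<phi> y)"
      by (auto intro!: AE_I2)
  qed
  \<comment> \<open>Exchanging the two integrals moves the convolution out of the correlation: what
    remains is \<phi> integrated against the correlations with translates of the kernel.\<close>
  then have "(\<integral>y. (\<integral>p. F p y \<partial>\<mu>) \<partial>lborel) = (\<integral>p. (\<integral>y. F p y \<partial>lborel) \<partial>\<mu>)"
    by (rule Fubini_integral)
  moreover have "(\<integral>p. F p y \<partial>\<mu>) = corr (pushforward c \<eta> (\<lambda>x. k (x - y))) j * \<phi> y" for y
    unfolding birkhoff_term_def F_def pushforward_coord0[OF c, of _ "\<lambda>x. k (x - y)"] by (rule integral_mult_left_zero)
  moreover have "(\<integral>y. F p y \<partial>lborel) = complex_of_real (\<eta> p) * (\<integral>y. k (coord c p - y) * \<phi> y \<partial>lborel) * complex_of_real (R (int_iter f j p))" for p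
  proof -
    have "(\<integral>y. F p y \<partial>lborel) = (\<integral>y. (complex_of_real (\<eta> p) * complex_of_real (R (int_iter f j p))) * (k (coord0 c p - y) * \<phi> y) \<partial>lborel)"
      by (intro Bochner_Integration.integral_cong) (auto simp: F_def mult_ac)
    also have "\<dots> = complex_of_real (\<eta> p) * (\<integral>y. k (coord0 c p - y) * \<phi> y \<partial>lborel) * complex_of_real (R (int_iter f j p))"
      unfolding integral_mult_right_zero by (simp only: mult_ac)
    finally show ?thesis
      by (simp only: pushforward_coord0[OF c, of _ "\<lambda>x. \<integral>y. k (x - y) * \<phi> y \<partial>lborel"])
  qed
  ultimately show ?thesis by (simp add: birkhoff_term_def)
qed

text \<open>Dominated convergence with the integrable bound |b| |R o f^j|. It is needed because
  \<open>represented_by\<close> demands a continuous representative.\<close>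

lemma corr_translate_continuous:
  fixes k :: "real^'n \<Rightarrow> complex"
  assumes c: "supported_in c \<eta>" and k: "continuous_on UNIV k" "\<And>z. norm (k z) \<le> b" and \<eta>: "\<And>p. \<bar>\<eta> p\<bar> \<le> 1"
  shows "continuous_on UNIV (\<lambda>y. corr (pushforward c \<eta> (\<lambda>x. k (x - y))) j)"
proof (rule continuous_on_sequentiallyI)
  fix u and y :: "real^'n" assume u: "u \<longlonglongrightarrow> y"
  have cc: "c \<in> charts r A" and \<eta>C: "\<eta> \<in> Cr_fun r A" using c by (auto simp: supported_in_def)
  have [measurable]: "k \<in> borel_measurable borel" by (rule borel_measurable_continuous_onI[OF k(1)])
  note [measurable] = coord0_measurable[OF cc] borel_measurable_integrable[OF iter_integrable]
    measurable_\<mu>[OF borel_measurable_continuous_onI[OF Cr_fun_continuous[OF \<eta>C]]]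
  show "(\<lambda>n. corr (pushforward c \<eta> (\<lambda>x. k (x - u n))) j) \<longlonglongrightarrow>
      corr (pushforward c \<eta> (\<lambda>x. k (x - y))) j"
    unfolding birkhoff_term_def pushforward_coord0[OF c, of _ "\<lambda>x. k (x - _)"]
  proof (rule integral_dominated_convergence[where w = "\<lambda>p. \<bar>b\<bar> * \<bar>R (int_iter f j p)\<bar>"])
    show "integrable \<mu> (\<lambda>p. \<bar>b\<bar> * \<bar>R (int_iter f j p)\<bar>)"
      by (intro integrable_mult_right integrable_abs iter_integrable)
    have "(\<lambda>n. k (coord0 c p - u n)) \<longlonglongrightarrow> k (coord0 c p - y)" for p
      by (rule continuous_on_tendsto_compose[OF k(1)]) (auto intro!: tendsto_intros u)
    then show "AE p in \<mu>. (\<lambda>n. complex_of_real (\<eta> p) * k (coord0 c p - u n) * complex_of_real (R (int_iter f j p)))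
      \<longlonglongrightarrow> complex_of_real (\<eta> p) * k (coord0 c p - y) * complex_of_real (R (int_iter f j p))"
      by (auto intro!: AE_I2 tendsto_intros)
    have "norm (complex_of_real (\<eta> p) * k (coord0 c p - u n) * complex_of_real (R (int_iter f j p))) \<le> \<bar>b\<bar> * \<bar>R (int_iter f j p)\<bar>" for n p
    proof -
      have "norm (k (coord0 c p - u n)) \<le> \<bar>b\<bar>" using k(2)[of "coord0 c p - u n"] by linarith
      then have "\<bar>\<eta> p\<bar> * norm (k (coord0 c p - u n)) * \<bar>R (int_iter f j p)\<bar> \<le> 1 * \<bar>b\<bar> * \<bar>R (int_iter f j p)\<bar>"
        using \<eta>[of p] by (intro mult_mono) auto
      then show ?thesis by (simp add: norm_mult)
    qed
    then show "AE p in \<mu>. norm (complex_of_real (\<eta> p) * k (coord0 c p - u n) * complex_of_real (R (int_iter f j p))) \<le> \<bar>b\<bar> * \<bar>R (int_iter f j p)\<bar>" for n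
      by (auto intro!: AE_I2)
  qed measurable
qed

text \<open>The l-th piece is represented by y -> s times the sum of \<open>a l j y\<close> over j.
  The facts \<open>a1\<close> and \<open>a2\<close> are the mixing bound and the L1 bound of its
  terms, and \<open>sa\<close> combines them into a bound that is linear in l.\<close>

lemma coord_dist_log_besov:
  fixes \<psi>0 :: "real^'n \<Rightarrow> real"
  assumes c: "supported_in c \<eta>" and one: "\<And>q. q \<in> dom_of c \<Longrightarrow> \<omega> c q = 1" and \<eta>: "\<And>p. \<bar>\<eta> p\<bar> \<le> 1"
    and \<psi>0: "lp_cutoff \<psi>0" and \<sigma>: "index_ok \<sigma>"
  shows "coord_dist c \<eta> (birkhoff_sum s \<sigma>) \<in> log_besov \<psi>0 0 (-1)"
proof -
  obtain D where D: "0 \<le> D" "\<And>\<phi> M k. Ck_bounded \<phi> M \<Longrightarrow> 0 \<le> M \<Longrightarrow> norm (corr \<phi> (\<sigma> k)) \<le> D * M * exp (- C2) ^ k"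
    using corr_summable \<sigma> by metis
  obtain B where B: "0 \<le> B" "\<And>(\<theta> :: real^'n \<Rightarrow> complex) M. (\<And>k. Ck_on k UNIV \<theta>) \<Longrightarrow>
     (\<And>is y. length is \<le> K \<Longrightarrow> norm (partials is \<theta> y) \<le> M) \<Longrightarrow>
     Ck_bounded (pushforward c \<eta> \<theta>) (B * M)"
    using pushforward_Ck_bounded[OF c] by blast
  obtain C where C: "0 \<le> C" "\<And>l y. (\<integral>\<^sup>+x. ennreal (norm (kernel (lp_piece \<psi>0 l) (x - y))) \<partial>lborel) \<le> ennreal C"
    using kernel_L1_bound[OF \<psi>0] by blast
  define q where "q = exp (- C2)"
  have q: "0 < q" "q < 1" using C12 by (auto simp: q_def)
  \<comment> \<open>\<open>Q\<close> and the power of 4 are the constants of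
    \<open>norm_partials_kernel_le\<close>; the factor \<open>B\<close> transports the kernel bound
    to the charts of \<open>S\<close>, and \<open>D\<close> comes from the decay of
    correlations.\<close>
  define Q where "Q = (2::real) ^ (K + CARD('n))"
  define d where "d = D * (B * 4 ^ (K + CARD('n)))"
  have Q: "0 < Q" and d: "0 \<le> d" using D(1) B(1) by (auto simp: Q_def d_def)
  \<comment> \<open>The number of extra indices per scale: N steps of mixing compensate one doubling
    of the frequency, since q^N < 1 / Q.\<close>
  obtain N where N: "q ^ N < 1 / Q" using real_arch_pow_inv[of "1 / Q" q] Q q by auto
  then have QN: "Q * q ^ N \<le> 1" using Q by (simp add: field_simps)
  define k where "k l = kernel (lp_piece \<psi>0 l)" for l
  define a where "a l j y = corr (pushforward c \<eta> (\<lambda>x. k l (x - y))) (\<sigma> j)" for l j y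
  have a1: "norm (a l j y) \<le> d * Q ^ l * q ^ j" for l j y
  proof -
    have "Ck_bounded (pushforward c \<eta> (\<lambda>x. k l (x - y))) (B * (4 ^ (K + CARD('n)) * Q ^ l))"
      unfolding k_def Q_def
      by (rule B(2)[of "\<lambda>x. kernel (lp_piece \<psi>0 l) (x - y)", OF Ck_on_kernel[OF \<psi>0] norm_partials_kernel_le[OF \<psi>0]])
    from D(2)[OF this, of j] show ?thesis using B(1) Q by (simp add: a_def d_def q_def mult_ac)
  qed
  have a2: "norm (a l j y) \<le> \<bar>B0\<bar> * C" for l j y
    unfolding a_def k_def
    by (rule corr_L1_bound[OF c one \<eta>, of "\<lambda>x. kernel (lp_piece \<psi>0 l) (x - y)", OF _ Ck_on_kernel[OF \<psi>0] C(2,1)])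
  have sa: "summable (\<lambda>j. norm (a l j y))" "(\<Sum>j. norm (a l j y)) \<le> real (l * N) * (\<bar>B0\<bar> * C) + d / (1 - q)" for l y
    using suminf_min_geometric_bound[of "\<lambda>j. norm (a l j y)" "\<bar>B0\<bar> * C" d Q l q N,
        OF a2 a1 norm_ge_zero q less_imp_le[OF Q] QN d] by auto
  define g where "g l y = s * (\<Sum>j. a l j y)" for l y
  have kc: "continuous_on UNIV (k l)" for l
    using Ck_on_continuous[OF Ck_on_kernel[OF \<psi>0, of 0 l 0]] by (simp add: k_def)
  have kb: "norm (k l z) \<le> 4 ^ (0 + CARD('n)) * (2 ^ (0 + CARD('n))) ^ l" for l z
    using norm_partials_kernel_le[OF \<psi>0, of "[]" 0 l 0 z] by (simp add: k_def)
  have ac: "continuous_on UNIV (a l j)" for l j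
    unfolding a_def by (rule corr_translate_continuous[OF c kc kb \<eta>])
  have geo: "summable (\<lambda>j. e * q ^ j)" for e using q by (intro summable_mult summable_geometric) simp
  \<comment> \<open>For a fixed l the geometric bound \<open>a1\<close> is uniform in
    \<open>y\<close>, so the series converges uniformly and its sum is continuous.\<close>
  have gc: "continuous_on UNIV (g l)" for l
  proof -
    have "uniform_limit UNIV (\<lambda>n y. \<Sum>j<n. a l j y) (\<lambda>y. \<Sum>j. a l j y) sequentially"
      by (rule Weierstrass_m_test[OF a1 geo])
    then have "continuous_on UNIV (\<lambda>y. \<Sum>j. a l j y)"
      by (rule uniform_limit_theorem[rotated]) (auto intro!: always_eventually continuous_on_sum ac)
    then show ?thesis unfolding g_def by (intro continuous_intros)
  qed
  have gb: "norm (g l y) \<le> norm s * (real (l * N) * (\<bar>B0\<bar> * C) + d / (1 - q))" for l y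
    unfolding g_def norm_mult by (intro mult_left_mono order_trans[OF summable_norm[OF sa(1)] sa(2)]) auto
  have rep: "represented_by (multiplier (lp_piece \<psi>0 l) (coord_dist c \<eta> (birkhoff_sum s \<sigma>))) (g l)" for l
    unfolding represented_by_def
  proof (intro conjI ballI gc)
    fix \<phi> :: "real^'n \<Rightarrow> complex" assume "\<phi> \<in> schwartz"
    then have \<phi>: "integrable lborel \<phi>" by (rule schwartz_integrable)
    note [measurable] = borel_measurable_integrable[OF \<phi>]
    have mult_int: "integrable lborel (\<lambda>y. h y * \<phi> y)"
      if h: "continuous_on UNIV h" "\<And>y. norm (h y) \<le> e" for h :: "real^'n \<Rightarrow> complex" and e
    proof (rule Bochner_Integration.integrable_bound[OF integrable_mult_right[OF integrable_norm[OF \<phi>], of e]])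
      have [measurable]: "h \<in> borel_measurable borel" using h(1) by (rule borel_measurable_continuous_onI)
      show "(\<lambda>y. h y * \<phi> y) \<in> borel_measurable lborel" by measurable
      have "norm (h y) \<le> \<bar>e\<bar>" for y using h(2)[of y] by linarith
      then show "AE y in lborel. norm (h y * \<phi> y) \<le> norm (e * norm (\<phi> y))"
        by (auto simp: norm_mult abs_mult intro!: mult_right_mono)
    qed
    show "integrable lborel (\<lambda>y. g l y * \<phi> y)" by (rule mult_int[OF gc gb])
    have int: "integrable lborel (\<lambda>y. a l j y * \<phi> y)" for j by (rule mult_int[OF ac a1])
    have "multiplier (lp_piece \<psi>0 l) (coord_dist c \<eta> (birkhoff_sum s \<sigma>)) \<phi>
       = coord_dist c \<eta> (birkhoff_sum s \<sigma>) (fourier (\<lambda>\<xi>. of_real (lp_piece \<psi>0 l \<xi>) * inv_fourier \<phi> \<xi>))"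
      by (simp add: multiplier_def dist_inv_fourier_def dist_times_def dist_fourier_def)
    also have "fourier (\<lambda>\<xi>. of_real (lp_piece \<psi>0 l \<xi>) * inv_fourier \<phi> \<xi>) = (\<lambda>x. \<integral>y. k l (x - y) * \<phi> y \<partial>lborel)"
      unfolding k_def using fourier_inv_fourier_eq[OF lp_piece_bounded_supp[OF \<psi>0] _ \<phi>] by (intro ext) simp
    also have "coord_dist c \<eta> (birkhoff_sum s \<sigma>) \<dots> = s * (\<Sum>j. \<integral>y. a l j y * \<phi> y \<partial>lborel)"
      unfolding coord_dist_def birkhoff_sum_def corr_convolution[OF c kc kb \<phi> \<eta>] a_def ..
    \<comment> \<open>Sum and integral may be exchanged because \<open>a1\<close> makes the L1 norms
      of the terms geometric in j for fixed l.\<close>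
    also have "(\<Sum>j. \<integral>y. a l j y * \<phi> y \<partial>lborel) = (\<integral>y. (\<Sum>j. a l j y * \<phi> y) \<partial>lborel)"
    proof (rule integral_suminf[symmetric, OF int])
      show "AE y in lborel. summable (\<lambda>j. norm (a l j y * \<phi> y))"
        unfolding norm_mult by (intro AE_I2 summable_mult2 sa)
      have b: "norm (\<integral>y. norm (a l j y * \<phi> y) \<partial>lborel) \<le> (d * Q ^ l * (\<integral>y. norm (\<phi> y) \<partial>lborel)) * q ^ j" for j
      proof -
        have "(\<integral>y. norm (a l j y * \<phi> y) \<partial>lborel) \<le> (\<integral>y. (d * Q ^ l * q ^ j) * norm (\<phi> y) \<partial>lborel)"
          using a1 by (intro integral_mono integrable_norm int integrable_mult_right \<phi>)
            (auto simp: norm_mult intro!: mult_right_mono)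
        moreover have "0 \<le> (\<integral>y. norm (a l j y * \<phi> y) \<partial>lborel)" by (rule Bochner_Integration.integral_nonneg) simp
        ultimately show ?thesis by (simp add: mult_ac)
      qed
      show "summable (\<lambda>j. \<integral>y. norm (a l j y * \<phi> y) \<partial>lborel)"
        by (rule summable_comparison_test[OF _ geo]) (use b in blast)
    qed
    also have "\<dots> = (\<integral>y. (\<Sum>j. a l j y) * \<phi> y \<partial>lborel)"
      by (intro Bochner_Integration.integral_cong refl suminf_mult2[symmetric] summable_norm_cancel[OF sa(1)])
    also have "s * \<dots> = (\<integral>y. g l y * \<phi> y \<partial>lborel)"
      unfolding g_def mult.assoc by (rule integral_mult_right_zero[symmetric])
    finally show "multiplier (lp_piece \<psi>0 l) (coord_dist c \<eta> (birkhoff_sum s \<sigma>)) \<phi> = (\<integral>y. g l y * \<phi> y \<partial>lborel)" .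
  qed
  have "2 powr (real l * 0) * (1 + real l) powr (-1) * norm (g l y) \<le> norm s * (real N * (\<bar>B0\<bar> * C) + d / (1 - q))" for l y
  proof -
    have "0 \<le> \<bar>B0\<bar> * C" "0 \<le> d / (1 - q)" using C(1) d q by auto
    \<comment> \<open>The part that grows with l and the part that does not are absorbed into one
      multiple of 1 + l, the reciprocal of the Besov weight.\<close>
    then have "real (l * N) * (\<bar>B0\<bar> * C) + d / (1 - q) \<le> (1 + real l) * (real N * (\<bar>B0\<bar> * C) + d / (1 - q))"
    proof -
      have "real (l * N) * X + Y \<le> (1 + real l) * (real N * X + Y)" if "0 \<le> X" "0 \<le> Y" for X Y :: real
      proof -
        have "(1 + real l) * (real N * X + Y) = real (l * N) * X + Y + (real N * X + real l * Y)"
          by (simp add: algebra_simps)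
        moreover have "0 \<le> real N * X + real l * Y" using that by simp
        ultimately show ?thesis by linarith
      qed
      then show ?thesis using \<open>0 \<le> \<bar>B0\<bar> * C\<close> \<open>0 \<le> d / (1 - q)\<close> .
    qed
    from mult_left_mono[OF this, of "norm s"] gb[of l y]
    have "norm (g l y) \<le> (1 + real l) * (norm s * (real N * (\<bar>B0\<bar> * C) + d / (1 - q)))"
      by (simp add: mult_ac)
    then show ?thesis by (simp add: powr_minus field_simps)
  qed
  with rep coord_dist_tempered[OF c \<sigma>] show ?thesis unfolding log_besov_def by blast
qed

lemma birkhoff_sum_log_besov_on:
  fixes \<psi>0 :: "real^'n \<Rightarrow> real"
  assumes \<psi>0: "lp_cutoff \<psi>0" and \<sigma>: "index_ok \<sigma>"
  shows "birkhoff_sum s \<sigma> \<in> log_besov_on r A \<omega> \<psi>0 0 (-1)"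
proof -
  have "coord_dist c \<eta> (birkhoff_sum s \<sigma>) \<in> log_besov \<psi>0 0 (-1)"
    if S': "volume_chart_system r A \<omega> S'" and c: "(c, \<eta>) \<in> set S'" for S' c \<eta>
  proof (rule coord_dist_log_besov[OF _ _ _ \<psi>0 \<sigma>])
    have *: "c \<in> charts r A \<and> \<eta> \<in> Cr_fun r A \<and> (\<forall>p. 0 \<le> \<eta> p) \<and> support \<eta> \<subseteq> dom_of c"
      "\<forall>p\<in>dom_of c. \<omega> c p = 1" if "(c, \<eta>) \<in> set S'" for c \<eta>
      using S' that unfolding volume_chart_system_def chart_system_def by blast+
    show "supported_in c \<eta>" using *(1)[OF c] by (simp add: supported_in_def)
    show "\<omega> c q = 1" if "q \<in> dom_of c" for q using *(2)[OF c] that by blast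
    \<comment> \<open>A member of a partition of unity is at most 1, because all members are
      nonnegative and add up to 1.\<close>
    show "\<bar>\<eta> p\<bar> \<le> 1" for p
    proof -
      have "\<eta> p \<le> (\<Sum>(c, \<eta>)\<leftarrow>S'. \<eta> p)"
        by (rule member_le_sum_list) (use c *(1) in \<open>force+\<close>)
      then show ?thesis using S' *(1)[OF c] by (simp add: volume_chart_system_def chart_system_def)
    qed
  qed
  then show ?thesis
    using birkhoff_sum_distribution[OF \<sigma>] volume_charts unfolding log_besov_on_def by blast
qed

lemma birkhoff_convergent:
  assumes "\<phi> \<in> Cr_fun r A"
  shows "birkhoff_convergent \<mu> f R \<phi>" "birkhoff_convergent \<mu> f R (\<phi> \<circ> inv f)"
  unfolding birkhoff_convergent_def corr_shift[OF assms]
  by (intro conjI corr_summable_Cr[OF assms]; simp add: index_ok_def)+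

text \<open>By \<open>corr_shift\<close>, composing the test function with f^(-1) moves every index
  j to j + 1. In each difference all terms cancel except the one with j = 0, which is the integral
  of R \<phi>; for \<open>u_alpha\<close> the outer minus sign makes it come out positive.\<close>

lemma weak_solutions: "weak_solution r A \<mu> f R (u_omega \<mu> f R)" "weak_solution r A \<mu> f R (u_alpha \<mu> f R)"
  unfolding weak_solution_def
proof (safe)
  fix \<phi> :: "'m \<Rightarrow> complex" assume \<phi>: "\<phi> \<in> Cr_fun r A"
  have zero: "corr \<phi> 0 = (\<integral>x. of_real (R x) * \<phi> x \<partial>\<mu>)"
    by (simp add: birkhoff_term_def int_iter_def mult.commute)
  have "summable (\<lambda>k. corr \<phi> (- int k))" by (rule corr_summable_Cr[OF \<phi>]) (simp add: index_ok_def)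
  from suminf_split_head[OF this]
  show "u_omega \<mu> f R (\<phi> \<circ> inv f) - u_omega \<mu> f R \<phi> = (\<integral>x. of_real (R x) * \<phi> x \<partial>\<mu>)"
    unfolding zero[symmetric] u_omega_def corr_shift[OF \<phi>] by (simp add: algebra_simps)
  have "summable (\<lambda>k. corr \<phi> (int k))" by (rule corr_summable_Cr[OF \<phi> index_ok_alpha])
  from suminf_split_head[OF this]
  show "u_alpha \<mu> f R (\<phi> \<circ> inv f) - u_alpha \<mu> f R \<phi> = (\<integral>x. of_real (R x) * \<phi> x \<partial>\<mu>)"
    unfolding zero[symmetric] u_alpha_def corr_shift[OF \<phi>] by (simp add: algebra_simps)
qed

end

text \<open>Convergence is the first conjunct because \<open>suminf\<close> denotes some number even
  for a divergent series. It covers \<phi> and \<phi> o f^(-1), the two arguments that occur in the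
  weak equation.\<close>

theorem theorem1:
  fixes A :: "('m::{t2_space, second_countable_topology}, 'n::finite) chart set"
    and \<omega> :: "('m, 'n) chart \<Rightarrow> 'm \<Rightarrow> real"
    and \<mu> :: "'m measure"
    and f :: "'m \<Rightarrow> 'm"
    and R :: "'m \<Rightarrow> real"
    and S :: "(('m, 'n) chart \<times> ('m \<Rightarrow> real)) list"
    and \<psi>0 :: "real^'n \<Rightarrow> real"
    and r :: enat
    and \<gamma> C1 C2 :: real
  assumes "1 \<le> r"
    and "compact (UNIV :: 'm set)"
    and "Cr_atlas r A"
    and "smooth_volume_form r A \<omega>"
    and "volume_measure r A \<omega> \<mu>"
    and "bij f"
    and "f \<in> measurable \<mu> \<mu>"
    and "inv f \<in> measurable \<mu> \<mu>"
    and "distr \<mu> \<mu> f = \<mu>"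
    and "integrable \<mu> R"
    and "\<exists>B. AE x in \<mu>. \<bar>R x\<bar> \<le> B"
    and "(\<integral>x. R x \<partial>\<mu>) = 0"
    and "chart_system r A S"
    and "0 < \<gamma>"
    and "ereal \<gamma> \<le> ereal_of_enat r"
    and "0 < C1"
    and "0 < C2"
    and "\<forall>\<phi> :: 'm \<Rightarrow> real. \<phi> \<in> Cr_fun r A \<longrightarrow>
           (\<forall>j :: int. \<bar>\<integral>x. R (int_iter f j x) * \<phi> x \<partial>\<mu>\<bar>
              \<le> C1 * exp (- C2 * \<bar>real_of_int j\<bar>) * holder_norm_on S \<gamma> \<phi>)"
    and "lp_cutoff \<psi>0"
  shows "(\<forall>\<phi>\<in>Cr_fun r A. birkhoff_convergent \<mu> f R \<phi> \<and> birkhoff_convergent \<mu> f R (\<phi> \<circ> inv f)) \<and>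
         u_omega \<mu> f R \<in> log_besov_on r A \<omega> \<psi>0 0 (-1) \<and>
         u_alpha \<mu> f R \<in> log_besov_on r A \<omega> \<psi>0 0 (-1) \<and>
         weak_solution r A \<mu> f R (u_omega \<mu> f R) \<and>
         weak_solution r A \<mu> f R (u_alpha \<mu> f R)"
proof -
  interpret compact_manifold A r using assms(2,3) by unfold_locales
  obtain B0 where B0: "AE x in \<mu>. \<bar>R x\<bar> \<le> B0" using assms(11) by blast
  interpret mixing_system A r \<omega> \<mu> f R S \<gamma> C1 C2 B0
  proof unfold_locales
    show "\<exists>S. volume_chart_system r A \<omega> S"
      by (rule volume_chart_system_exists[OF assms(19,4)])
  qed (use assms(5-10,13-18) B0 in auto)
  show ?thesis
    using birkhoff_convergent weak_solutions birkhoff_sum_log_besov_on[OF assms(19)] index_ok_omega index_ok_alpha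
    unfolding u_omega_eq u_alpha_eq by blast
qed

end
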